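(* Let $\mathcal I\neq(0)$ be a monomial ideal in $\mathbb C\langle x_1,\dots,x_d\rangle$ with associated C*-correspondence ${}_AE_A$. Then $\mathcal O_E$ is the universal C*-algebra generated by $d$ partial isometries $s_1,\dots,s_d$ such that (i) the mapping $T_\mu^*T_\mu\mapsto s_\mu^*s_\mu$ ($\mu\in\mathbb F_+^d$) extends to a $*$-representation of $A$; (ii) $s_j^*s_i=\delta_{i,j}s_i^*s_i$ for all $i,j$; (iii) $s_\mu^*s_\mu s_is_i^*=s_is_i^*s_\mu^*s_\mu$ for all $\mu\in\Lambda^*$ and $i=1,\dots,d$; (iv) $I-s_{\mu_1}^*s_{\mu_1}\cdots s_{\mu_d}^*s_{\mu_d}=\sum_{i=1}^ds_is_i^*$ for some (and hence for every) $d$-tuple of words $\mu_1,\dots,\mu_d\in\Lambda^*$ such that $\mu_ii\notin\Lambda^*$ for all $i=1,\dots,d$; or $I=\sum_{i=1}^ds_is_i^*$ if no such $d$-tuple of words exists.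
   Context: $\mathbb F_+^d$ is the free monoid of words in $\{1,\dots,d\}$, with empty word $\emptyset$; for $\mu=\mu_1\cdots\mu_n$ put $x^\mu=x_{\mu_1}\cdots x_{\mu_n}$ in the ring $\mathbb C\langle x_1,\dots,x_d\rangle$ of polynomials in noncommuting variables. A monomial ideal is a two-sided ideal generated by monomials; throughout, monomial ideals are generated by monomials of degree at least 2. For a monomial ideal $\mathcal I$ put $\Lambda^*=\{\mu\in\mathbb F_+^d: x^\mu\notin\mathcal I\}$. $\mathcal F_X$ is the Hilbert space with orthonormal basis $\{e_\mu:\mu\in\Lambda^*\}$, and $T_ie_\nu=e_{i\nu}$ if $i\nu\in\Lambda^*$, $T_ie_\nu=0$ otherwise. Put $T_\mu=T_{\mu_1}\cdots T_{\mu_n}$ (so $T_\mu=0$ exactly when $\mu\notin\Lambda^*$), $T_\emptyset=I$; similarly $s_\mu=s_{\mu_1}\cdots s_{\mu_n}$, $s_\emptyset=I$. $A=C^*(T_\mu^*T_\mu:\mu\in\Lambda^* )$ is unital and commutative, and $E=\overline{\mathrm{span}}\{T_ia: a\in A,\ i=1,\dots,d\}$ is a C*-correspondence over $A$ with $a\cdot\xi\cdot b=a\xi b$, $\langle\xi,\eta\rangle=\xi^*\eta$ and left action $\phi_E:A\to\mathcal L(E)$. A representation $(\pi,t)$ of $E$ consists of a $*$-representation $\pi$ of $A$ on a Hilbert space $H$ and a linear map $t:E\to B(H)$ with $t(\xi)^*t(\eta)=\pi(\langle\xi,\eta\rangle)$ and $\pi(a)t(\xi)=t(\phi_E(a)\xi)$;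 it induces $\psi_t:\mathcal K(E)\to B(H)$, $\psi_t(\Theta_{\xi,\eta})=t(\xi)t(\eta)^*$. The Cuntz–Pimsner algebra $\mathcal O_E$ is the universal C*-algebra generated by $A$ and $E$ for representations satisfying $\pi(a)=\psi_t(\phi_E(a))$ for all $a\in J_E=(\ker\phi_E)^\perp\cap\phi_E^{-1}(\mathcal K(E))$. The universal generator $s_i$ corresponds to the copy of $T_i\in E$ in $\mathcal O_E$. *)

theory Defs
  imports
    "HOL-Analysis.Analysis"
    "HOL-Algebra.Algebraic_Closure_Type"
    "HOL-Library.Poly_Mapping"
begin

section \<open>C*-algebras\<close>

text \<open>
  Everything is carrier based, in the style of HOL-Algebra, so that the algebras and Hilbert
  spaces may depend on parameters. As usual there, the fields \<open>mult\<close> and \<open>one\<close> of a \<open>module\<close>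
  record are meaningless when the record is used as a vector space.
\<close>

abbreviation Cx :: "complex ring" where
  "Cx \<equiv> ring_of_type_algebra"

record 'a cstar = "(complex, 'a) module" +
  adj :: "'a \<Rightarrow> 'a"
  nrm :: "'a \<Rightarrow> real"

text \<open>The value off the carrier is irrelevant; it is fixed because \<open>Metric_space\<close> asks for
  nonnegativity and symmetry on the whole type.\<close>

definition ndist :: "('v, 'm) ring_scheme \<Rightarrow> ('v \<Rightarrow> real) \<Rightarrow> 'v \<Rightarrow> 'v \<Rightarrow> real" where
  "ndist V n x y = (if x \<in> carrier V \<and> y \<in> carrier V then n (x \<ominus>\<^bsub>V\<^esub> y) else 0)"

abbreviation norm_closed :: "('a, 'm) cstar_scheme \<Rightarrow> 'a set \<Rightarrow> bool" where
  "norm_closed B \<equiv> closedin (Metric_space.mtopology (carrier B) (ndist B (nrm B)))"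

text \<open>Unital C*-algebras; the zero algebra (with \<open>1 = 0\<close>) is allowed.\<close>

locale unital_cstar_algebra = ring B + Module.module Cx B
  for B :: "('a, 'm) cstar_scheme" (structure) +
  assumes smult_mult_left:
      "\<lbrakk>x \<in> carrier B; y \<in> carrier B\<rbrakk> \<Longrightarrow> (c \<odot> x) \<otimes> y = c \<odot> (x \<otimes> y)"
    and smult_mult_right:
      "\<lbrakk>x \<in> carrier B; y \<in> carrier B\<rbrakk> \<Longrightarrow> x \<otimes> (c \<odot> y) = c \<odot> (x \<otimes> y)"
    and adj_closed: "x \<in> carrier B \<Longrightarrow> adj B x \<in> carrier B"
    and adj_adj: "x \<in> carrier B \<Longrightarrow> adj B (adj B x) = x"
    and adj_add: "\<lbrakk>x \<in> carrier B; y \<in> carrier B\<rbrakk> \<Longrightarrow> adj B (x \<oplus> y) = adj B x \<oplus> adj B y"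
    and adj_smult: "x \<in> carrier B \<Longrightarrow> adj B (c \<odot> x) = cnj c \<odot> adj B x"
    and adj_mult: "\<lbrakk>x \<in> carrier B; y \<in> carrier B\<rbrakk> \<Longrightarrow> adj B (x \<otimes> y) = adj B y \<otimes> adj B x"
    and nrm_nonneg: "x \<in> carrier B \<Longrightarrow> 0 \<le> nrm B x"
    and nrm_eq_0: "x \<in> carrier B \<Longrightarrow> nrm B x = 0 \<longleftrightarrow> x = \<zero>"
    and nrm_triangle: "\<lbrakk>x \<in> carrier B; y \<in> carrier B\<rbrakk> \<Longrightarrow> nrm B (x \<oplus> y) \<le> nrm B x + nrm B y"
    and nrm_smult: "x \<in> carrier B \<Longrightarrow> nrm B (c \<odot> x) = cmod c * nrm B x"
    and nrm_mult: "\<lbrakk>x \<in> carrier B; y \<in> carrier B\<rbrakk> \<Longrightarrow> nrm B (x \<otimes> y) \<le> nrm B x * nrm B y"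
    and cstar_identity: "x \<in> carrier B \<Longrightarrow> nrm B (adj B x \<otimes> x) = (nrm B x)\<^sup>2"
    and complete: "Metric_space.mcomplete (carrier B) (ndist B (nrm B))"

text \<open>*-homomorphisms are not required to preserve the unit.\<close>

definition star_hom :: "('a, 'm) cstar_scheme \<Rightarrow> ('b, 'n) cstar_scheme \<Rightarrow> ('a \<Rightarrow> 'b) set" where
  "star_hom A B = {f \<in> carrier A \<rightarrow> carrier B.
     (\<forall>x\<in>carrier A. \<forall>y\<in>carrier A.
        f (x \<oplus>\<^bsub>A\<^esub> y) = f x \<oplus>\<^bsub>B\<^esub> f y \<and> f (x \<otimes>\<^bsub>A\<^esub> y) = f x \<otimes>\<^bsub>B\<^esub> f y) \<and>
     (\<forall>x\<in>carrier A. f (adj A x) = adj B (f x) \<and> (\<forall>c. f (c \<odot>\<^bsub>A\<^esub> x) = c \<odot>\<^bsub>B\<^esub> f x))}"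

definition closed_span :: "('a, 'm) cstar_scheme \<Rightarrow> 'a set \<Rightarrow> 'a set" where
  "closed_span B S = \<Inter>{V. S \<subseteq> V \<and> submodule V Cx B \<and> norm_closed B V}"

text \<open>The unit of the ambient algebra need not belong to a C*-subalgebra.\<close>

definition cstar_subalgebra :: "('a, 'm) cstar_scheme \<Rightarrow> 'a set \<Rightarrow> bool" where
  "cstar_subalgebra B V \<longleftrightarrow> submodule V Cx B \<and> norm_closed B V \<and>
     (\<forall>x\<in>V. adj B x \<in> V) \<and> (\<forall>x\<in>V. \<forall>y\<in>V. x \<otimes>\<^bsub>B\<^esub> y \<in> V)"

definition generated_cstar :: "('a, 'm) cstar_scheme \<Rightarrow> 'a set \<Rightarrow> 'a set" where
  "generated_cstar B S = \<Inter>{V. S \<subseteq> V \<and> cstar_subalgebra B V}"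

definition list_prod :: "('a, 'm) monoid_scheme \<Rightarrow> 'a list \<Rightarrow> 'a" where
  "list_prod B xs = foldr (mult B) xs (one B)"

definition word_prod :: "('a, 'm) monoid_scheme \<Rightarrow> ('i \<Rightarrow> 'a) \<Rightarrow> 'i list \<Rightarrow> 'a" where
  "word_prod B s \<mu> = list_prod B (map s \<mu>)"

text \<open>The element \<open>s\<^sub>\<mu>\<^sup>* s\<^sub>\<mu>\<close>.\<close>

definition source_proj :: "('a, 'm) cstar_scheme \<Rightarrow> ('i \<Rightarrow> 'a) \<Rightarrow> 'i list \<Rightarrow> 'a" where
  "source_proj B s \<mu> = adj B (word_prod B s \<mu>) \<otimes>\<^bsub>B\<^esub> word_prod B s \<mu>"

definition partial_isometry :: "('a, 'm) cstar_scheme \<Rightarrow> 'a \<Rightarrow> bool" where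
  "partial_isometry B v \<longleftrightarrow> v \<in> carrier B \<and> v \<otimes>\<^bsub>B\<^esub> adj B v \<otimes>\<^bsub>B\<^esub> v = v"

section \<open>Operators on Hilbert spaces and Hilbert modules\<close>

text \<open>
  The algebra of a set \<open>\<O>\<close> of operators on \<open>V\<close>, with pointwise vector space operations,
  composition, adjoints taken with respect to the (possibly algebra valued) inner product
  \<open>ip\<close>, and the operator norm for the norm \<open>n\<close> on \<open>V\<close>. Operators are
  extensional functions on \<open>carrier V\<close>.
\<close>

definition op_algebra ::
  "(complex, 'v, 'm) module_scheme \<Rightarrow> ('v \<Rightarrow> real) \<Rightarrow> ('v \<Rightarrow> 'v \<Rightarrow> 'c) \<Rightarrow> ('v \<Rightarrow> 'v) set
    \<Rightarrow> ('v \<Rightarrow> 'v) cstar" where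
  "op_algebra V n ip \<O> = \<lparr>
     carrier = \<O>,
     mult = compose (carrier V),
     one = (\<lambda>x\<in>carrier V. x),
     zero = (\<lambda>x\<in>carrier V. \<zero>\<^bsub>V\<^esub>),
     add = (\<lambda>S T. \<lambda>x\<in>carrier V. S x \<oplus>\<^bsub>V\<^esub> T x),
     smult = (\<lambda>c S. \<lambda>x\<in>carrier V. c \<odot>\<^bsub>V\<^esub> S x),
     adj = (\<lambda>S. THE S'. S' \<in> \<O> \<and> (\<forall>x\<in>carrier V. \<forall>y\<in>carrier V. ip (S x) y = ip x (S' y))),
     nrm = (\<lambda>S. SUP x\<in>{x \<in> carrier V. n x \<le> 1}. n (S x))\<rparr>"

text \<open>Inner products are conjugate linear in the first argument.\<close>

record 'h hilb = "(complex, 'h) module" +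
  cinner :: "'h \<Rightarrow> 'h \<Rightarrow> complex"

definition hnorm :: "('h, 'm) hilb_scheme \<Rightarrow> 'h \<Rightarrow> real" where
  "hnorm H x = sqrt (Re (cinner H x x))"

locale hilbert_space = Module.module Cx H for H :: "('h, 'm) hilb_scheme" (structure) +
  assumes cinner_add_right:
      "\<lbrakk>x \<in> carrier H; y \<in> carrier H; z \<in> carrier H\<rbrakk>
        \<Longrightarrow> cinner H x (y \<oplus> z) = cinner H x y + cinner H x z"
    and cinner_smult_right:
      "\<lbrakk>x \<in> carrier H; y \<in> carrier H\<rbrakk> \<Longrightarrow> cinner H x (c \<odot> y) = c * cinner H x y"
    and cinner_commute:
      "\<lbrakk>x \<in> carrier H; y \<in> carrier H\<rbrakk> \<Longrightarrow> cinner H y x = cnj (cinner H x y)"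
    and cinner_nonneg: "x \<in> carrier H \<Longrightarrow> 0 \<le> Re (cinner H x x)"
    and cinner_eq_0: "x \<in> carrier H \<Longrightarrow> cinner H x x = 0 \<longleftrightarrow> x = \<zero>"
    and hilbert_complete: "Metric_space.mcomplete (carrier H) (ndist H (hnorm H))"

definition bounded_ops :: "('h, 'm) hilb_scheme \<Rightarrow> ('h \<Rightarrow> 'h) cstar" where
  "bounded_ops H = op_algebra H (hnorm H) (cinner H)
     {S \<in> carrier H \<rightarrow>\<^sub>E carrier H.
        (\<forall>x\<in>carrier H. \<forall>y\<in>carrier H. S (x \<oplus>\<^bsub>H\<^esub> y) = S x \<oplus>\<^bsub>H\<^esub> S y) \<and>
        (\<forall>c. \<forall>x\<in>carrier H. S (c \<odot>\<^bsub>H\<^esub> x) = c \<odot>\<^bsub>H\<^esub> S x) \<and>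
        (\<exists>K. \<forall>x\<in>carrier H. hnorm H (S x) \<le> K * hnorm H x)}"

text \<open>The space \<open>\<ell>\<^sup>2(S)\<close>, whose vectors are functions vanishing off \<open>S\<close>.\<close>

definition ell2 :: "'i set \<Rightarrow> ('i \<Rightarrow> complex) hilb" where
  "ell2 S = \<lparr>
     carrier = {f. (\<forall>\<mu>. \<mu> \<notin> S \<longrightarrow> f \<mu> = 0) \<and> (\<lambda>\<mu>. (cmod (f \<mu>))\<^sup>2) summable_on S},
     mult = undefined,
     one = undefined,
     zero = (\<lambda>_. 0),
     add = (\<lambda>f g \<mu>. f \<mu> + g \<mu>),
     smult = (\<lambda>c f \<mu>. c * f \<mu>),
     cinner = (\<lambda>f g. \<Sum>\<^sub>\<infinity>\<mu>\<in>S. cnj (f \<mu>) * g \<mu>)\<rparr>"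

definition basis_vec :: "'i \<Rightarrow> 'i \<Rightarrow> complex" where
  "basis_vec \<mu> = (\<lambda>\<nu>. if \<nu> = \<mu> then 1 else 0)"

section \<open>C*-correspondences and Cuntz-Pimsner algebras\<close>

record ('a, 'e) correspondence = "(complex, 'e) module" +
  coeff :: "'a cstar"
  ract :: "'e \<Rightarrow> 'a \<Rightarrow> 'e"
  aip :: "'e \<Rightarrow> 'e \<Rightarrow> 'a"
  lact :: "'a \<Rightarrow> 'e \<Rightarrow> 'e"

definition enorm :: "('a, 'e, 'm) correspondence_scheme \<Rightarrow> 'e \<Rightarrow> real" where
  "enorm E \<xi> = sqrt (nrm (coeff E) (aip E \<xi> \<xi>))"

definition adjointable_ops :: "('a, 'e, 'm) correspondence_scheme \<Rightarrow> ('e \<Rightarrow> 'e) cstar" where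
  "adjointable_ops E = op_algebra E (enorm E) (aip E)
     {S \<in> carrier E \<rightarrow>\<^sub>E carrier E. \<exists>S' \<in> carrier E \<rightarrow>\<^sub>E carrier E.
        \<forall>\<xi>\<in>carrier E. \<forall>\<eta>\<in>carrier E. aip E (S \<xi>) \<eta> = aip E \<xi> (S' \<eta>)}"

definition rank_one :: "('a, 'e, 'm) correspondence_scheme \<Rightarrow> 'e \<Rightarrow> 'e \<Rightarrow> 'e \<Rightarrow> 'e" where
  "rank_one E \<xi> \<eta> = (\<lambda>\<zeta>\<in>carrier E. ract E \<xi> (aip E \<eta> \<zeta>))"

definition compact_ops :: "('a, 'e, 'm) correspondence_scheme \<Rightarrow> ('e \<Rightarrow> 'e) cstar" where
  "compact_ops E = adjointable_ops E\<lparr>carrier :=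
     closed_span (adjointable_ops E) {rank_one E \<xi> \<eta> | \<xi> \<eta>. \<xi> \<in> carrier E \<and> \<eta> \<in> carrier E}\<rparr>"

text \<open>The left action \<open>\<phi>\<^sub>E\<close> as a map into the adjointable operators.\<close>

definition left_op :: "('a, 'e, 'm) correspondence_scheme \<Rightarrow> 'a \<Rightarrow> 'e \<Rightarrow> 'e" where
  "left_op E a = (\<lambda>\<xi>\<in>carrier E. lact E a \<xi>)"

definition katsura_ideal :: "('a, 'e, 'm) correspondence_scheme \<Rightarrow> 'a set" where
  "katsura_ideal E = {a \<in> carrier (coeff E).
     left_op E a \<in> carrier (compact_ops E) \<and>
     (\<forall>b\<in>carrier (coeff E). left_op E b = \<zero>\<^bsub>adjointable_ops E\<^esub>
        \<longrightarrow> a \<otimes>\<^bsub>coeff E\<^esub> b = \<zero>\<^bsub>coeff E\<^esub>)}"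

text \<open>Representations in a C*-algebra \<open>B\<close>; representations on a Hilbert space \<open>H\<close> are the
  case \<open>B = bounded_ops H\<close>.\<close>

definition corr_rep ::
  "('a, 'e, 'm) correspondence_scheme \<Rightarrow> ('b, 'n) cstar_scheme \<Rightarrow> ('a \<Rightarrow> 'b) \<Rightarrow> ('e \<Rightarrow> 'b) \<Rightarrow> bool"
  where
  "corr_rep E B \<pi> t \<longleftrightarrow>
     \<pi> \<in> star_hom (coeff E) B \<and>
     t \<in> carrier E \<rightarrow> carrier B \<and>
     (\<forall>\<xi>\<in>carrier E. \<forall>\<eta>\<in>carrier E. t (\<xi> \<oplus>\<^bsub>E\<^esub> \<eta>) = t \<xi> \<oplus>\<^bsub>B\<^esub> t \<eta>) \<and>
     (\<forall>c. \<forall>\<xi>\<in>carrier E. t (c \<odot>\<^bsub>E\<^esub> \<xi>) = c \<odot>\<^bsub>B\<^esub> t \<xi>) \<and>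
     (\<forall>\<xi>\<in>carrier E. \<forall>\<eta>\<in>carrier E. adj B (t \<xi>) \<otimes>\<^bsub>B\<^esub> t \<eta> = \<pi> (aip E \<xi> \<eta>)) \<and>
     (\<forall>a\<in>carrier (coeff E). \<forall>\<xi>\<in>carrier E. \<pi> a \<otimes>\<^bsub>B\<^esub> t \<xi> = t (left_op E a \<xi>))"

text \<open>The map \<open>\<psi>\<^sub>t\<close> induced by \<open>t\<close> on the compact operators. It exists for every
  representation, and is unique because *-homomorphisms are continuous.\<close>

definition induced_on_compacts ::
  "('a, 'e, 'm) correspondence_scheme \<Rightarrow> ('b, 'n) cstar_scheme \<Rightarrow> ('e \<Rightarrow> 'b)
    \<Rightarrow> (('e \<Rightarrow> 'e) \<Rightarrow> 'b) \<Rightarrow> bool" where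
  "induced_on_compacts E B t \<psi> \<longleftrightarrow>
     \<psi> \<in> star_hom (compact_ops E) B \<and>
     (\<forall>\<xi>\<in>carrier E. \<forall>\<eta>\<in>carrier E. \<psi> (rank_one E \<xi> \<eta>) = t \<xi> \<otimes>\<^bsub>B\<^esub> adj B (t \<eta>))"

definition covariant_rep ::
  "('a, 'e, 'm) correspondence_scheme \<Rightarrow> ('b, 'n) cstar_scheme \<Rightarrow> ('a \<Rightarrow> 'b) \<Rightarrow> ('e \<Rightarrow> 'b) \<Rightarrow> bool"
  where
  "covariant_rep E B \<pi> t \<longleftrightarrow> corr_rep E B \<pi> t \<and>
     (\<exists>\<psi>. induced_on_compacts E B t \<psi> \<and> (\<forall>a\<in>katsura_ideal E. \<pi> a = \<psi> (left_op E a)))"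

text \<open>
  \<open>Q\<close>, with the copies \<open>\<pi>\<^sub>0\<close>, \<open>t\<^sub>0\<close> of the coefficient algebra and of \<open>E\<close>, is the
  Cuntz-Pimsner algebra of \<open>E\<close>. A definition cannot quantify over types, so the universal
  property is relative to the Hilbert spaces with vectors in \<open>'h\<close>; a theorem in which \<open>'h\<close> is
  free speaks about all of them. Uniqueness of \<open>\<rho>\<close> follows from generation.
  The definition is meant for a unital coefficient algebra acting unitally, where
  the Cuntz-Pimsner algebra is unital.
\<close>

definition cuntz_pimsner_algebra ::
  "'h itself \<Rightarrow> ('a, 'e, 'm) correspondence_scheme \<Rightarrow> 'q cstar \<Rightarrow> ('a \<Rightarrow> 'q) \<Rightarrow> ('e \<Rightarrow> 'q) \<Rightarrow> bool"
  where
  "cuntz_pimsner_algebra _ E Q \<pi>\<^sub>0 t\<^sub>0 \<longleftrightarrow>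
     unital_cstar_algebra Q \<and>
     covariant_rep E Q \<pi>\<^sub>0 t\<^sub>0 \<and>
     generated_cstar Q (\<pi>\<^sub>0 ` carrier (coeff E) \<union> t\<^sub>0 ` carrier E) = carrier Q \<and>
     (\<forall>(H :: 'h hilb) \<pi> t. hilbert_space H \<longrightarrow> covariant_rep E (bounded_ops H) \<pi> t \<longrightarrow>
        (\<exists>\<rho>\<in>star_hom Q (bounded_ops H).
           (\<forall>a\<in>carrier (coeff E). \<rho> (\<pi>\<^sub>0 a) = \<pi> a) \<and> (\<forall>\<xi>\<in>carrier E. \<rho> (t\<^sub>0 \<xi>) = t \<xi>)))"

section \<open>Monomial ideals\<close>

text \<open>\<open>\<complex>\<langle>x\<^sub>1, \<dots>, x\<^sub>d\<rangle>\<close> is the monoid algebra of the free monoid. The type \<open>fword\<close> carries the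
  concatenation monoid in additive notation, as the product of \<open>Poly_Mapping\<close> requires.\<close>

datatype 'a fword = FWord (letters: "'a list")

instantiation fword :: (type) monoid_add
begin
definition "0 = FWord []"
definition "u + v = FWord (letters u @ letters v)"
instance
  by standard (auto simp: zero_fword_def plus_fword_def)
end

definition words :: "nat \<Rightarrow> nat list set" where
  "words d = {\<mu>. set \<mu> \<subseteq> {1..d}}"

definition free_algebra :: "nat \<Rightarrow> (nat fword \<Rightarrow>\<^sub>0 complex) ring" where
  "free_algebra d = \<lparr>
     carrier = {p. \<forall>w\<in>Poly_Mapping.keys p. letters w \<in> words d},
     mult = (*), one = 1, zero = 0, add = (+)\<rparr>"

definition var :: "nat \<Rightarrow> nat fword \<Rightarrow>\<^sub>0 complex" where
  "var i = Poly_Mapping.single (FWord [i]) 1"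

definition monomial :: "nat list \<Rightarrow> nat fword \<Rightarrow>\<^sub>0 complex" where
  "monomial \<mu> = prod_list (map var \<mu>)"

lemma monomial_eq_single: "monomial \<mu> = Poly_Mapping.single (FWord \<mu>) 1"
proof (induction \<mu>)
  case Nil
  then show ?case
    by (simp add: monomial_def flip: zero_fword_def)
next
  case (Cons i \<mu>)
  then show ?case
    by (simp add: monomial_def var_def mult_single plus_fword_def)
qed

definition monomial_ideal :: "nat \<Rightarrow> (nat fword \<Rightarrow>\<^sub>0 complex) set \<Rightarrow> bool" where
  "monomial_ideal d I \<longleftrightarrow>
     (\<exists>M \<subseteq> {\<mu> \<in> words d. 2 \<le> length \<mu>}. I = Idl\<^bsub>free_algebra d\<^esub> (monomial ` M))"

definition allowed_words :: "nat \<Rightarrow> (nat fword \<Rightarrow>\<^sub>0 complex) set \<Rightarrow> nat list set" where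
  "allowed_words d I = {\<mu> \<in> words d. monomial \<mu> \<notin> I}"

section \<open>The correspondence of a monomial ideal\<close>

text \<open>In this section \<open>L\<close> stands for the set \<open>\<Lambda>\<^sup>*\<close> of allowed words.\<close>

definition shift :: "nat list set \<Rightarrow> nat \<Rightarrow> (nat list \<Rightarrow> complex) \<Rightarrow> nat list \<Rightarrow> complex" where
  "shift L i = (\<lambda>f\<in>carrier (ell2 L). \<lambda>\<mu>. case \<mu> of
     [] \<Rightarrow> 0 | j # \<nu> \<Rightarrow> if j = i \<and> \<mu> \<in> L then f \<nu> else 0)"

lemma basis_vec_in_ell2: "\<mu> \<in> S \<Longrightarrow> basis_vec \<mu> \<in> carrier (ell2 S)"
proof -
  assume "\<mu> \<in> S"
  have "(\<lambda>\<nu>. (cmod (basis_vec \<mu> \<nu>))\<^sup>2) summable_on S \<longleftrightarrow>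
      (\<lambda>\<nu>. (cmod (basis_vec \<mu> \<nu>))\<^sup>2) summable_on {\<mu>}"
    using \<open>\<mu> \<in> S\<close> by (intro summable_on_cong_neutral) (auto simp: basis_vec_def)
  then show ?thesis
    using \<open>\<mu> \<in> S\<close> by (auto simp: ell2_def basis_vec_def)
qed

lemma shift_basis_vec:
  assumes "\<nu> \<in> L"
  shows "shift L i (basis_vec \<nu>) = (if i # \<nu> \<in> L then basis_vec (i # \<nu>) else \<zero>\<^bsub>ell2 L\<^esub>)"
  using basis_vec_in_ell2[OF assms]
  by (auto simp: shift_def basis_vec_def ell2_def fun_eq_iff split: list.split)

definition coeff_algebra :: "nat list set \<Rightarrow> ((nat list \<Rightarrow> complex) \<Rightarrow> nat list \<Rightarrow> complex) cstar" where
  "coeff_algebra L = bounded_ops (ell2 L)\<lparr>carrier :=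
     generated_cstar (bounded_ops (ell2 L)) (source_proj (bounded_ops (ell2 L)) (shift L) ` L)\<rparr>"

definition monomial_correspondence :: "nat \<Rightarrow> nat list set \<Rightarrow>
    ((nat list \<Rightarrow> complex) \<Rightarrow> nat list \<Rightarrow> complex,
     (nat list \<Rightarrow> complex) \<Rightarrow> nat list \<Rightarrow> complex) correspondence" where
  "monomial_correspondence d L = (let F = bounded_ops (ell2 L) in \<lparr>
     carrier = closed_span F {shift L i \<otimes>\<^bsub>F\<^esub> a | i a. i \<in> {1..d} \<and> a \<in> carrier (coeff_algebra L)},
     mult = undefined,
     one = undefined,
     zero = zero F,
     add = add F,
     smult = smult F,
     coeff = coeff_algebra L,
     ract = (\<lambda>\<xi> a. \<xi> \<otimes>\<^bsub>F\<^esub> a),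
     aip = (\<lambda>\<xi> \<eta>. adj F \<xi> \<otimes>\<^bsub>F\<^esub> \<eta>),
     lact = (\<lambda>a \<xi>. a \<otimes>\<^bsub>F\<^esub> \<xi>)\<rparr>)"

section \<open>The relations\<close>

definition killing_tuple :: "nat \<Rightarrow> nat list set \<Rightarrow> (nat \<Rightarrow> nat list) \<Rightarrow> bool" where
  "killing_tuple d L \<mu> \<longleftrightarrow> (\<forall>i\<in>{1..d}. \<mu> i \<in> L \<and> \<mu> i @ [i] \<notin> L)"

definition relation_iv_at ::
  "nat \<Rightarrow> ('b, 'n) cstar_scheme \<Rightarrow> (nat \<Rightarrow> 'b) \<Rightarrow> (nat \<Rightarrow> nat list) \<Rightarrow> bool" where
  "relation_iv_at d B s \<mu> \<longleftrightarrow>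
     \<one>\<^bsub>B\<^esub> \<ominus>\<^bsub>B\<^esub> list_prod B (map (\<lambda>i. source_proj B s (\<mu> i)) [1..<Suc d]) =
       (\<Oplus>\<^bsub>B\<^esub>i\<in>{1..d}. s i \<otimes>\<^bsub>B\<^esub> adj B (s i))"

text \<open>Partial isometries \<open>s\<^sub>1, \<dots>, s\<^sub>d\<close> satisfying (i) to (iv), the last one for some tuple.\<close>

definition monomial_relations ::
  "nat \<Rightarrow> nat list set \<Rightarrow> ('b, 'n) cstar_scheme \<Rightarrow> (nat \<Rightarrow> 'b) \<Rightarrow> bool" where
  "monomial_relations d L B s \<longleftrightarrow>
     (\<forall>i\<in>{1..d}. partial_isometry B (s i)) \<and>
     (\<exists>\<pi>\<in>star_hom (coeff_algebra L) B. \<forall>\<mu>\<in>words d.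
        \<pi> (source_proj (bounded_ops (ell2 L)) (shift L) \<mu>) = source_proj B s \<mu>) \<and>
     (\<forall>i\<in>{1..d}. \<forall>j\<in>{1..d}.
        adj B (s j) \<otimes>\<^bsub>B\<^esub> s i = (if i = j then adj B (s i) \<otimes>\<^bsub>B\<^esub> s i else \<zero>\<^bsub>B\<^esub>)) \<and>
     (\<forall>\<mu>\<in>L. \<forall>i\<in>{1..d}.
        source_proj B s \<mu> \<otimes>\<^bsub>B\<^esub> (s i \<otimes>\<^bsub>B\<^esub> adj B (s i)) =
        (s i \<otimes>\<^bsub>B\<^esub> adj B (s i)) \<otimes>\<^bsub>B\<^esub> source_proj B s \<mu>) \<and>
     (if \<exists>\<mu>. killing_tuple d L \<mu>
      then \<exists>\<mu>. killing_tuple d L \<mu> \<and> relation_iv_at d B s \<mu>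
      else \<one>\<^bsub>B\<^esub> = (\<Oplus>\<^bsub>B\<^esub>i\<in>{1..d}. s i \<otimes>\<^bsub>B\<^esub> adj B (s i)))"

text \<open>\<open>Q\<close> is the universal C*-algebra generated by partial isometries \<open>\<sigma>\<^sub>1, \<dots>, \<sigma>\<^sub>d\<close> subject to
  the relations, tested on the Hilbert spaces with vectors in \<open>'h\<close>, as for
  \<open>cuntz_pimsner_algebra\<close>.\<close>

definition universal_for_relations ::
  "'h itself \<Rightarrow> nat \<Rightarrow> nat list set \<Rightarrow> 'q cstar \<Rightarrow> (nat \<Rightarrow> 'q) \<Rightarrow> bool" where
  "universal_for_relations _ d L Q \<sigma> \<longleftrightarrow>
     unital_cstar_algebra Q \<and>
     monomial_relations d L Q \<sigma> \<and>
     generated_cstar Q (\<sigma> ` {1..d}) = carrier Q \<and>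
     (\<forall>(H :: 'h hilb) s. hilbert_space H \<longrightarrow> monomial_relations d L (bounded_ops H) s \<longrightarrow>
        (\<exists>\<rho>\<in>star_hom Q (bounded_ops H). \<forall>i\<in>{1..d}. \<rho> (\<sigma> i) = s i))"

end

theory Submission
  imports Defs
begin

text \<open>
  Write \<open>L\<close> for the set of allowed words and \<open>P\<^sub>w = T\<^sub>w\<^sup>* T\<^sub>w\<close>. Everything rests on two facts about
  the concrete operators.

  First, \<open>P\<^sub>w\<close> is the diagonal projection onto the words \<open>\<nu>\<close> with \<open>w\<nu> \<in> L\<close>, so \<open>A\<close> consists of
  commuting diagonal operators (\<open>A_diagonal\<close>). They satisfy \<open>a T\<^sub>i = T\<^sub>i (T\<^sub>i\<^sup>* a T\<^sub>i)\<close> with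
  \<open>T\<^sub>i\<^sup>* a T\<^sub>i \<in> A\<close>, and \<open>\<Sum> T\<^sub>i T\<^sub>i\<^sup>* = 1 - vacuum\<close>, where \<open>vacuum\<close> projects onto the vector of the
  empty word.

  Secondly, every \<open>\<xi> \<in> E\<close> is the finite sum \<open>\<Sum> T\<^sub>i (T\<^sub>i\<^sup>* \<xi>)\<close> with coefficients in \<open>A\<close>
  (\<open>E_frame\<close>). With such a finite frame all adjointable operators are sums of rank one
  operators, \<open>A\<close> acts by compact operators, and both a representation \<open>t\<close> and the induced map
  on the compacts are given by finite sums, with no limits to take.

  The frame reduces the Cuntz-Pimsner relations to one equation. The kernel of the left action
  is spanned by \<open>vacuum\<close> if \<open>vacuum \<in> A\<close>, and is zero otherwise. If \<open>(\<mu>\<^sub>i)\<close> is a killing tuple, the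
  product of the \<open>P\<^bsub>\<mu>\<^sub>i\<^esub>\<close> is \<open>vacuum\<close>, whatever the tuple; if there is none, some letter \<open>i\<close> may
  follow every allowed word, so that elements of \<open>A\<close> agree at \<open>[]\<close> and \<open>[i]\<close>, and \<open>vacuum \<notin> A\<close>.
  Hence \<open>J\<^sub>E = A q\<close> for \<open>q = 1 - vacuum\<close> in the first case and \<open>q = 1\<close> in the second. As the left
  action of \<open>q\<close> is \<open>\<Sum> \<Theta>(T\<^sub>i, T\<^sub>i)\<close>, covariance says \<open>\<pi>(q) = \<Sum> s\<^sub>i s\<^sub>i\<^sup>*\<close>, and this is relation (iv)
  (\<open>covariant_rep_t\<close>, \<open>covariant_range_sum\<close>, \<open>relation_iv_at_iff\<close>).

  Given partial isometries with the relations, \<open>t(\<xi>) = \<Sum> s\<^sub>i \<pi>(T\<^sub>i\<^sup>* \<xi>)\<close> is a representation; the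
  point to check is \<open>\<pi>(a) s\<^sub>i = s\<^sub>i \<pi>(T\<^sub>i\<^sup>* a T\<^sub>i)\<close>, which (iii) gives for \<open>a = P\<^sub>w\<close> (\<open>p_s\<close>).
  Conversely the images of the \<open>T\<^sub>i\<close> under a covariant representation satisfy the relations.
  That they generate uses (iv) to recover the unit (\<open>generated_by_shifts\<close>).

  Passing from the generators \<open>P\<^sub>w\<close> to \<open>A\<close> requires continuity of *-homomorphisms on \<open>A\<close>. For
  diagonal operators this is elementary: a self-adjoint contraction \<open>h\<close> is the real part of the
  unitary \<open>h + i sqrt(1 - h\<^sup>2)\<close>, and unital *-homomorphisms preserve unitaries (\<open>hom_bounded\<close>,
  \<open>diagonal_sqrt\<close>).
\<close>

section \<open>Normed modules over the complex numbers and C*-algebras\<close>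

lemma Cx_simps [simp]:
  "carrier Cx = UNIV" "x \<otimes>\<^bsub>Cx\<^esub> y = x * y" "\<one>\<^bsub>Cx\<^esub> = 1" "\<zero>\<^bsub>Cx\<^esub> = 0" "x \<oplus>\<^bsub>Cx\<^esub> y = x + y"
  by (auto simp: ring_of_type_algebra_def)

lemma cring_Cx: "cring Cx"
  by (rule cring_from_type_algebra)

lemma Cx_uminus [simp]: "\<ominus>\<^bsub>Cx\<^esub> c = - c"
proof -
  interpret cring Cx by (rule cring_Cx)
  show ?thesis by (rule minus_equality) simp_all
qed

locale normed_module = Module.module Cx V
  for V :: "(complex, 'v, 'm) module_scheme" (structure) +
  fixes n :: "'v \<Rightarrow> real"
  assumes n_nonneg: "x \<in> carrier V \<Longrightarrow> 0 \<le> n x"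
    and n_eq_0: "x \<in> carrier V \<Longrightarrow> n x = 0 \<longleftrightarrow> x = \<zero>"
    and n_triangle: "\<lbrakk>x \<in> carrier V; y \<in> carrier V\<rbrakk> \<Longrightarrow> n (x \<oplus> y) \<le> n x + n y"
    and n_smult: "x \<in> carrier V \<Longrightarrow> n (c \<odot> x) = cmod c * n x"
begin

lemma smult_1 [simp]: "x \<in> carrier V \<Longrightarrow> 1 \<odot> x = x"
  using smult_one by simp

lemma smult_0 [simp]: "x \<in> carrier V \<Longrightarrow> 0 \<odot> x = \<zero>"
  using smult_l_null by simp

lemma smult_zero [simp]: "c \<odot> \<zero> = \<zero>"
  using smult_r_null by simp

lemma smult_in [simp, intro]: "x \<in> carrier V \<Longrightarrow> c \<odot> x \<in> carrier V"
  using smult_closed by simp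

lemma smult_smult: "x \<in> carrier V \<Longrightarrow> a \<odot> (b \<odot> x) = (a * b) \<odot> x"
  using smult_assoc1[of a b x] by simp

lemma smult_add_left: "x \<in> carrier V \<Longrightarrow> (a + b) \<odot> x = a \<odot> x \<oplus> b \<odot> x"
  using smult_l_distr[of a b x] by simp

lemma smult_add_right:
  "\<lbrakk>x \<in> carrier V; y \<in> carrier V\<rbrakk> \<Longrightarrow> a \<odot> (x \<oplus> y) = a \<odot> x \<oplus> a \<odot> y"
  using smult_r_distr[of a x y] by simp

lemma uminus_eq_smult: "x \<in> carrier V \<Longrightarrow> \<ominus> x = (- 1) \<odot> x"
  using smult_l_minus[of 1 x] by simp

lemma diff_eq_smult:
  "\<lbrakk>x \<in> carrier V; y \<in> carrier V\<rbrakk> \<Longrightarrow> x \<ominus> y = x \<oplus> (- 1) \<odot> y"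
  by (simp add: M.minus_eq uminus_eq_smult)

lemma n_uminus: "x \<in> carrier V \<Longrightarrow> n (\<ominus> x) = n x"
  by (simp add: uminus_eq_smult n_smult)

lemma n_zero [simp]: "n \<zero> = 0"
  by (simp add: n_eq_0)

lemma diff_add_diff:
  assumes "x \<in> carrier V" "y \<in> carrier V" "z \<in> carrier V"
  shows "(x \<ominus> y) \<oplus> (y \<ominus> z) = x \<ominus> z"
  using assms by (simp add: M.minus_eq M.a_assoc M.r_neg1)

lemma uminus_diff:
  assumes "x \<in> carrier V" "y \<in> carrier V"
  shows "\<ominus> (x \<ominus> y) = y \<ominus> x"
  using assms by (simp add: M.minus_eq M.minus_add M.a_comm)

lemma diff_add_cancel:
  assumes "x \<in> carrier V" "y \<in> carrier V"
  shows "(x \<ominus> y) \<oplus> y = x"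
  using assms by (simp add: M.minus_eq M.a_assoc M.l_neg)

lemma diff_zero [simp]: "x \<in> carrier V \<Longrightarrow> x \<ominus> \<zero> = x"
  by (simp add: M.minus_eq)

lemma n_diff_commute:
  assumes "x \<in> carrier V" "y \<in> carrier V"
  shows "n (x \<ominus> y) = n (y \<ominus> x)"
  using assms n_uminus[of "y \<ominus> x"] by (simp add: uminus_diff)

lemma n_diff_triangle:
  assumes "x \<in> carrier V" "y \<in> carrier V" "z \<in> carrier V"
  shows "n (x \<ominus> z) \<le> n (x \<ominus> y) + n (y \<ominus> z)"
  using assms n_triangle[of "x \<ominus> y" "y \<ominus> z"] by (simp add: diff_add_diff)

lemma n_diff_eq_0:
  assumes "x \<in> carrier V" "y \<in> carrier V"
  shows "n (x \<ominus> y) = 0 \<longleftrightarrow> x = y"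
  using assms diff_add_cancel[of x y] by (auto simp: n_eq_0 M.minus_eq M.r_neg)

lemma metric: "Metric_space (carrier V) (ndist V n)"
  unfolding Metric_space_def ndist_def
  using n_diff_triangle
  by (auto simp: n_nonneg n_diff_eq_0 n_diff_commute)

lemma closedin_iff:
  "closedin (Metric_space.mtopology (carrier V) (ndist V n)) S \<longleftrightarrow>
     S \<subseteq> carrier V \<and> (\<forall>x\<in>carrier V. (\<forall>e>0. \<exists>y\<in>S. n (x \<ominus> y) < e) \<longrightarrow> x \<in> S)"
proof -
  interpret Met: Metric_space "carrier V" "ndist V n" by (rule metric)
  have "disjnt S (Met.mball x r) \<longleftrightarrow> \<not> (\<exists>y\<in>S. n (x \<ominus> y) < r)"
    if "S \<subseteq> carrier V" "x \<in> carrier V" for x r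
    using that by (auto simp: disjnt_iff ndist_def)
  then show ?thesis
    unfolding Met.closedin_metric by (smt (verit) DiffD1 DiffD2 DiffI)
qed

lemma limitin_iff:
  "limitin (Metric_space.mtopology (carrier V) (ndist V n)) u x sequentially \<longleftrightarrow>
     x \<in> carrier V \<and> (\<forall>e>0. \<exists>N. \<forall>k\<ge>N. u k \<in> carrier V \<and> n (u k \<ominus> x) < e)"
proof -
  interpret Met: Metric_space "carrier V" "ndist V n" by (rule metric)
  show ?thesis
    unfolding Met.limit_metric_sequentially by (simp add: ndist_def cong: conj_cong)
qed

lemma mcomplete_iff:
  "Metric_space.mcomplete (carrier V) (ndist V n) \<longleftrightarrow>
     (\<forall>u::nat \<Rightarrow> 'v. range u \<subseteq> carrier V \<longrightarrow> (\<forall>e>0. \<exists>N. \<forall>k\<ge>N. \<forall>l\<ge>N. n (u k \<ominus> u l) < e) \<longrightarrow>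
       (\<exists>x\<in>carrier V. \<forall>e>0. \<exists>N. \<forall>k\<ge>N. n (u k \<ominus> x) < e))"
proof -
  interpret Met: Metric_space "carrier V" "ndist V n" by (rule metric)
  have "Met.MCauchy u \<longleftrightarrow> range u \<subseteq> carrier V \<and> (\<forall>e>0. \<exists>N. \<forall>k\<ge>N. \<forall>l\<ge>N. n (u k \<ominus> u l) < e)" for u
    unfolding Met.MCauchy_def by (simp add: ndist_def image_subset_iff cong: conj_cong)
  then show ?thesis
    unfolding Met.mcomplete_def limitin_iff by (simp add: image_subset_iff Bex_def imp_conjL)
qed

end

text \<open>The norm axioms of a unital C*-algebra: the common ground of abstract C*-algebras and
  of the algebras of bounded operators.\<close>

locale pre_cstar_algebra = normed_module B "nrm B" + ring B
  for B :: "('a, 'm) cstar_scheme" (structure) +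
  assumes smult_mult_left:
      "\<lbrakk>x \<in> carrier B; y \<in> carrier B\<rbrakk> \<Longrightarrow> (c \<odot> x) \<otimes> y = c \<odot> (x \<otimes> y)"
    and smult_mult_right:
      "\<lbrakk>x \<in> carrier B; y \<in> carrier B\<rbrakk> \<Longrightarrow> x \<otimes> (c \<odot> y) = c \<odot> (x \<otimes> y)"
    and adj_closed [simp, intro]: "x \<in> carrier B \<Longrightarrow> adj B x \<in> carrier B"
    and adj_adj [simp]: "x \<in> carrier B \<Longrightarrow> adj B (adj B x) = x"
    and adj_add: "\<lbrakk>x \<in> carrier B; y \<in> carrier B\<rbrakk> \<Longrightarrow> adj B (x \<oplus> y) = adj B x \<oplus> adj B y"
    and adj_smult: "x \<in> carrier B \<Longrightarrow> adj B (c \<odot> x) = cnj c \<odot> adj B x"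
    and adj_mult: "\<lbrakk>x \<in> carrier B; y \<in> carrier B\<rbrakk> \<Longrightarrow> adj B (x \<otimes> y) = adj B y \<otimes> adj B x"
    and nrm_mult: "\<lbrakk>x \<in> carrier B; y \<in> carrier B\<rbrakk> \<Longrightarrow> nrm B (x \<otimes> y) \<le> nrm B x * nrm B y"
    and cstar_identity: "x \<in> carrier B \<Longrightarrow> nrm B (adj B x \<otimes> x) = (nrm B x)\<^sup>2"

lemma unital_cstar_algebra_imp_pre:
  fixes B :: "('a, 'm) cstar_scheme" (structure)
  assumes "unital_cstar_algebra B"
  shows "pre_cstar_algebra B"
proof -
  interpret unital_cstar_algebra B by fact
  show ?thesis
    by unfold_locales
      (simp_all add: nrm_nonneg nrm_eq_0 nrm_triangle nrm_smult smult_mult_left smult_mult_right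
        adj_closed adj_adj adj_add adj_smult adj_mult nrm_mult cstar_identity)
qed


context normed_module
begin

abbreviation closed_set :: "'v set \<Rightarrow> bool" where
  "closed_set \<equiv> closedin (Metric_space.mtopology (carrier V) (ndist V n))"

lemma closed_set_zero: "closed_set {\<zero>}"
  unfolding closedin_iff
proof (intro conjI ballI impI)
  fix x assume x: "x \<in> carrier V" and "\<forall>e>0. \<exists>y\<in>{\<zero>}. n (x \<ominus> y) < e"
  then have "\<forall>e>0. n x < e" by simp
  then have "n x \<le> 0" by (meson dense not_le order_less_asym)
  then show "x \<in> {\<zero>}" using n_nonneg[OF x] n_eq_0[OF x] by simp
qed simp

lemma closed_set_carrier: "closed_set (carrier V)"
  by (simp add: closedin_iff)

lemma submodule_iff:
  "submodule S Cx V \<longleftrightarrow> S \<subseteq> carrier V \<and> \<zero> \<in> S \<and>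
     (\<forall>x\<in>S. \<forall>y\<in>S. x \<oplus> y \<in> S) \<and> (\<forall>c. \<forall>x\<in>S. c \<odot> x \<in> S)"
proof
  assume S: "submodule S Cx V"
  note submodule.smult_closed[OF S] subgroup.one_closed[OF submodule.axioms(1)[OF S]]
  then show "S \<subseteq> carrier V \<and> \<zero> \<in> S \<and>
     (\<forall>x\<in>S. \<forall>y\<in>S. x \<oplus> y \<in> S) \<and> (\<forall>c. \<forall>x\<in>S. c \<odot> x \<in> S)"
    using submoduleE[OF S] by simp
next
  assume "S \<subseteq> carrier V \<and> \<zero> \<in> S \<and>
     (\<forall>x\<in>S. \<forall>y\<in>S. x \<oplus> y \<in> S) \<and> (\<forall>c. \<forall>x\<in>S. c \<odot> x \<in> S)"
  then show "submodule S Cx V"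
    by (intro submoduleI) (auto simp: uminus_eq_smult subset_iff)
qed

lemma n_finsum_le:
  assumes "finite J" "\<And>i. i \<in> J \<Longrightarrow> f i \<in> carrier V"
  shows "n (\<Oplus>i\<in>J. f i) \<le> (\<Sum>i\<in>J. n (f i))"
  using assms
proof (induction J)
  case (insert x J)
  then have c: "f x \<in> carrier V" "(\<Oplus>i\<in>J. f i) \<in> carrier V" by (auto intro: M.finsum_closed)
  have "n (\<Oplus>i\<in>insert x J. f i) = n (f x \<oplus> (\<Oplus>i\<in>J. f i))"
    using insert by (subst M.finsum_insert) auto
  also have "\<dots> \<le> n (f x) + n (\<Oplus>i\<in>J. f i)" using c by (rule n_triangle)
  also have "\<dots> \<le> n (f x) + (\<Sum>i\<in>J. n (f i))" using insert by simp
  finally show ?case using insert by simp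
qed simp

lemma finsum_in_submodule:
  assumes "submodule S Cx V" "finite J" "\<And>i. i \<in> J \<Longrightarrow> f i \<in> S"
  shows "(\<Oplus>i\<in>J. f i) \<in> S"
  using assms(2,3)
proof (induction J)
  case empty
  then show ?case using assms(1) by (simp add: submodule_iff)
next
  case (insert x J)
  then show ?case
    using assms(1) by (subst M.finsum_insert) (auto simp: submodule_iff subset_iff Pi_iff)
qed

lemma finsum_single:
  assumes "finite J" "i \<in> J" "\<And>j. j \<in> J \<Longrightarrow> f j \<in> carrier V"
    "\<And>j. j \<in> J \<Longrightarrow> j \<noteq> i \<Longrightarrow> f j = \<zero>"
  shows "(\<Oplus>j\<in>J. f j) = f i"
proof -
  have "(\<Oplus>j\<in>J. f j) = (\<Oplus>j\<in>insert i (J - {i}). f j)"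
    using assms(2) by (simp add: insert_absorb)
  also have "\<dots> = f i \<oplus> (\<Oplus>j\<in>J - {i}. f j)"
    using assms by (intro M.finsum_insert) auto
  also have "(\<Oplus>j\<in>J - {i}. f j) = (\<Oplus>j\<in>J - {i}. \<zero>)"
    using assms by (intro M.finsum_cong') auto
  finally show ?thesis using assms by simp
qed

lemma smult_finsum:
  assumes "finite J" "\<And>i. i \<in> J \<Longrightarrow> f i \<in> carrier V"
  shows "c \<odot> (\<Oplus>i\<in>J. f i) = (\<Oplus>i\<in>J. c \<odot> f i)"
  using assms by (induction J) (auto simp: smult_add_right Pi_iff)

end

text \<open>Identities and memberships checked on generators extend to the closed subalgebra they generate
  because the sets where they hold are closed; the maps involved are all Lipschitz.\<close>

lemma closed_set_eq:
  assumes "normed_module V n" and "normed_module W m"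
    and S: "closedin (Metric_space.mtopology (carrier V) (ndist V n)) S"
    and f: "f \<in> S \<rightarrow> carrier W" and g: "g \<in> S \<rightarrow> carrier W"
    and lf: "\<And>x y. x \<in> S \<Longrightarrow> y \<in> S \<Longrightarrow> m (f x \<ominus>\<^bsub>W\<^esub> f y) \<le> K * n (x \<ominus>\<^bsub>V\<^esub> y)"
    and lg: "\<And>x y. x \<in> S \<Longrightarrow> y \<in> S \<Longrightarrow> m (g x \<ominus>\<^bsub>W\<^esub> g y) \<le> K' * n (x \<ominus>\<^bsub>V\<^esub> y)"
  shows "closedin (Metric_space.mtopology (carrier V) (ndist V n)) {x \<in> S. f x = g x}"
proof -
  interpret V: normed_module V n by fact
  interpret W: normed_module W m by fact
  have "f x = g x" if x: "x \<in> S" and a: "\<And>e. e > 0 \<Longrightarrow> \<exists>y\<in>{x \<in> S. f x = g x}. n (x \<ominus>\<^bsub>V\<^esub> y) < e" for x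
  proof -
    have SV: "S \<subseteq> carrier V" using S by (simp add: V.closedin_iff)
    have c: "f y \<in> carrier W" "g y \<in> carrier W" if "y \<in> S" for y using that f g by auto
    have "m (f x \<ominus>\<^bsub>W\<^esub> g x) \<le> 0 + e" if e: "e > 0" for e
    proof -
      define M where "M = \<bar>K\<bar> + \<bar>K'\<bar> + 1"
      have M: "M > 0" by (simp add: M_def)
      obtain y where y: "y \<in> S" "f y = g y" "n (x \<ominus>\<^bsub>V\<^esub> y) < e / M"
        using a[of "e / M"] e M by auto
      have n0: "0 \<le> n (x \<ominus>\<^bsub>V\<^esub> y)" using x y SV by (intro V.n_nonneg) auto
      have "m (f x \<ominus>\<^bsub>W\<^esub> g x) \<le> m (f x \<ominus>\<^bsub>W\<^esub> f y) + m (g y \<ominus>\<^bsub>W\<^esub> g x)"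
        using W.n_diff_triangle[of "f x" "f y" "g x"] c x y by auto
      also have "m (g y \<ominus>\<^bsub>W\<^esub> g x) = m (g x \<ominus>\<^bsub>W\<^esub> g y)"
        using W.n_diff_commute c x y by auto
      also have "m (f x \<ominus>\<^bsub>W\<^esub> f y) + m (g x \<ominus>\<^bsub>W\<^esub> g y) \<le> K * n (x \<ominus>\<^bsub>V\<^esub> y) + K' * n (x \<ominus>\<^bsub>V\<^esub> y)"
        using lf[OF x y(1)] lg[OF x y(1)] by (rule add_mono)
      also have "\<dots> \<le> M * n (x \<ominus>\<^bsub>V\<^esub> y)"
        using n0 unfolding M_def distrib_right[symmetric] by (intro mult_right_mono) auto
      also have "\<dots> \<le> e" using y M by (simp add: field_simps)
      finally show ?thesis by simp
    qed
    then have "m (f x \<ominus>\<^bsub>W\<^esub> g x) \<le> 0" by (rule field_le_epsilon)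
    then show ?thesis
      using W.n_nonneg[of "f x \<ominus>\<^bsub>W\<^esub> g x"] W.n_diff_eq_0[of "f x" "g x"] c x
      by (auto simp: W.M.minus_closed)
  qed
  then show ?thesis
    using S unfolding V.closedin_iff
    by (smt (verit, ccfv_threshold) mem_Collect_eq subset_iff)
qed

lemma closed_set_preimage:
  assumes "normed_module V n" and "normed_module W m"
    and S: "closedin (Metric_space.mtopology (carrier V) (ndist V n)) S"
    and C: "closedin (Metric_space.mtopology (carrier W) (ndist W m)) C"
    and f: "f \<in> S \<rightarrow> carrier W"
    and lf: "\<And>x y. x \<in> S \<Longrightarrow> y \<in> S \<Longrightarrow> m (f x \<ominus>\<^bsub>W\<^esub> f y) \<le> K * n (x \<ominus>\<^bsub>V\<^esub> y)"
  shows "closedin (Metric_space.mtopology (carrier V) (ndist V n)) {x \<in> S. f x \<in> C}"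
proof -
  interpret V: normed_module V n by fact
  interpret W: normed_module W m by fact
  have "f x \<in> C" if x: "x \<in> S" and a: "\<And>e. e > 0 \<Longrightarrow> \<exists>y\<in>{x \<in> S. f x \<in> C}. n (x \<ominus>\<^bsub>V\<^esub> y) < e" for x
  proof -
    have SV: "S \<subseteq> carrier V" using S by (simp add: V.closedin_iff)
    have "\<exists>z\<in>C. m (f x \<ominus>\<^bsub>W\<^esub> z) < e" if e: "e > 0" for e
    proof -
      define M where "M = \<bar>K\<bar> + 1"
      have M: "M > 0" by (simp add: M_def)
      obtain y where y: "y \<in> S" "f y \<in> C" "n (x \<ominus>\<^bsub>V\<^esub> y) < e / M"
        using a[of "e / M"] e M by auto
      have n0: "0 \<le> n (x \<ominus>\<^bsub>V\<^esub> y)" using x y SV by (intro V.n_nonneg) auto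
      have "m (f x \<ominus>\<^bsub>W\<^esub> f y) \<le> K * n (x \<ominus>\<^bsub>V\<^esub> y)" using lf x y by blast
      also have "\<dots> \<le> M * n (x \<ominus>\<^bsub>V\<^esub> y)" using n0 by (intro mult_right_mono) (auto simp: M_def)
      also have "\<dots> < e" using y M by (simp add: field_simps)
      finally show ?thesis using y by blast
    qed
    moreover have "f x \<in> carrier W" using f x by auto
    ultimately show ?thesis using C unfolding W.closedin_iff by blast
  qed
  then show ?thesis
    using S unfolding V.closedin_iff
    by (smt (verit, ccfv_threshold) mem_Collect_eq subset_iff)
qed

context pre_cstar_algebra
begin

lemma adj_zero [simp]: "adj B \<zero> = \<zero>"
  using adj_smult[of \<zero> 0] by simp

lemma adj_one [simp]: "adj B \<one> = \<one>"
proof -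
  have "adj B \<one> = adj B (\<one> \<otimes> adj B \<one>)"
    using adj_mult[of \<one> "adj B \<one>"] by simp
  then show ?thesis by simp
qed

lemma adj_finsum:
  assumes "finite J" "\<And>i. i \<in> J \<Longrightarrow> f i \<in> carrier B"
  shows "adj B (\<Oplus>i\<in>J. f i) = (\<Oplus>i\<in>J. adj B (f i))"
  using assms by (induction J) (auto simp: adj_add Pi_iff)

lemma nrm_adj: 
  assumes x: "x \<in> carrier B" 
  shows "nrm B (adj B x) = nrm B x"
proof -
  have "nrm B y \<le> nrm B (adj B y)" if y: "y \<in> carrier B" for y
  proof (cases "nrm B y = 0")
    case True
    then show ?thesis using n_nonneg[of "adj B y"] y by simp
  next
    case False
    then have "nrm B y > 0" using n_nonneg[of y] y by simp
    moreover have "(nrm B y)\<^sup>2 \<le> nrm B (adj B y) * nrm B y"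
      using nrm_mult[of "adj B y" y] cstar_identity[of y] y by simp
    ultimately show ?thesis by (simp add: power2_eq_square)
  qed
  from this[of x] this[of "adj B x"] x show ?thesis by simp
qed

lemma nrm_one_le: "nrm B \<one> \<le> 1"
proof -
  have "nrm B \<one> = (nrm B \<one>)\<^sup>2" using cstar_identity[of \<one>] by simp
  then have "nrm B \<one> = 0 \<or> nrm B \<one> = 1" by (auto simp: power2_eq_square)
  then show ?thesis by auto
qed

lemma nrm_mult_le:
  assumes "x \<in> carrier B" "y \<in> carrier B" "nrm B x \<le> p" "nrm B y \<le> q"
  shows "nrm B (x \<otimes> y) \<le> p * q"
  using nrm_mult[OF assms(1,2)] n_nonneg[OF assms(1)] n_nonneg[OF assms(2)] assms(3,4)
    mult_mono[of "nrm B x" p "nrm B y" q] by linarith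

lemma eq_zero_of_adj_mult:
  assumes "x \<in> carrier B" "adj B x \<otimes> x = \<zero>"
  shows "x = \<zero>"
  using assms cstar_identity[of x] n_eq_0[of x] by simp

lemma mult_diff_left:
  "\<lbrakk>x \<in> carrier B; y \<in> carrier B; z \<in> carrier B\<rbrakk> \<Longrightarrow> (x \<ominus> y) \<otimes> z = x \<otimes> z \<ominus> y \<otimes> z"
  by (simp add: minus_eq l_distr l_minus)

lemma mult_diff_right:
  "\<lbrakk>x \<in> carrier B; y \<in> carrier B; z \<in> carrier B\<rbrakk> \<Longrightarrow> z \<otimes> (x \<ominus> y) = z \<otimes> x \<ominus> z \<otimes> y"
  by (simp add: minus_eq r_distr r_minus)

text \<open>The unitary \<open>x + i y\<close> has norm at most one, and \<open>x\<close> is its real part.\<close>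

lemma nrm_le_one_of_sum_squares:
  assumes x: "x \<in> carrier B" "adj B x = x" and y: "y \<in> carrier B" "adj B y = y"
    and xy: "x \<otimes> y = y \<otimes> x" and one: "x \<otimes> x \<oplus> y \<otimes> y = \<one>"
  shows "nrm B x \<le> 1"
proof -
  define u where "u = x \<oplus> \<i> \<odot> y"
  have u: "u \<in> carrier B" using x y by (simp add: u_def)
  have au: "adj B u = x \<oplus> (- \<i>) \<odot> y" using x y by (simp add: u_def adj_add adj_smult)
  have "adj B u \<otimes> u = (x \<otimes> x \<oplus> (- \<i>) \<odot> (x \<otimes> y)) \<oplus> (\<i> \<odot> (x \<otimes> y) \<oplus> y \<otimes> y)"
    using x y unfolding au unfolding u_def
    by (simp add: l_distr r_distr smult_mult_left smult_mult_right smult_smult smult_add_right xy[symmetric])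
  also have "\<dots> = (x \<otimes> x \<oplus> y \<otimes> y) \<oplus> (\<i> \<odot> (x \<otimes> y) \<oplus> (- \<i>) \<odot> (x \<otimes> y))"
    using x y by (simp add: M.a_ac)
  also have "\<i> \<odot> (x \<otimes> y) \<oplus> (- \<i>) \<odot> (x \<otimes> y) = \<zero>"
    using x y smult_add_left[of "x \<otimes> y" \<i> "- \<i>"] by simp
  finally have "adj B u \<otimes> u = \<one>" using one by simp
  then have "(nrm B u)\<^sup>2 \<le> 1"
    using cstar_identity[OF u] nrm_one_le by simp
  then have nu: "nrm B u \<le> 1" using n_nonneg[OF u] by (simp add: power_le_one_iff)
  have "u \<oplus> adj B u = (x \<oplus> x) \<oplus> (\<i> \<odot> y \<oplus> (- \<i>) \<odot> y)"
    using x y unfolding au unfolding u_def by (simp add: M.a_ac)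
  also have "\<dots> = 2 \<odot> x" using x y smult_add_left[of x 1 1] smult_add_left[of y \<i> "- \<i>"] by simp
  finally have "2 * nrm B x = nrm B (u \<oplus> adj B u)" using x by (simp add: n_smult)
  also have "\<dots> \<le> nrm B u + nrm B (adj B u)" using u by (intro n_triangle) auto
  finally show ?thesis using nu nrm_adj[OF u] by simp
qed

lemma cstar_subalgebra_iff:
  "cstar_subalgebra B V \<longleftrightarrow> V \<subseteq> carrier B \<and> \<zero> \<in> V \<and>
     (\<forall>x\<in>V. \<forall>y\<in>V. x \<oplus> y \<in> V) \<and> (\<forall>c. \<forall>x\<in>V. c \<odot> x \<in> V) \<and> norm_closed B V \<and>
     (\<forall>x\<in>V. adj B x \<in> V) \<and> (\<forall>x\<in>V. \<forall>y\<in>V. x \<otimes> y \<in> V)"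
  unfolding cstar_subalgebra_def submodule_iff by auto

text \<open>Self-adjointness of \<open>M\<close> makes the commutant closed under adjoints: \<open>m x = x m\<close> for the adjoint
  of \<open>m\<close> is the adjoint of the wanted identity.\<close>

lemma cstar_subalgebra_commutant:
  assumes M: "M \<subseteq> carrier B" "\<And>m. m \<in> M \<Longrightarrow> adj B m \<in> M"
  shows "cstar_subalgebra B {x \<in> carrier B. \<forall>m\<in>M. m \<otimes> x = x \<otimes> m}" (is "cstar_subalgebra B ?C")
  unfolding cstar_subalgebra_iff
proof (intro conjI ballI allI)
  have Mc: "m \<in> carrier B" if "m \<in> M" for m using M that by auto
  show "?C \<subseteq> carrier B" "\<zero> \<in> ?C" using Mc by auto
  fix x assume x: "x \<in> ?C"
  show "c \<odot> x \<in> ?C" for c using x Mc by (auto simp: smult_mult_left smult_mult_right)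
  have "m \<otimes> adj B x = adj B x \<otimes> m" if m: "m \<in> M" for m
  proof -
    have "adj B (x \<otimes> adj B m) = adj B (adj B m \<otimes> x)" using x M(2)[OF m] by auto
    then show ?thesis using x Mc[OF m] by (simp add: adj_mult)
  qed
  then show "adj B x \<in> ?C" using x by auto
  fix y assume y: "y \<in> ?C"
  show "x \<oplus> y \<in> ?C" using x y Mc by (auto simp: l_distr r_distr)
  have "m \<otimes> (x \<otimes> y) = x \<otimes> y \<otimes> m" if m: "m \<in> M" for m
  proof -
    have "m \<otimes> (x \<otimes> y) = (m \<otimes> x) \<otimes> y" using x y Mc[OF m] by (simp add: m_assoc)
    also have "\<dots> = x \<otimes> (m \<otimes> y)" using x y m Mc[OF m] by (simp add: m_assoc)
    also have "\<dots> = x \<otimes> y \<otimes> m" using x y m Mc[OF m] by (simp add: m_assoc)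
    finally show ?thesis .
  qed
  then show "x \<otimes> y \<in> ?C" using x y by auto
next
  have Mc: "m \<in> carrier B" if "m \<in> M" for m using M that by auto
  have cl: "norm_closed B {x \<in> carrier B. m \<otimes> x = x \<otimes> m}" if m: "m \<in> M" for m
  proof (rule closed_set_eq[OF normed_module_axioms normed_module_axioms closed_set_carrier,
        where K = "nrm B m" and K' = "nrm B m"])
    fix x y assume x: "x \<in> carrier B" and y: "y \<in> carrier B"
    show "nrm B (m \<otimes> x \<ominus> m \<otimes> y) \<le> nrm B m * nrm B (x \<ominus> y)"
      using nrm_mult[of m "x \<ominus> y"] x y Mc[OF m] by (simp add: mult_diff_right)
    show "nrm B (x \<otimes> m \<ominus> y \<otimes> m) \<le> nrm B m * nrm B (x \<ominus> y)"
      using nrm_mult[of "x \<ominus> y" m] x y Mc[OF m] by (simp add: mult_diff_left mult.commute)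
  qed (use Mc[OF m] in auto)
  have "?C = \<Inter> (insert (carrier B) ((\<lambda>m. {x \<in> carrier B. m \<otimes> x = x \<otimes> m}) ` M))" by auto
  moreover have "norm_closed B \<dots>" by (rule closedin_Inter) (use cl closed_set_carrier in auto)
  ultimately show "norm_closed B ?C" by simp
qed

lemma closed_set_left_mult:
  assumes "norm_closed B C" "c \<in> carrier B"
  shows "norm_closed B {x \<in> carrier B. c \<otimes> x \<in> C}"
proof (rule closed_set_preimage[OF normed_module_axioms normed_module_axioms closed_set_carrier assms(1)])
  fix x y assume "x \<in> carrier B" "y \<in> carrier B"
  then show "nrm B (c \<otimes> x \<ominus> c \<otimes> y) \<le> nrm B c * nrm B (x \<ominus> y)"
    using nrm_mult[of c "x \<ominus> y"] assms by (simp add: mult_diff_right)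
qed (use assms in auto)

lemma cstar_subalgebra_diff:
  assumes "cstar_subalgebra B V" "x \<in> V" "y \<in> V"
  shows "x \<ominus> y \<in> V"
proof -
  have "x \<in> carrier B" "y \<in> carrier B" "x \<oplus> (- 1) \<odot> y \<in> V"
    using assms unfolding cstar_subalgebra_iff by blast+
  then show ?thesis by (simp add: diff_eq_smult)
qed

lemma cstar_subalgebra_carrier: "cstar_subalgebra B (carrier B)"
  unfolding cstar_subalgebra_iff by (simp add: closed_set_carrier)

lemma cstar_subalgebra_generated:
  assumes "S \<subseteq> carrier B"
  shows "cstar_subalgebra B (generated_cstar B S)"
proof -
  have ne: "{V. S \<subseteq> V \<and> cstar_subalgebra B V} \<noteq> {}"
    using assms cstar_subalgebra_carrier by auto
  have "norm_closed B (generated_cstar B S)"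
    unfolding generated_cstar_def using ne
    by (intro closedin_Inter) (auto simp: cstar_subalgebra_def)
  moreover have "generated_cstar B S \<subseteq> carrier B"
    unfolding generated_cstar_def using assms cstar_subalgebra_carrier by blast
  ultimately show ?thesis
    unfolding cstar_subalgebra_iff by (auto simp: generated_cstar_def cstar_subalgebra_iff)
qed

lemma generated_cstar_incl: "S \<subseteq> generated_cstar B S"
  by (auto simp: generated_cstar_def)

lemma generated_cstar_least: "S \<subseteq> V \<Longrightarrow> cstar_subalgebra B V \<Longrightarrow> generated_cstar B S \<subseteq> V"
  by (auto simp: generated_cstar_def)

lemma generated_cstar_eq_carrier:
  assumes "S \<subseteq> carrier B" "\<And>V. S \<subseteq> V \<Longrightarrow> cstar_subalgebra B V \<Longrightarrow> carrier B \<subseteq> V"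
  shows "generated_cstar B S = carrier B"
  using assms cstar_subalgebra_carrier unfolding generated_cstar_def by blast

text \<open>A C*-subalgebra may lack the unit of the ambient algebra, and the empty product is that unit.\<close>

lemma list_prod_in:
  assumes "\<And>x y. x \<in> V \<Longrightarrow> y \<in> V \<Longrightarrow> x \<otimes> y \<in> V" "V \<subseteq> carrier B" "set xs \<subseteq> V" "xs \<noteq> []"
  shows "list_prod B xs \<in> V"
  using assms(3,4)
proof (induction xs)
  case (Cons x xs)
  then show ?case 
    using assms(1,2) by (cases "xs = []") (auto simp: list_prod_def)
qed simp

lemma list_prod_closed: "set xs \<subseteq> carrier B \<Longrightarrow> list_prod B xs \<in> carrier B"
  by (induction xs) (auto simp: list_prod_def)

lemma list_prod_append:
  "set xs \<subseteq> carrier B \<Longrightarrow> set ys \<subseteq> carrier B \<Longrightarrow>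
    list_prod B (xs @ ys) = list_prod B xs \<otimes> list_prod B ys"
  using list_prod_closed[of ys] list_prod_closed
  by (induction xs) (auto simp: list_prod_def m_assoc)

lemma word_prod_closed: "s \<in> set w \<rightarrow> carrier B \<Longrightarrow> word_prod B s w \<in> carrier B"
  by (auto simp: word_prod_def intro!: list_prod_closed)

lemma source_proj_closed: "s \<in> set w \<rightarrow> carrier B \<Longrightarrow> source_proj B s w \<in> carrier B"
  by (simp add: source_proj_def word_prod_closed)

lemma source_proj_Nil [simp]: "source_proj B s [] = \<one>"
  by (simp add: source_proj_def word_prod_def list_prod_def)

lemma source_proj_snoc:
  assumes "s \<in> set w \<rightarrow> carrier B" "s i \<in> carrier B"
  shows "source_proj B s (w @ [i]) = adj B (s i) \<otimes> source_proj B s w \<otimes> s i"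
proof -
  have "word_prod B s (w @ [i]) = word_prod B s w \<otimes> s i"
    using assms unfolding word_prod_def map_append
    by (subst list_prod_append) (auto simp: list_prod_def)
  then show ?thesis
    using assms word_prod_closed[OF assms(1)] by (simp add: source_proj_def adj_mult m_assoc)
qed

lemma source_proj_adj:
  "s \<in> set w \<rightarrow> carrier B \<Longrightarrow> adj B (source_proj B s w) = source_proj B s w"
  by (simp add: source_proj_def adj_mult word_prod_closed)

lemma source_proj_single: "s i \<in> carrier B \<Longrightarrow> source_proj B s [i] = adj B (s i) \<otimes> s i"
  using source_proj_snoc[of s "[]" i] by simp

lemma partial_isometryD:
  assumes "partial_isometry B v"
  shows "v \<in> carrier B" "v \<otimes> adj B v \<otimes> v = v" "v \<otimes> (adj B v \<otimes> v) = v" 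
  using assms by (auto simp: partial_isometry_def m_assoc)

end

section \<open>Homomorphisms out of a subalgebra\<close>

locale subalgebra_hom = F: pre_cstar_algebra F + B: pre_cstar_algebra B
  for F :: "('a, 'm) cstar_scheme" and B :: "('b, 'k) cstar_scheme" (structure) +
  fixes A :: "'a set" and p :: "'a \<Rightarrow> 'b"
  assumes subalg: "cstar_subalgebra F A"
    and hom: "p \<in> star_hom (F\<lparr>carrier := A\<rparr>) B"
begin

lemma A_carrier [simp]: "x \<in> A \<Longrightarrow> x \<in> carrier F"
  using subalg unfolding F.cstar_subalgebra_iff by blast

lemma A_closed [simp]:
  "\<zero>\<^bsub>F\<^esub> \<in> A" 
  "x \<in> A \<Longrightarrow> y \<in> A \<Longrightarrow> x \<oplus>\<^bsub>F\<^esub> y \<in> A"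
  "x \<in> A \<Longrightarrow> y \<in> A \<Longrightarrow> x \<otimes>\<^bsub>F\<^esub> y \<in> A"
  "x \<in> A \<Longrightarrow> y \<in> A \<Longrightarrow> x \<ominus>\<^bsub>F\<^esub> y \<in> A"
  "x \<in> A \<Longrightarrow> c \<odot>\<^bsub>F\<^esub> x \<in> A"
  "x \<in> A \<Longrightarrow> adj F x \<in> A"
  using subalg F.cstar_subalgebra_diff[OF subalg] unfolding F.cstar_subalgebra_iff by blast+

lemma hom_closed [simp]: "x \<in> A \<Longrightarrow> p x \<in> carrier B"
  using hom by (auto simp: star_hom_def)

lemma hom_add: "x \<in> A \<Longrightarrow> y \<in> A \<Longrightarrow> p (x \<oplus>\<^bsub>F\<^esub> y) = p x \<oplus> p y"
  using hom by (auto simp: star_hom_def)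

lemma hom_mult: "x \<in> A \<Longrightarrow> y \<in> A \<Longrightarrow> p (x \<otimes>\<^bsub>F\<^esub> y) = p x \<otimes> p y"
  using hom by (auto simp: star_hom_def)

lemma hom_smult: "x \<in> A \<Longrightarrow> p (c \<odot>\<^bsub>F\<^esub> x) = c \<odot> p x"
  using hom by (auto simp: star_hom_def)

lemma hom_adj: "x \<in> A \<Longrightarrow> p (adj F x) = adj B (p x)"
  using hom by (auto simp: star_hom_def)

lemma hom_zero [simp]: "p \<zero>\<^bsub>F\<^esub> = \<zero>"
  using hom_smult[of "\<zero>\<^bsub>F\<^esub>" 0] by simp

lemma hom_diff: "x \<in> A \<Longrightarrow> y \<in> A \<Longrightarrow> p (x \<ominus>\<^bsub>F\<^esub> y) = p x \<ominus> p y"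
  by (simp add: F.diff_eq_smult B.diff_eq_smult hom_add hom_smult)

lemma hom_finsum:
  assumes "finite J" "\<And>i. i \<in> J \<Longrightarrow> f i \<in> A"
  shows "p (\<Oplus>\<^bsub>F\<^esub>i\<in>J. f i) = (\<Oplus>i\<in>J. p (f i))" and "(\<Oplus>\<^bsub>F\<^esub>i\<in>J. f i) \<in> A"
  using assms by (induction J) (auto simp: hom_add Pi_iff)

lemma hom_list_prod:
  assumes "\<one>\<^bsub>F\<^esub> \<in> A" "p \<one>\<^bsub>F\<^esub> = \<one>" "set xs \<subseteq> A"
  shows "p (list_prod F xs) = list_prod B (map p xs)" and "list_prod F xs \<in> A"
  using assms by (induction xs) (auto simp: hom_mult list_prod_def)

lemma hom_lipschitz:
  assumes "\<And>a. a \<in> A \<Longrightarrow> nrm B (p a) \<le> K * nrm F a" "a \<in> A" "b \<in> A"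
  shows "nrm B (p a \<ominus> p b) \<le> K * nrm F (a \<ominus>\<^bsub>F\<^esub> b)"
  using assms(1)[of "a \<ominus>\<^bsub>F\<^esub> b"] assms by (simp add: hom_diff)

lemma closed_A: "F.closed_set A"
  using subalg unfolding F.cstar_subalgebra_iff by blast

lemma cstar_subalgebra_preimage:
  assumes bound: "\<And>a. a \<in> A \<Longrightarrow> nrm B (p a) \<le> K * nrm F a" and V: "cstar_subalgebra B V"
  shows "cstar_subalgebra F {a \<in> A. p a \<in> V}"
  unfolding F.cstar_subalgebra_iff
proof (intro conjI ballI allI)
  have cl: "norm_closed B V" using V by (simp add: cstar_subalgebra_def)
  show "F.closed_set {a \<in> A. p a \<in> V}"
  proof (rule closed_set_preimage[OF F.normed_module_axioms B.normed_module_axioms closed_A cl])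
    show "p \<in> A \<rightarrow> carrier B" by auto
  qed (rule hom_lipschitz[OF bound])
qed (use V in \<open>auto simp: B.cstar_subalgebra_iff hom_add hom_mult hom_smult hom_adj\<close>)

text \<open>Automatic continuity: a self-adjoint contraction \<open>h\<close> is the real part of a unitary
  \<open>h + i k\<close>, and a unital homomorphism maps unitaries to unitaries.\<close>

lemma hom_bounded:
  assumes one: "\<one>\<^bsub>F\<^esub> \<in> A" "p \<one>\<^bsub>F\<^esub> = \<one>"
    and sqrt: "\<And>h. \<lbrakk>h \<in> A; adj F h = h; nrm F h \<le> 1\<rbrakk> \<Longrightarrow>
      \<exists>k\<in>A. adj F k = k \<and> h \<otimes>\<^bsub>F\<^esub> k = k \<otimes>\<^bsub>F\<^esub> h \<and> h \<otimes>\<^bsub>F\<^esub> h \<oplus>\<^bsub>F\<^esub> k \<otimes>\<^bsub>F\<^esub> k = \<one>\<^bsub>F\<^esub>"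
    and a: "a \<in> A"
  shows "nrm B (p a) \<le> 2 * nrm F a"
proof -
  have contr: "nrm B (p h) \<le> nrm F h" if h: "h \<in> A" "adj F h = h" for h
  proof (cases "nrm F h = 0")
    case True
    then have "h = \<zero>\<^bsub>F\<^esub>" using h F.n_eq_0[of h] by simp
    then show ?thesis by simp
  next
    case False
    then have pos: "nrm F h > 0" using h F.n_nonneg[of h] by simp
    define r where "r = complex_of_real (1 / nrm F h)"
    define g where "g = r \<odot>\<^bsub>F\<^esub> h"
    have g: "g \<in> A" "adj F g = g" "nrm F g \<le> 1"
      using h pos by (auto simp: g_def r_def F.adj_smult F.n_smult norm_divide)
    obtain k where k: "k \<in> A" "adj F k = k" "g \<otimes>\<^bsub>F\<^esub> k = k \<otimes>\<^bsub>F\<^esub> g"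
        "g \<otimes>\<^bsub>F\<^esub> g \<oplus>\<^bsub>F\<^esub> k \<otimes>\<^bsub>F\<^esub> k = \<one>\<^bsub>F\<^esub>"
      using sqrt[OF g] by blast
    have "nrm B (p g) \<le> 1"
    proof (rule B.nrm_le_one_of_sum_squares[of _ "p k"])
      show "p g \<otimes> p g \<oplus> p k \<otimes> p k = \<one>"
        using k(4) one(2) g k by (simp flip: hom_mult hom_add)
    qed (use g k in \<open>simp_all flip: hom_adj hom_mult\<close>)
    moreover have "p g = r \<odot> p h" using h by (simp add: g_def hom_smult)
    ultimately show ?thesis
      using pos h by (simp add: r_def B.n_smult norm_divide field_simps)
  qed
  define h where "h = (1 / 2) \<odot>\<^bsub>F\<^esub> (a \<oplus>\<^bsub>F\<^esub> adj F a)"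
  define k where "k = (- \<i> / 2) \<odot>\<^bsub>F\<^esub> (a \<oplus>\<^bsub>F\<^esub> (- 1) \<odot>\<^bsub>F\<^esub> adj F a)"
  have h: "h \<in> A" "adj F h = h"
    using a by (simp_all add: h_def F.adj_smult F.adj_add F.M.a_comm)
  have k: "k \<in> A" "adj F k = k"
    using a by (simp_all add: k_def F.adj_smult F.adj_add F.smult_add_right F.smult_smult F.M.a_comm)
  have "nrm F (a \<oplus>\<^bsub>F\<^esub> adj F a) \<le> 2 * nrm F a"
    using F.n_triangle[of a "adj F a"] a by (simp add: F.nrm_adj)
  then have nh: "nrm F h \<le> nrm F a"
    using a by (simp add: h_def F.n_smult)
  have "nrm F (a \<oplus>\<^bsub>F\<^esub> (- 1) \<odot>\<^bsub>F\<^esub> adj F a) \<le> 2 * nrm F a"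
    using F.n_triangle[of a "(- 1) \<odot>\<^bsub>F\<^esub> adj F a"] a by (simp add: F.nrm_adj F.n_smult)
  then have nk: "nrm F k \<le> nrm F a"
    using a by (simp add: k_def F.n_smult norm_divide)
  have "h \<oplus>\<^bsub>F\<^esub> \<i> \<odot>\<^bsub>F\<^esub> k = ((1/2) \<odot>\<^bsub>F\<^esub> a \<oplus>\<^bsub>F\<^esub> (1/2) \<odot>\<^bsub>F\<^esub> a)
      \<oplus>\<^bsub>F\<^esub> ((1/2) \<odot>\<^bsub>F\<^esub> adj F a \<oplus>\<^bsub>F\<^esub> (- 1/2) \<odot>\<^bsub>F\<^esub> adj F a)"
    using a by (simp add: h_def k_def F.smult_add_right F.smult_smult F.M.a_ac)
  also have "\<dots> = a" using a by (simp flip: F.smult_add_left)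
  finally have "p a = p h \<oplus> \<i> \<odot> p k"
    using h k by (simp flip: hom_add hom_smult)
  also have "nrm B \<dots> \<le> nrm B (p h) + nrm B (p k)"
    using B.n_triangle[of "p h" "\<i> \<odot> p k"] h k by (simp add: B.n_smult)
  also have "\<dots> \<le> 2 * nrm F a" using contr[OF h] contr[OF k] nh nk by simp
  finally show ?thesis .
qed

end

section \<open>Spaces of bounded operators\<close>

text \<open>The operator norm is a norm on every space of bounded operators; this covers both the
  operators on a Hilbert space and those on a Hilbert module.\<close>

locale operator_space = normed_module V n
  for V :: "(complex, 'v, 'm) module_scheme" (structure) and n :: "'v \<Rightarrow> real" +
  fixes ip :: "'v \<Rightarrow> 'v \<Rightarrow> 'c" and \<O> :: "('v \<Rightarrow> 'v) set"
  assumes op_fun: "S \<in> \<O> \<Longrightarrow> S \<in> carrier V \<rightarrow>\<^sub>E carrier V"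
    and op_add: "\<lbrakk>S \<in> \<O>; x \<in> carrier V; y \<in> carrier V\<rbrakk> \<Longrightarrow> S (x \<oplus> y) = S x \<oplus> S y"
    and op_smult: "\<lbrakk>S \<in> \<O>; x \<in> carrier V\<rbrakk> \<Longrightarrow> S (c \<odot> x) = c \<odot> S x"
    and op_bounded: "S \<in> \<O> \<Longrightarrow> \<exists>K. \<forall>x\<in>carrier V. n (S x) \<le> K * n x"
    and zero_op: "(\<lambda>x\<in>carrier V. \<zero>) \<in> \<O>"
    and add_op: "\<lbrakk>S \<in> \<O>; T \<in> \<O>\<rbrakk> \<Longrightarrow> (\<lambda>x\<in>carrier V. S x \<oplus> T x) \<in> \<O>"
    and smult_op: "S \<in> \<O> \<Longrightarrow> (\<lambda>x\<in>carrier V. c \<odot> S x) \<in> \<O>"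
begin

abbreviation "OA \<equiv> op_algebra V n ip \<O>"

lemma op_algebra_carrier: "carrier OA = \<O>"
  by (simp add: op_algebra_def)

lemma op_closed: "S \<in> \<O> \<Longrightarrow> x \<in> carrier V \<Longrightarrow> S x \<in> carrier V"
  using op_fun by auto

lemma op_ext:
  assumes "S \<in> \<O>" "T \<in> \<O>" "\<And>x. x \<in> carrier V \<Longrightarrow> S x = T x"
  shows "S = T"
  using assms op_fun by (metis PiE_ext)

lemma op_algebra_simps:
  "\<zero>\<^bsub>OA\<^esub> = (\<lambda>x\<in>carrier V. \<zero>)"
  "S \<oplus>\<^bsub>OA\<^esub> T = (\<lambda>x\<in>carrier V. S x \<oplus> T x)"
  "c \<odot>\<^bsub>OA\<^esub> S = (\<lambda>x\<in>carrier V. c \<odot> S x)"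
  by (auto simp: op_algebra_def)

lemma nrm_op: "nrm OA S = (SUP x\<in>{x \<in> carrier V. n x \<le> 1}. n (S x))"
  by (simp add: op_algebra_def)

text \<open>The operator norm is a supremum over the unit ball; this lemma and \<open>n_le_nrm_op\<close> characterise it
  as the least bound.\<close>

lemma nrm_op_le:
  assumes "\<And>x. x \<in> carrier V \<Longrightarrow> n (S x) \<le> K * n x" "0 \<le> K"
  shows "nrm OA S \<le> K"
  unfolding nrm_op
proof (rule cSUP_least)
  show "{x \<in> carrier V. n x \<le> 1} \<noteq> {}" by (auto intro!: exI[of _ \<zero>])
  fix x assume x: "x \<in> {x \<in> carrier V. n x \<le> 1}"
  then have "n (S x) \<le> K * n x" using assms by auto
  also have "\<dots> \<le> K * 1" using x assms(2) by (intro mult_left_mono) auto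
  finally show "n (S x) \<le> K" by simp
qed

lemma bdd_above_op:
  assumes S: "S \<in> \<O>"
  shows "bdd_above ((\<lambda>x. n (S x)) ` {x \<in> carrier V. n x \<le> 1})"
proof -
  obtain K where K: "\<And>x. x \<in> carrier V \<Longrightarrow> n (S x) \<le> K * n x"
    using op_bounded[OF S] by auto
  show ?thesis
  proof (rule bdd_aboveI2)
    fix x assume x: "x \<in> {x \<in> carrier V. n x \<le> 1}"
    have "n (S x) \<le> K * n x" using K x by auto
    also have "\<dots> \<le> \<bar>K\<bar> * n x" using x n_nonneg by (intro mult_right_mono) auto
    also have "\<dots> \<le> \<bar>K\<bar> * 1" using x by (intro mult_left_mono) auto
    finally show "n (S x) \<le> \<bar>K\<bar>" by simp
  qed
qed

lemma n_le_nrm_op: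
  assumes S: "S \<in> \<O>" and x: "x \<in> carrier V"
  shows "n (S x) \<le> nrm OA S * n x"
proof (cases "n x = 0")
  case True
  obtain K where "\<And>x. x \<in> carrier V \<Longrightarrow> n (S x) \<le> K * n x"
    using op_bounded[OF S] by auto
  from this[OF x] show ?thesis using True by simp
next
  case False
  then have pos: "n x > 0" using n_nonneg[OF x] by linarith
  define y where "y = of_real (1 / n x) \<odot> x"
  have y: "y \<in> carrier V" "n y \<le> 1" using x pos by (auto simp: y_def n_smult norm_divide)
  have "n (S y) \<le> nrm OA S"
    unfolding nrm_op using bdd_above_op[OF S] y by (intro cSUP_upper) auto
  moreover have "n (S y) = n (S x) / n x"
    using x pos S by (simp add: y_def op_smult op_closed n_smult norm_divide)
  ultimately show ?thesis using pos by (simp add: field_simps)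
qed

lemma nrm_op_nonneg:
  assumes S: "S \<in> \<O>"
  shows "0 \<le> nrm OA S"
proof -
  have "n (S \<zero>) \<le> nrm OA S"
    unfolding nrm_op using bdd_above_op[OF S] by (intro cSUP_upper) auto
  moreover have "0 \<le> n (S \<zero>)" using op_closed[OF S] by (simp add: n_nonneg)
  ultimately show ?thesis by linarith
qed

lemma normed_op_algebra: "normed_module OA (nrm OA)"
proof -
  have ab: "abelian_group OA"
  proof (rule abelian_groupI)
    fix S assume S: "S \<in> carrier OA"
    have "(- 1) \<odot>\<^bsub>OA\<^esub> S \<oplus>\<^bsub>OA\<^esub> S = \<zero>\<^bsub>OA\<^esub>"
      using S op_closed uminus_eq_smult M.l_neg
      by (auto simp: op_algebra_simps op_algebra_carrier intro!: restrict_ext)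
    then show "\<exists>y\<in>carrier OA. y \<oplus>\<^bsub>OA\<^esub> S = \<zero>\<^bsub>OA\<^esub>"
      using S smult_op[of S "- 1"]
      by (intro bexI[of _ "(- 1) \<odot>\<^bsub>OA\<^esub> S"]) (auto simp only: op_algebra_simps op_algebra_carrier)
    have "(\<lambda>x\<in>carrier V. S x) = S"
      using op_fun[of S] S by (simp add: PiE_restrict op_algebra_carrier)
    moreover have "\<zero>\<^bsub>OA\<^esub> \<oplus>\<^bsub>OA\<^esub> S = (\<lambda>x\<in>carrier V. S x)"
      using S op_closed by (auto simp: op_algebra_simps op_algebra_carrier intro!: restrict_ext)
    ultimately show "\<zero>\<^bsub>OA\<^esub> \<oplus>\<^bsub>OA\<^esub> S = S" by simp
  qed (auto simp: op_algebra_simps op_algebra_carrier zero_op add_op op_closed M.a_ac intro!: restrict_ext)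
  have mod: "Module.module Cx OA"
    by (rule moduleI)
      (use ab in \<open>auto simp: cring_Cx op_algebra_simps op_algebra_carrier smult_op op_closed
        smult_add_left smult_add_right smult_smult intro!: restrict_ext op_ext\<close>)
  show ?thesis
  proof (intro normed_module.intro normed_module_axioms.intro mod)
    fix S assume "S \<in> carrier OA"
    then have S: "S \<in> \<O>" by (simp add: op_algebra_carrier)
    note n0 = nrm_op_nonneg[OF S]
    show "0 \<le> nrm OA S" by (rule n0)
    show "nrm OA S = 0 \<longleftrightarrow> S = \<zero>\<^bsub>OA\<^esub>"
    proof
      assume z: "nrm OA S = 0"
      have "S x = \<zero>" if x: "x \<in> carrier V" for x
      proof -
        have "n (S x) \<le> 0" using n_le_nrm_op[OF S x] z by simp
        then show ?thesis
          using n_nonneg[OF op_closed[OF S x]] n_eq_0[OF op_closed[OF S x]] by simp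
      qed
      then show "S = \<zero>\<^bsub>OA\<^esub>"
        using S zero_op by (auto simp: op_algebra_simps intro!: op_ext)
    next
      assume "S = \<zero>\<^bsub>OA\<^esub>"
      then have "nrm OA S \<le> 0" by (intro nrm_op_le) (auto simp: op_algebra_simps)
      then show "nrm OA S = 0" using n0 by simp
    qed
    have sm: "nrm OA (c \<odot>\<^bsub>OA\<^esub> S) \<le> cmod c * nrm OA S" if S: "S \<in> \<O>" for c S
      using nrm_op_nonneg[OF S] n_le_nrm_op[OF S] op_closed[OF S]
      by (intro nrm_op_le) (auto simp: op_algebra_simps n_smult mult.assoc intro!: mult_left_mono)
    fix c
    show "nrm OA (c \<odot>\<^bsub>OA\<^esub> S) = cmod c * nrm OA S"
    proof (cases "c = 0")
      case True
      then show ?thesis 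
        using sm[OF S, of 0] nrm_op_nonneg[OF smult_op[OF S, of 0]] by (simp add: op_algebra_simps)
    next
      case False
      have "inverse c \<odot>\<^bsub>OA\<^esub> (c \<odot>\<^bsub>OA\<^esub> S) = S"
        unfolding op_algebra_simps
        by (rule op_ext) (use S smult_op[OF smult_op[OF S]] False op_closed[OF S] in \<open>auto simp: smult_smult\<close>)
      then have "nrm OA S \<le> cmod (inverse c) * nrm OA (c \<odot>\<^bsub>OA\<^esub> S)"
        using sm[of "c \<odot>\<^bsub>OA\<^esub> S" "inverse c"] smult_op[OF S, of c] by (simp add: op_algebra_simps)
      then have "cmod c * nrm OA S \<le> nrm OA (c \<odot>\<^bsub>OA\<^esub> S)"
        using False by (simp add: norm_inverse norm_divide field_simps)
      then show ?thesis using sm[OF S, of c] by simp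
    qed
    fix T assume "T \<in> carrier OA"
    then have T: "T \<in> \<O>" by (simp add: op_algebra_carrier)
    show "nrm OA (S \<oplus>\<^bsub>OA\<^esub> T) \<le> nrm OA S + nrm OA T"
    proof (rule nrm_op_le)
      fix x assume x: "x \<in> carrier V"
      have "n (S x \<oplus> T x) \<le> n (S x) + n (T x)"
        using S T x by (intro n_triangle) (auto simp: op_closed)
      then show "n ((S \<oplus>\<^bsub>OA\<^esub> T) x) \<le> (nrm OA S + nrm OA T) * n x"
        using x n_le_nrm_op[OF S x] n_le_nrm_op[OF T x] by (simp add: op_algebra_simps distrib_right)
    qed (use n0 nrm_op_nonneg[OF T] in simp)
  qed
qed

lemma finsum_op_apply:
  assumes "finite J" "\<And>i. i \<in> J \<Longrightarrow> f i \<in> \<O>" and x: "x \<in> carrier V"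
  shows "(\<Oplus>\<^bsub>OA\<^esub>i\<in>J. f i) x = (\<Oplus>i\<in>J. f i x)"
proof -
  interpret OA: normed_module OA "nrm OA" by (rule normed_op_algebra)
  show ?thesis
    using assms(1,2)
  proof (induction J)
    case empty
    then show ?case using x by (simp add: op_algebra_simps)
  next
    case (insert i J)
    then show ?case
      using x by (subst OA.M.finsum_insert, simp_all add: Pi_iff op_algebra_carrier op_closed)
        (simp add: op_algebra_simps)
  qed
qed

end

section \<open>Hilbert spaces and their bounded operators\<close>

text \<open>The axioms of a Hilbert space up to completeness, which is expressed by the norm that they
  define.\<close>

locale pre_hilbert = Module.module Cx H for H :: "('h, 'm) hilb_scheme" (structure) +
  assumes cinner_add_right:
      "\<lbrakk>x \<in> carrier H; y \<in> carrier H; z \<in> carrier H\<rbrakk>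
        \<Longrightarrow> cinner H x (y \<oplus> z) = cinner H x y + cinner H x z"
    and cinner_smult_right:
      "\<lbrakk>x \<in> carrier H; y \<in> carrier H\<rbrakk> \<Longrightarrow> cinner H x (c \<odot> y) = c * cinner H x y"
    and cinner_commute:
      "\<lbrakk>x \<in> carrier H; y \<in> carrier H\<rbrakk> \<Longrightarrow> cinner H y x = cnj (cinner H x y)"
    and cinner_nonneg: "x \<in> carrier H \<Longrightarrow> 0 \<le> Re (cinner H x x)"
    and cinner_eq_0: "x \<in> carrier H \<Longrightarrow> cinner H x x = 0 \<longleftrightarrow> x = \<zero>"

text \<open>This gives the Cauchy-Schwarz inequality and also, with a small error term \<open>a\<close>, the variational
  step in the Riesz theorem.\<close>

lemma discriminant_bound:
  fixes a b c :: real
  assumes "\<And>t. 0 \<le> a + 2 * t * b + t\<^sup>2 * c" and "0 \<le> c"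
  shows "b\<^sup>2 \<le> a * c"
proof (cases "c = 0")
  case True
  have "b = 0"
  proof (rule ccontr)
    assume "b \<noteq> 0"
    then show False using assms(1)[of "- (a + 1) / (2 * b)"] True by simp
  qed
  then show ?thesis using True by simp
next
  case False
  then have "c > 0" using assms(2) by simp
  have "0 \<le> a - b\<^sup>2 / c"
    using assms(1)[of "- b / c"] False by (simp add: power2_eq_square field_simps)
  then show ?thesis using \<open>c > 0\<close> by (simp add: field_simps)
qed

context pre_hilbert
begin

lemma closed_simps [simp]: "x \<in> carrier H \<Longrightarrow> c \<odot> x \<in> carrier H"
  using smult_closed by simp

lemma cinner_add_left:
  assumes "x \<in> carrier H" "y \<in> carrier H" "z \<in> carrier H"
  shows "cinner H (y \<oplus> z) x = cinner H y x + cinner H z x"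
  using assms cinner_commute[of x "y \<oplus> z"] cinner_commute[of x y] cinner_commute[of x z]
  by (simp add: cinner_add_right)

lemma cinner_smult_left:
  assumes "x \<in> carrier H" "y \<in> carrier H"
  shows "cinner H (c \<odot> y) x = cnj c * cinner H y x"
  using assms cinner_commute[of x "c \<odot> y"] cinner_commute[of x y] by (simp add: cinner_smult_right)

lemma hnorm_sq: "x \<in> carrier H \<Longrightarrow> (hnorm H x)\<^sup>2 = Re (cinner H x x)"
  using cinner_nonneg by (simp add: hnorm_def)

lemma cinner_self: "x \<in> carrier H \<Longrightarrow> cinner H x x = of_real ((hnorm H x)\<^sup>2)"
  using cinner_commute[of x x] by (simp add: complex_eq_iff hnorm_sq)

lemma hnorm_nonneg [simp]: "0 \<le> hnorm H x" if "x \<in> carrier H"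
  using that cinner_nonneg by (simp add: hnorm_def)

lemma hnorm_smult: "x \<in> carrier H \<Longrightarrow> hnorm H (c \<odot> x) = cmod c * hnorm H x"
proof -
  assume x: "x \<in> carrier H"
  have "cinner H (c \<odot> x) (c \<odot> x) = of_real ((cmod c)\<^sup>2 * (hnorm H x)\<^sup>2)"
    using x cinner_self[OF x] complex_norm_square[of c]
    by (simp add: cinner_smult_left cinner_smult_right mult_ac)
  then have "(hnorm H (c \<odot> x))\<^sup>2 = (cmod c * hnorm H x)\<^sup>2"
    using x hnorm_sq[of "c \<odot> x"] by (simp add: power_mult_distrib)
  then show ?thesis using x by (simp add: power2_eq_iff_nonneg)
qed

lemma hnorm_add_sq:
  assumes "x \<in> carrier H" "y \<in> carrier H"
  shows "(hnorm H (x \<oplus> y))\<^sup>2 = (hnorm H x)\<^sup>2 + 2 * Re (cinner H x y) + (hnorm H y)\<^sup>2"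
  using assms cinner_commute[of x y]
  by (simp add: hnorm_sq cinner_add_left cinner_add_right)

lemma Re_cinner_sq_le:
  assumes x: "x \<in> carrier H" and y: "y \<in> carrier H"
  shows "(Re (cinner H x y))\<^sup>2 \<le> (hnorm H x)\<^sup>2 * (hnorm H y)\<^sup>2"
proof (rule discriminant_bound)
  fix t :: real
  have "0 \<le> (hnorm H (x \<oplus> of_real t \<odot> y))\<^sup>2" by simp
  also have "\<dots> = (hnorm H x)\<^sup>2 + 2 * t * Re (cinner H x y) + t\<^sup>2 * (hnorm H y)\<^sup>2"
    using x y by (simp add: hnorm_add_sq hnorm_smult cinner_smult_right power_mult_distrib)
  finally show "0 \<le> (hnorm H x)\<^sup>2 + 2 * t * Re (cinner H x y) + t\<^sup>2 * (hnorm H y)\<^sup>2" .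
qed simp

lemma cauchy_schwarz:
  assumes x: "x \<in> carrier H" and y: "y \<in> carrier H"
  shows "cmod (cinner H x y) \<le> hnorm H x * hnorm H y"
proof (cases "cinner H x y = 0")
  case True
  then show ?thesis using x y by simp
next
  case False
  \<comment> \<open>Rotate \<open>y\<close> so that the inner product becomes real.\<close>
  define c where "c = cnj (cinner H x y) / cmod (cinner H x y)"
  have "c * cinner H x y = cmod (cinner H x y)"
    using False complex_norm_square[of "cinner H x y", symmetric]
    by (simp add: c_def mult.commute[of "cnj _"] power2_eq_square)
  moreover have "cmod c = 1" using False by (simp add: c_def norm_divide)
  ultimately have "(cmod (cinner H x y))\<^sup>2 \<le> (hnorm H x * hnorm H y)\<^sup>2"
    using Re_cinner_sq_le[of x "c \<odot> y"] x y
    by (simp add: cinner_smult_right hnorm_smult power_mult_distrib)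
  then show ?thesis using x y by (simp add: power2_le_iff_abs_le)
qed

sublocale normed_module H "hnorm H"
proof
  fix x y assume x: "x \<in> carrier H" and y: "y \<in> carrier H"
  have "(hnorm H (x \<oplus> y))\<^sup>2 \<le> (hnorm H x + hnorm H y)\<^sup>2"
    using cauchy_schwarz[OF x y] complex_Re_le_cmod[of "cinner H x y"]
    by (simp add: hnorm_add_sq[OF x y] power2_sum)
  then show "hnorm H (x \<oplus> y) \<le> hnorm H x + hnorm H y"
    using x y by (simp add: power2_le_iff_abs_le)
next
  fix x assume x: "x \<in> carrier H"
  have "hnorm H x = 0 \<longleftrightarrow> (hnorm H x)\<^sup>2 = 0" by simp
  also have "\<dots> \<longleftrightarrow> cinner H x x = 0" by (simp add: cinner_self[OF x])
  finally show "hnorm H x = 0 \<longleftrightarrow> x = \<zero>" using cinner_eq_0[OF x] by simp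
qed (simp_all add: hnorm_smult)

lemma cinner_diff_right:
  "\<lbrakk>x \<in> carrier H; y \<in> carrier H; z \<in> carrier H\<rbrakk>
    \<Longrightarrow> cinner H x (y \<ominus> z) = cinner H x y - cinner H x z"
  by (simp add: diff_eq_smult cinner_add_right cinner_smult_right)

lemma cinner_diff_left:
  "\<lbrakk>x \<in> carrier H; y \<in> carrier H; z \<in> carrier H\<rbrakk>
    \<Longrightarrow> cinner H (y \<ominus> z) x = cinner H y x - cinner H z x"
  by (simp add: diff_eq_smult cinner_add_left cinner_smult_left)

lemma cinner_ext:
  assumes "y \<in> carrier H" "z \<in> carrier H" "\<And>x. x \<in> carrier H \<Longrightarrow> cinner H x y = cinner H x z"
  shows "y = z"
proof -
  have "cinner H (y \<ominus> z) (y \<ominus> z) = 0"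
    using assms by (simp add: cinner_diff_right)
  then have "hnorm H (y \<ominus> z) = 0" by (simp add: hnorm_def)
  then show ?thesis using assms n_diff_eq_0 by simp
qed

end

lemma hilbert_imp_pre_hilbert: "hilbert_space H \<Longrightarrow> pre_hilbert H"
  unfolding hilbert_space_def pre_hilbert_def hilbert_space_axioms_def pre_hilbert_axioms_def
  by blast

context hilbert_space
begin

sublocale pre: pre_hilbert H
  by (rule hilbert_imp_pre_hilbert) (rule hilbert_space_axioms)

text \<open>The Riesz representation theorem: the representing vector minimises
  \<open>\<parallel>x\<parallel>\<^sup>2 - 2 Re f(x)\<close>, and minimising sequences are Cauchy by the parallelogram law.\<close>

lemma riesz_representation:
    assumes add: "\<And>x y. \<lbrakk>x \<in> carrier H; y \<in> carrier H\<rbrakk> \<Longrightarrow> f (x \<oplus> y) = f x + f y"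
    and smult: "\<And>c x. x \<in> carrier H \<Longrightarrow> f (c \<odot> x) = c * f x"
    and bound: "\<And>x. x \<in> carrier H \<Longrightarrow> cmod (f x) \<le> K * hnorm H x"
  shows "\<exists>z\<in>carrier H. \<forall>x\<in>carrier H. f x = cinner H z x"
proof -
  define J where "J x = (hnorm H x)\<^sup>2 - 2 * Re (f x)" for x
  define m where "m = (INF x\<in>carrier H. J x)"
  have bdd: "bdd_below (J ` carrier H)"
  proof (rule bdd_belowI2)
    fix x assume x: "x \<in> carrier H"
    have "Re (f x) \<le> K * hnorm H x"
      using bound[OF x] complex_Re_le_cmod[of "f x"] by simp
    moreover have "0 \<le> (hnorm H x - K)\<^sup>2" by simp
    ultimately show "- (K\<^sup>2) \<le> J x"
      unfolding J_def by (simp add: power2_diff algebra_simps)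
  qed
  have m_le: "m \<le> J x" if "x \<in> carrier H" for x
    unfolding m_def using bdd that by (rule cINF_lower)
  have "\<exists>x\<in>carrier H. J x < m + 1 / Suc k" for k
  proof -
    have "(INF x\<in>carrier H. J x) < m + 1 / Suc k" by (simp add: m_def)
    then show ?thesis using bdd by (subst (asm) cINF_less_iff) auto
  qed
  then obtain u where u: "\<And>k. u k \<in> carrier H" "\<And>k. J (u k) < m + 1 / Suc k"
    by metis
  have cauchy: "(hnorm H (u k \<ominus> u l))\<^sup>2 \<le> 2 / Suc k + 2 / Suc l" for k l
  proof -
    define x where "x = u k"
    define y where "y = u l"
    have xy: "x \<in> carrier H" "y \<in> carrier H" using u by (auto simp: x_def y_def)
    have d: "(hnorm H (x \<ominus> y))\<^sup>2 = (hnorm H x)\<^sup>2 - 2 * Re (cinner H x y) + (hnorm H y)\<^sup>2"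
      using xy by (simp add: pre.diff_eq_smult pre.hnorm_add_sq pre.hnorm_smult pre.cinner_smult_right)
    have h: "4 * (hnorm H ((1/2) \<odot> (x \<oplus> y)))\<^sup>2 = (hnorm H x)\<^sup>2 + 2 * Re (cinner H x y) + (hnorm H y)\<^sup>2"
      using xy by (simp add: pre.hnorm_smult pre.hnorm_add_sq power_mult_distrib norm_divide power_divide)
    have "m \<le> J ((1/2) \<odot> (x \<oplus> y))" using xy by (intro m_le) auto
    also have "\<dots> = (hnorm H ((1/2) \<odot> (x \<oplus> y)))\<^sup>2 - Re (f x) - Re (f y)"
      using xy by (simp add: J_def add smult)
    finally have "4 * m \<le> (hnorm H x)\<^sup>2 + 2 * Re (cinner H x y) + (hnorm H y)\<^sup>2 - 4 * Re (f x) - 4 * Re (f y)"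
      using h by simp
    moreover define r where "r = 1 / real (Suc k) + 1 / real (Suc l)"
    then have "J x + J y < 2 * m + r"
      using u(2)[of k] u(2)[of l] by (simp add: x_def y_def)
    ultimately have "(hnorm H (x \<ominus> y))\<^sup>2 \<le> 2 * r"
      unfolding d J_def by linarith
    then show ?thesis by (simp add: x_def y_def r_def)
  qed
  have small: "\<exists>N. \<forall>k\<ge>N. C / Suc k < e" if "e > 0" for C e :: real
  proof -
    have "(\<lambda>k. C / Suc k) \<longlonglongrightarrow> 0"
      using tendsto_mult[OF tendsto_const[of C] LIMSEQ_inverse_real_of_nat] by (simp add: divide_inverse)
    then have "\<forall>\<^sub>F k in sequentially. C / Suc k < e" using that by (intro order_tendstoD(2)) auto
    then show ?thesis by (simp add: eventually_sequentially)
  qed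
  have cau: "\<forall>e>0. \<exists>N. \<forall>k\<ge>N. \<forall>l\<ge>N. hnorm H (u k \<ominus> u l) < e"
  proof (intro allI impI)
    fix e :: real assume e: "e > 0"
    then obtain N where N: "\<And>k. k \<ge> N \<Longrightarrow> 2 / Suc k < e\<^sup>2 / 2"
      using small[of "e\<^sup>2 / 2" 2] by auto
    have "hnorm H (u k \<ominus> u l) < e" if "k \<ge> N" "l \<ge> N" for k l
    proof -
      have "(hnorm H (u k \<ominus> u l))\<^sup>2 < e\<^sup>2"
        using cauchy[of k l] N[OF that(1)] N[OF that(2)] by simp
      then show ?thesis using e by (simp add: power2_less_imp_less)
    qed
    then show "\<exists>N. \<forall>k\<ge>N. \<forall>l\<ge>N. hnorm H (u k \<ominus> u l) < e" by blast
  qed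
  have "range u \<subseteq> carrier H" using u(1) by auto
  then have "\<exists>z\<in>carrier H. \<forall>e>0. \<exists>N. \<forall>k\<ge>N. hnorm H (u k \<ominus> z) < e"
    using hilbert_complete[unfolded pre.mcomplete_iff, THEN spec, of u] cau by simp
  then obtain z where z: "z \<in> carrier H" and lim: "\<And>e. e > 0 \<Longrightarrow> \<exists>N. \<forall>k\<ge>N. hnorm H (u k \<ominus> z) < e"
    by auto
  \<comment> \<open>Moving from \<open>u k\<close> in the direction \<open>w\<close> cannot bring \<open>J\<close> below its infimum.\<close>
  have var: "(Re (cinner H (u k) w) - Re (f w))\<^sup>2 \<le> 1 / Suc k * (hnorm H w)\<^sup>2"
    if w: "w \<in> carrier H" for k w
  proof (rule discriminant_bound)
    fix t :: real
    have "m \<le> J (u k \<oplus> of_real t \<odot> w)" using u w by (intro m_le) auto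
    also have "\<dots> = J (u k) + 2 * t * (Re (cinner H (u k) w) - Re (f w)) + t\<^sup>2 * (hnorm H w)\<^sup>2"
      using u w by (simp add: J_def pre.hnorm_add_sq pre.hnorm_smult pre.cinner_smult_right 
          power_mult_distrib add smult algebra_simps)
    finally show "0 \<le> 1 / Suc k + 2 * t * (Re (cinner H (u k) w) - Re (f w)) + t\<^sup>2 * (hnorm H w)\<^sup>2"
      using u(2)[of k] by simp
  qed simp
  have real: "Re (cinner H z w) = Re (f w)" if w: "w \<in> carrier H" for w
  proof -
    have "\<bar>Re (cinner H z w) - Re (f w)\<bar> \<le> 0 + e" if e: "e > 0" for e
    proof -
      define M where "M = hnorm H w + 1"
      have M: "M > 0" using w by (simp add: M_def add_nonneg_pos)
      obtain N1 where N1: "\<And>k. k \<ge> N1 \<Longrightarrow> hnorm H (u k \<ominus> z) < e / 2 / M"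
        using lim[of "e / 2 / M"] e M by auto
      obtain N2 where N2: "\<And>k. k \<ge> N2 \<Longrightarrow> (hnorm H w)\<^sup>2 / Suc k < (e / 2)\<^sup>2"
        using small[of "(e / 2)\<^sup>2"] e by auto
      define k where "k = max N1 N2"
      have "\<bar>Re (cinner H (u k) w) - Re (f w)\<bar>\<^sup>2 < (e/2)\<^sup>2"
        using var[OF w, of k] N2[of k] by (simp add: k_def)
      then have 1: "\<bar>Re (cinner H (u k) w) - Re (f w)\<bar> < e / 2"
        by (rule power2_less_imp_less) (use e in simp)
      have "\<bar>Re (cinner H (u k) w) - Re (cinner H z w)\<bar> \<le> cmod (cinner H (u k \<ominus> z) w)"
        using u(1)[of k] z w abs_Re_le_cmod[of "cinner H (u k \<ominus> z) w"]
          pre.cinner_diff_left[of w "u k" z] by simp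
      also have "\<dots> \<le> hnorm H (u k \<ominus> z) * hnorm H w"
        using u(1)[of k] z w by (intro pre.cauchy_schwarz) auto
      also have "\<dots> \<le> e / 2 / M * M"
        using N1[of k] e M u(1)[of k] z w by (intro mult_mono) (auto simp: k_def M_def)
      finally have "\<bar>Re (cinner H (u k) w) - Re (cinner H z w)\<bar> \<le> e / 2" using M by simp
      with 1 show ?thesis by linarith
    qed
    then have "\<bar>Re (cinner H z w) - Re (f w)\<bar> \<le> 0" by (rule field_le_epsilon)
    then show ?thesis by simp
  qed
  have "f w = cinner H z w" if w: "w \<in> carrier H" for w
  proof -
    have "Im (cinner H z w) = - Re (cinner H z (\<i> \<odot> w))"
      using z w by (simp add: pre.cinner_smult_right)
    also have "\<dots> = Im (f w)" using real[of "\<i> \<odot> w"] w by (simp add: smult)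
    finally show ?thesis using real[OF w] by (simp add: complex_eq_iff)
  qed
  then show ?thesis using z by blast
qed

abbreviation "BH \<equiv> bounded_ops H"

lemma bounded_opsI:
  assumes "S \<in> carrier H \<rightarrow>\<^sub>E carrier H"
    "\<And>x y. \<lbrakk>x \<in> carrier H; y \<in> carrier H\<rbrakk> \<Longrightarrow> S (x \<oplus> y) = S x \<oplus> S y"
    "\<And>c x. x \<in> carrier H \<Longrightarrow> S (c \<odot> x) = c \<odot> S x"
    "\<And>x. x \<in> carrier H \<Longrightarrow> hnorm H (S x) \<le> K * hnorm H x"
  shows "S \<in> carrier BH"
  using assms unfolding bounded_ops_def op_algebra_def by (auto intro!: exI[of _ K])

lemma bounded_opsD:
  assumes "S \<in> carrier BH"
  shows "S \<in> carrier H \<rightarrow>\<^sub>E carrier H" 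
    and "x \<in> carrier H \<Longrightarrow> S x \<in> carrier H"
    and "\<lbrakk>x \<in> carrier H; y \<in> carrier H\<rbrakk> \<Longrightarrow> S (x \<oplus> y) = S x \<oplus> S y"
    and "x \<in> carrier H \<Longrightarrow> S (c \<odot> x) = c \<odot> S x"
    and "\<exists>K. \<forall>x\<in>carrier H. hnorm H (S x) \<le> K * hnorm H x"
  using assms unfolding bounded_ops_def op_algebra_def by auto

lemma bounded_ops_eqI:
  assumes "S \<in> carrier BH" "T \<in> carrier BH"
    "\<And>x. x \<in> carrier H \<Longrightarrow> S x = T x"
  shows "S = T"
  using assms bounded_opsD(1) by (metis PiE_ext)

lemma bounded_ops_simps:
  "x \<in> carrier H \<Longrightarrow> (S \<otimes>\<^bsub>BH\<^esub> T) x = S (T x)"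
  "x \<in> carrier H \<Longrightarrow> \<one>\<^bsub>BH\<^esub> x = x"
  "x \<in> carrier H \<Longrightarrow> \<zero>\<^bsub>BH\<^esub> x = \<zero>"
  "x \<in> carrier H \<Longrightarrow> (S \<oplus>\<^bsub>BH\<^esub> T) x = S x \<oplus> T x"
  "x \<in> carrier H \<Longrightarrow> (c \<odot>\<^bsub>BH\<^esub> S) x = c \<odot> S x"
  by (auto simp: bounded_ops_def op_algebra_def compose_def)

lemma operator_space_bounded_ops:
  "operator_space H (hnorm H) (carrier BH)"
proof (intro operator_space.intro operator_space_axioms.intro)
  show "normed_module H (hnorm H)" by (rule pre.normed_module_axioms)
  show "(\<lambda>x\<in>carrier H. \<zero>) \<in> carrier BH"
    by (rule bounded_opsI[where K = 0]) auto
  fix S assume S: "S \<in> carrier BH"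
  obtain K where K: "\<And>x. x \<in> carrier H \<Longrightarrow> hnorm H (S x) \<le> K * hnorm H x"
    using bounded_opsD(5)[OF S] by auto
  show "(\<lambda>x\<in>carrier H. c \<odot> S x) \<in> carrier BH" for c
  proof (rule bounded_opsI[where K = "cmod c * K"])
    fix x assume x: "x \<in> carrier H"
    show "hnorm H ((\<lambda>x\<in>carrier H. c \<odot> S x) x) \<le> cmod c * K * hnorm H x"
      using x S K[OF x] by (simp add: pre.hnorm_smult bounded_opsD mult_left_mono mult.assoc)
  qed (use S in \<open>auto simp: bounded_opsD pre.smult_add_right pre.smult_smult mult.commute\<close>)
  fix T assume T: "T \<in> carrier BH"
  obtain K' where K': "\<And>x. x \<in> carrier H \<Longrightarrow> hnorm H (T x) \<le> K' * hnorm H x"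
    using bounded_opsD(5)[OF T] by auto
  show "(\<lambda>x\<in>carrier H. S x \<oplus> T x) \<in> carrier BH"
  proof (rule bounded_opsI[where K = "K + K'"])
    fix x assume x: "x \<in> carrier H"
    have "hnorm H (S x \<oplus> T x) \<le> hnorm H (S x) + hnorm H (T x)"
      using S T x by (intro pre.n_triangle) (auto simp: bounded_opsD)
    then show "hnorm H ((\<lambda>x\<in>carrier H. S x \<oplus> T x) x) \<le> (K + K') * hnorm H x"
      using x K[OF x] K'[OF x] by (simp add: distrib_right)
  qed (use S T in \<open>auto simp: bounded_opsD M.a_ac pre.smult_add_right\<close>)
qed (auto simp: bounded_opsD)

sublocale op: operator_space H "hnorm H" "cinner H" "carrier BH"
  rewrites "op_algebra H (hnorm H) (cinner H) (carrier BH) = BH"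
  by (rule operator_space_bounded_ops) (simp add: bounded_ops_def op_algebra_def)

lemmas nrm_bounded_ops_le = op.nrm_op_le
lemmas hnorm_le_nrm_bounded_ops = op.n_le_nrm_op

text \<open>Riesz representation of the functional \<open>x \<mapsto> \<langle>y, S x\<rangle>\<close>, for each \<open>y\<close>.\<close>

lemma adjoint_exists:
  assumes S: "S \<in> carrier BH"
  shows "\<exists>S'\<in>carrier BH. \<forall>x\<in>carrier H. \<forall>y\<in>carrier H. cinner H (S x) y = cinner H x (S' y)"
proof -
  define K where "K = nrm BH S"
  have K: "hnorm H (S x) \<le> K * hnorm H x" if "x \<in> carrier H" for x
    using hnorm_le_nrm_bounded_ops[OF S that] by (simp add: K_def)
  have "\<exists>z\<in>carrier H. \<forall>x\<in>carrier H. cinner H y (S x) = cinner H z x" if y: "y \<in> carrier H" for y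
  proof (rule riesz_representation[where K = "hnorm H y * K"])
    fix x assume x: "x \<in> carrier H"
    have "cmod (cinner H y (S x)) \<le> hnorm H y * hnorm H (S x)"
      using S x y by (intro pre.cauchy_schwarz) (auto simp: bounded_opsD)
    also have "\<dots> \<le> hnorm H y * (K * hnorm H x)" using K x y by (intro mult_left_mono) auto
    finally show "cmod (cinner H y (S x)) \<le> hnorm H y * K * hnorm H x" by (simp add: mult_ac)
  qed (use S y in \<open>simp_all add: bounded_opsD pre.cinner_add_right pre.cinner_smult_right\<close>)
  then obtain R where R: "\<And>y. y \<in> carrier H \<Longrightarrow> R y \<in> carrier H"
      "\<And>x y. x \<in> carrier H \<Longrightarrow> y \<in> carrier H \<Longrightarrow> cinner H y (S x) = cinner H (R y) x"
    by metis
  have ad: "cinner H x (R y) = cinner H (S x) y" if "x \<in> carrier H" "y \<in> carrier H" for x y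
    using that R S cinner_commute[of "R y" x] cinner_commute[of y "S x"] by (simp add: bounded_opsD)
  have "(\<lambda>y\<in>carrier H. R y) \<in> carrier BH"
  proof (rule bounded_opsI)
    show "(\<lambda>y\<in>carrier H. R y) \<in> carrier H \<rightarrow>\<^sub>E carrier H" using R by auto
  next
    fix x y assume xy: "x \<in> carrier H" "y \<in> carrier H"
    have "R (x \<oplus> y) = R x \<oplus> R y"
      by (rule pre.cinner_ext) (use xy R S ad in \<open>auto simp: pre.cinner_add_right bounded_opsD\<close>)
    then show "(\<lambda>y\<in>carrier H. R y) (x \<oplus> y) = (\<lambda>y\<in>carrier H. R y) x \<oplus> (\<lambda>y\<in>carrier H. R y) y"
      using xy by simp
  next
    fix c x assume x: "x \<in> carrier H"
    have "R (c \<odot> x) = c \<odot> R x"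
      by (rule pre.cinner_ext) (use x R S ad in \<open>auto simp: pre.cinner_smult_right bounded_opsD\<close>)
    then show "(\<lambda>y\<in>carrier H. R y) (c \<odot> x) = c \<odot> (\<lambda>y\<in>carrier H. R y) x" using x by simp
  next
    fix y assume y: "y \<in> carrier H"
    have "hnorm H (R y) \<le> \<bar>K\<bar> * hnorm H y"
    proof (cases "hnorm H (R y) = 0")
      case True then show ?thesis using y by simp
    next
      case False
      then have pos: "hnorm H (R y) > 0" using R(1)[OF y] pre.hnorm_nonneg[of "R y"] by linarith
      have "(hnorm H (R y))\<^sup>2 = Re (cinner H (R y) (R y))" using R y by (intro pre.hnorm_sq) auto
      also have "\<dots> = Re (cinner H (S (R y)) y)" using ad[of "R y" y] R y by simp
      also have "\<dots> \<le> hnorm H (S (R y)) * hnorm H y"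
        using pre.cauchy_schwarz[of "S (R y)" y] complex_Re_le_cmod[of "cinner H (S (R y)) y"] R y S 
        by (simp add: bounded_opsD)
      also have "\<dots> \<le> (\<bar>K\<bar> * hnorm H (R y)) * hnorm H y"
      proof (intro mult_right_mono)
        have "hnorm H (S (R y)) \<le> K * hnorm H (R y)" using K R y by auto
        also have "\<dots> \<le> \<bar>K\<bar> * hnorm H (R y)" using pos by (intro mult_right_mono) auto
        finally show "hnorm H (S (R y)) \<le> \<bar>K\<bar> * hnorm H (R y)" .
      qed (use y in auto)
      finally show ?thesis using pos by (simp add: power2_eq_square)
    qed
    then show "hnorm H ((\<lambda>y\<in>carrier H. R y) y) \<le> \<bar>K\<bar> * hnorm H y" using y by simp
  qed
  then show ?thesis using ad by (intro bexI[of _ "\<lambda>y\<in>carrier H. R y"]) auto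
qed

lemma adj_bounded_ops_eqI:
  assumes S': "S' \<in> carrier BH"
    and ad: "\<And>x y. \<lbrakk>x \<in> carrier H; y \<in> carrier H\<rbrakk> \<Longrightarrow> cinner H (S x) y = cinner H x (S' y)"
  shows "adj BH S = S'"
proof -
  have "adj BH S = (THE S'. S' \<in> carrier BH \<and>
      (\<forall>x\<in>carrier H. \<forall>y\<in>carrier H. cinner H (S x) y = cinner H x (S' y)))"
    by (simp add: bounded_ops_def op_algebra_def)
  also have "\<dots> = S'"
  proof (rule the_equality)
    fix T assume T: "T \<in> carrier BH \<and>
      (\<forall>x\<in>carrier H. \<forall>y\<in>carrier H. cinner H (S x) y = cinner H x (T y))"
    show "T = S'"
      by (rule bounded_ops_eqI) (use T S' ad in \<open>auto intro!: pre.cinner_ext simp: bounded_opsD\<close>)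
  qed (use assms in auto)
  finally show ?thesis .
qed

lemma adj_bounded_ops:
  assumes S: "S \<in> carrier BH"
  shows "adj BH S \<in> carrier BH"
    and "\<lbrakk>x \<in> carrier H; y \<in> carrier H\<rbrakk> \<Longrightarrow> cinner H (S x) y = cinner H x (adj BH S y)"
    and "\<lbrakk>x \<in> carrier H; y \<in> carrier H\<rbrakk> \<Longrightarrow> cinner H x (S y) = cinner H (adj BH S x) y"
proof -
  obtain S' where S': "S' \<in> carrier BH"
      "\<And>x y. \<lbrakk>x \<in> carrier H; y \<in> carrier H\<rbrakk> \<Longrightarrow> cinner H (S x) y = cinner H x (S' y)"
    using adjoint_exists[OF S] by blast
  then have eq: "adj BH S = S'" by (rule adj_bounded_ops_eqI)
  show a: "adj BH S \<in> carrier BH" using S' eq by simp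
  show b: "cinner H (S x) y = cinner H x (adj BH S y)"
    if "x \<in> carrier H" "y \<in> carrier H" for x y
    using S' eq that by simp
  show "\<lbrakk>x \<in> carrier H; y \<in> carrier H\<rbrakk> \<Longrightarrow> cinner H x (S y) = cinner H (adj BH S x) y"
    using b[of y x] a S cinner_commute[of "S y" x] cinner_commute[of y "adj BH S x"]
    by (simp add: bounded_opsD)
qed

lemma bounded_ops_closed:
  shows "\<one>\<^bsub>BH\<^esub> \<in> carrier BH"
    and "\<zero>\<^bsub>BH\<^esub> \<in> carrier BH"
    and "\<lbrakk>S \<in> carrier BH; T \<in> carrier BH\<rbrakk>
      \<Longrightarrow> S \<otimes>\<^bsub>BH\<^esub> T \<in> carrier BH"
    and "\<lbrakk>S \<in> carrier BH; T \<in> carrier BH\<rbrakk>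
      \<Longrightarrow> S \<oplus>\<^bsub>BH\<^esub> T \<in> carrier BH"
    and "S \<in> carrier BH \<Longrightarrow> c \<odot>\<^bsub>BH\<^esub> S \<in> carrier BH"
proof -
  show "\<one>\<^bsub>BH\<^esub> \<in> carrier BH"
    by (rule bounded_opsI[where K = 1])
      (auto simp: bounded_ops_simps bounded_ops_def op_algebra_def)
  show "S \<otimes>\<^bsub>BH\<^esub> T \<in> carrier BH"
    if S: "S \<in> carrier BH" and T: "T \<in> carrier BH"
  proof (rule bounded_opsI[where K = "\<bar>nrm BH S\<bar> * nrm BH T"])
    show "S \<otimes>\<^bsub>BH\<^esub> T \<in> carrier H \<rightarrow>\<^sub>E carrier H"
      using S T by (auto simp: bounded_ops_simps bounded_opsD) (simp add: bounded_ops_def op_algebra_def compose_def)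
    fix x assume x: "x \<in> carrier H"
    have "hnorm H (S (T x)) \<le> nrm BH S * hnorm H (T x)"
      using S T x by (intro hnorm_le_nrm_bounded_ops) (auto simp: bounded_opsD)
    also have "\<dots> \<le> \<bar>nrm BH S\<bar> * (nrm BH T * hnorm H x)"
      using S T x by (intro mult_mono hnorm_le_nrm_bounded_ops) (auto simp: bounded_opsD)
    finally show "hnorm H ((S \<otimes>\<^bsub>BH\<^esub> T) x) \<le> \<bar>nrm BH S\<bar> * nrm BH T * hnorm H x"
      using x by (simp add: bounded_ops_simps mult_ac)
  qed (use S T in \<open>simp_all add: bounded_ops_simps bounded_opsD\<close>)
qed (simp_all only: op.op_algebra_simps op.zero_op op.add_op op.smult_op)

lemmas bops_simps = bounded_ops_simps bounded_ops_closed bounded_opsD(2-4)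

end

lemma pre_cstar_bounded_ops:
  assumes "hilbert_space H"
  shows "pre_cstar_algebra (bounded_ops H)"
proof -
  interpret hilbert_space H by fact
  let ?B = "bounded_ops H"
  have normed: "normed_module ?B (nrm ?B)"
    by (rule op.normed_op_algebra)
  interpret B: normed_module ?B "nrm ?B" by (rule normed)
  have ring: "ring ?B"
  proof (rule ringI)
    show "monoid ?B"
      by (rule monoidI) (auto simp: bops_simps intro!: bounded_ops_eqI)
  qed (use B.M.abelian_group_axioms in \<open>auto simp: bops_simps intro!: bounded_ops_eqI\<close>)
  note n0 = op.nrm_op_nonneg
  note le = hnorm_le_nrm_bounded_ops
  have nm: "nrm ?B (S \<otimes>\<^bsub>?B\<^esub> T) \<le> nrm ?B S * nrm ?B T"
    if S: "S \<in> carrier ?B" and T: "T \<in> carrier ?B" for S T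
  proof (rule nrm_bounded_ops_le)
    fix x assume x: "x \<in> carrier H"
    have "hnorm H (S (T x)) \<le> nrm ?B S * hnorm H (T x)"
      using S T x by (intro le) (auto simp: bops_simps)
    also have "\<dots> \<le> nrm ?B S * (nrm ?B T * hnorm H x)"
      using n0[OF S] le[OF T x] by (intro mult_left_mono)
    finally show "hnorm H ((S \<otimes>\<^bsub>?B\<^esub> T) x) \<le> nrm ?B S * nrm ?B T * hnorm H x"
      using x by (simp add: bops_simps mult_ac)
  qed (use n0[OF S] n0[OF T] in simp)
  note ad = adj_bounded_ops
  have aa: "adj ?B (adj ?B S) = S" if S: "S \<in> carrier ?B" for S
    by (rule adj_bounded_ops_eqI) (use S ad(3)[OF S] in \<open>auto simp: bops_simps\<close>)
  have am: "adj ?B (S \<otimes>\<^bsub>?B\<^esub> T) = adj ?B T \<otimes>\<^bsub>?B\<^esub> adj ?B S"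
    if S: "S \<in> carrier ?B" and T: "T \<in> carrier ?B" for S T
  proof (rule adj_bounded_ops_eqI)
    fix x y assume x: "x \<in> carrier H" and y: "y \<in> carrier H"
    show "cinner H ((S \<otimes>\<^bsub>?B\<^esub> T) x) y = cinner H x ((adj ?B T \<otimes>\<^bsub>?B\<^esub> adj ?B S) y)"
      using ad(2)[OF S, of "T x" y] ad(2)[OF T, of x "adj ?B S y"] S T x y ad(1)
      by (simp add: bops_simps)
  qed (use S T ad(1) in \<open>auto simp: bops_simps\<close>)
  have nle: "(nrm ?B S)\<^sup>2 \<le> nrm ?B (adj ?B S \<otimes>\<^bsub>?B\<^esub> S)" if S: "S \<in> carrier ?B" for S
  proof -
    have c: "adj ?B S \<otimes>\<^bsub>?B\<^esub> S \<in> carrier ?B" using S ad(1) by (auto simp: bops_simps)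
    have "nrm ?B S \<le> sqrt (nrm ?B (adj ?B S \<otimes>\<^bsub>?B\<^esub> S))"
    proof (rule nrm_bounded_ops_le)
      fix x assume x: "x \<in> carrier H"
      have "(hnorm H (S x))\<^sup>2 = Re (cinner H (S x) (S x))"
        using S x by (intro pre.hnorm_sq) (auto simp: bops_simps)
      also have "\<dots> = Re (cinner H x ((adj ?B S \<otimes>\<^bsub>?B\<^esub> S) x))"
        using ad(2)[OF S, of x "S x"] S x by (simp add: bops_simps)
      also have "\<dots> \<le> hnorm H x * hnorm H ((adj ?B S \<otimes>\<^bsub>?B\<^esub> S) x)"
        using pre.cauchy_schwarz[of x "(adj ?B S \<otimes>\<^bsub>?B\<^esub> S) x"] bounded_opsD(2)[OF c x] x
          complex_Re_le_cmod[of "cinner H x ((adj ?B S \<otimes>\<^bsub>?B\<^esub> S) x)"] by linarith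
      also have "\<dots> \<le> hnorm H x * (nrm ?B (adj ?B S \<otimes>\<^bsub>?B\<^esub> S) * hnorm H x)"
        using x le[OF c x] by (intro mult_left_mono) auto
      also have "\<dots> = (sqrt (nrm ?B (adj ?B S \<otimes>\<^bsub>?B\<^esub> S)) * hnorm H x)\<^sup>2"
        using n0[OF c] by (simp add: power_mult_distrib power2_eq_square[of "hnorm H x"])
      finally show "hnorm H (S x) \<le> sqrt (nrm ?B (adj ?B S \<otimes>\<^bsub>?B\<^esub> S)) * hnorm H x"
        by (rule power2_le_imp_le) (use n0[OF c] x in simp)
    qed (use n0[OF c] in simp)
    then have "(nrm ?B S)\<^sup>2 \<le> (sqrt (nrm ?B (adj ?B S \<otimes>\<^bsub>?B\<^esub> S)))\<^sup>2"
      using n0[OF S] by (intro power_mono) auto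
    then show ?thesis using n0[OF c] by simp
  qed
  have na: "nrm ?B (adj ?B S) \<le> nrm ?B S" if S: "S \<in> carrier ?B" for S
  proof (cases "nrm ?B (adj ?B S) = 0")
    case True then show ?thesis using n0[OF S] by simp
  next
    case False
    then have "nrm ?B (adj ?B S) > 0" using n0[OF ad(1)[OF S]] by simp
    moreover have "(nrm ?B (adj ?B S))\<^sup>2 \<le> nrm ?B S * nrm ?B (adj ?B S)"
      using nle[OF ad(1)[OF S]] aa[OF S] nm[OF S ad(1)[OF S]] by simp
    ultimately show ?thesis by (simp add: power2_eq_square)
  qed
  show ?thesis
  proof (intro pre_cstar_algebra.intro pre_cstar_algebra_axioms.intro normed ring)
    fix S assume S: "S \<in> carrier ?B"
    show "nrm ?B (adj ?B S \<otimes>\<^bsub>?B\<^esub> S) = (nrm ?B S)\<^sup>2"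
    proof (rule antisym)
      have "nrm ?B (adj ?B S \<otimes>\<^bsub>?B\<^esub> S) \<le> nrm ?B (adj ?B S) * nrm ?B S" using nm[OF ad(1)[OF S] S] .
      also have "\<dots> \<le> nrm ?B S * nrm ?B S" using na[OF S] n0[OF S] by (intro mult_right_mono)
      finally show "nrm ?B (adj ?B S \<otimes>\<^bsub>?B\<^esub> S) \<le> (nrm ?B S)\<^sup>2" by (simp add: power2_eq_square)
    qed (rule nle[OF S])
    fix c
    show "adj ?B (c \<odot>\<^bsub>?B\<^esub> S) = cnj c \<odot>\<^bsub>?B\<^esub> adj ?B S"
      by (rule adj_bounded_ops_eqI)
        (use S ad[OF S] in \<open>auto simp: bops_simps pre.cinner_smult_left pre.cinner_smult_right\<close>)
  next
    fix S T assume S: "S \<in> carrier ?B" and T: "T \<in> carrier ?B"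
    show "adj ?B (S \<oplus>\<^bsub>?B\<^esub> T) = adj ?B S \<oplus>\<^bsub>?B\<^esub> adj ?B T"
      by (rule adj_bounded_ops_eqI)
        (use S T ad[OF S] ad[OF T] in \<open>auto simp: bops_simps pre.cinner_add_left pre.cinner_add_right\<close>)
  qed (use aa am nm ad(1) in \<open>auto simp: bops_simps intro!: bounded_ops_eqI\<close>)
qed

section \<open>Square summable functions\<close>

lemma ell2_simps:
  "f \<in> carrier (ell2 S) \<longleftrightarrow> (\<forall>\<mu>. \<mu> \<notin> S \<longrightarrow> f \<mu> = 0) \<and> (\<lambda>\<mu>. (cmod (f \<mu>))\<^sup>2) summable_on S"
  "\<zero>\<^bsub>ell2 S\<^esub> = (\<lambda>_. 0)"
  "f \<oplus>\<^bsub>ell2 S\<^esub> g = (\<lambda>\<mu>. f \<mu> + g \<mu>)"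
  "c \<odot>\<^bsub>ell2 S\<^esub> f = (\<lambda>\<mu>. c * f \<mu>)"
  "cinner (ell2 S) f g = (\<Sum>\<^sub>\<infinity>\<mu>\<in>S. cnj (f \<mu>) * g \<mu>)"
  by (simp_all add: ell2_def)

lemma summable_on_comparison:
  fixes f g :: "'i \<Rightarrow> real"
  assumes "g summable_on S" "\<And>x. x \<in> S \<Longrightarrow> 0 \<le> f x" "\<And>x. x \<in> S \<Longrightarrow> f x \<le> g x"
  shows "f summable_on S"
proof -
  have g: "\<And>x. x \<in> S \<Longrightarrow> 0 \<le> g x" using assms(2,3) order_trans by blast
  then have "(\<lambda>x. norm (g x)) summable_on S" using assms(1) by (simp cong: summable_on_cong)
  then have "(\<lambda>x. norm (f x)) summable_on S"
    by (rule Infinite_Sum.abs_summable_on_comparison_test) (use assms g in auto)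
  then show ?thesis by (rule abs_summable_summable)
qed

lemma cmod_add_sq_le: "(cmod (a + b))\<^sup>2 \<le> 2 * (cmod a)\<^sup>2 + 2 * (cmod b)\<^sup>2"
proof -
  have "(cmod (a + b))\<^sup>2 \<le> (cmod a + cmod b)\<^sup>2" by (intro power_mono norm_triangle_ineq) auto
  also have "\<dots> \<le> 2 * (cmod a)\<^sup>2 + 2 * (cmod b)\<^sup>2"
    using zero_le_power2[of "cmod a - cmod b"] by (simp add: power2_sum power2_diff)
  finally show ?thesis .
qed

lemma ell2_add_closed:
  assumes "f \<in> carrier (ell2 S)" "g \<in> carrier (ell2 S)"
  shows "(\<lambda>\<mu>. f \<mu> + g \<mu>) \<in> carrier (ell2 S)"
proof -
  have "(\<lambda>\<mu>. 2 * (cmod (f \<mu>))\<^sup>2 + 2 * (cmod (g \<mu>))\<^sup>2) summable_on S"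
    using assms by (intro summable_on_add summable_on_cmult_right) (auto simp: ell2_simps)
  then have "(\<lambda>\<mu>. (cmod (f \<mu> + g \<mu>))\<^sup>2) summable_on S"
    by (rule summable_on_comparison) (auto intro: cmod_add_sq_le)
  then show ?thesis using assms by (simp add: ell2_simps)
qed

lemma ell2_smult_closed:
  assumes "f \<in> carrier (ell2 S)"
  shows "(\<lambda>\<mu>. c * f \<mu>) \<in> carrier (ell2 S)"
  using assms by (auto simp: ell2_simps norm_mult power_mult_distrib intro!: summable_on_cmult_right)

lemma ell2_cinner_summable:
  assumes "f \<in> carrier (ell2 S)" "g \<in> carrier (ell2 S)"
  shows "(\<lambda>\<mu>. cnj (f \<mu>) * g \<mu>) summable_on S"
proof (rule abs_summable_summable)
  have s: "(\<lambda>\<mu>. (cmod (f \<mu>))\<^sup>2 + (cmod (g \<mu>))\<^sup>2) summable_on S"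
    using assms by (intro summable_on_add) (auto simp: ell2_simps)
  have "cmod a * cmod b \<le> (cmod a)\<^sup>2 + (cmod b)\<^sup>2" for a b
  proof -
    have "2 * (cmod a * cmod b) \<le> (cmod a)\<^sup>2 + (cmod b)\<^sup>2"
      using zero_le_power2[of "cmod a - cmod b"] by (simp add: power2_diff mult.assoc)
    moreover have "0 \<le> cmod a * cmod b" by simp
    ultimately show ?thesis by linarith
  qed
  then show "(\<lambda>\<mu>. norm (cnj (f \<mu>) * g \<mu>)) summable_on S"
    using s by (intro summable_on_comparison[OF s]) (auto simp: norm_mult)
qed

lemma ell2_cinner_self:
  assumes "f \<in> carrier (ell2 S)"
  shows "cinner (ell2 S) f f = of_real (\<Sum>\<^sub>\<infinity>\<mu>\<in>S. (cmod (f \<mu>))\<^sup>2)"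
proof -
  have "((\<lambda>\<mu>. (cmod (f \<mu>))\<^sup>2) has_sum (\<Sum>\<^sub>\<infinity>\<mu>\<in>S. (cmod (f \<mu>))\<^sup>2)) S"
    using assms by (simp add: ell2_simps summable_iff_has_sum_infsum)
  then have "((\<lambda>\<mu>. complex_of_real ((cmod (f \<mu>))\<^sup>2)) has_sum of_real (\<Sum>\<^sub>\<infinity>\<mu>\<in>S. (cmod (f \<mu>))\<^sup>2)) S"
    by (rule has_sum_of_real)
  then have "((\<lambda>\<mu>. cnj (f \<mu>) * f \<mu>) has_sum of_real (\<Sum>\<^sub>\<infinity>\<mu>\<in>S. (cmod (f \<mu>))\<^sup>2)) S"
    using complex_norm_square by (simp add: mult.commute)
  then show ?thesis by (simp add: ell2_simps infsumI)
qed

lemma pre_hilbert_ell2: "pre_hilbert (ell2 S)"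
proof (intro pre_hilbert.intro pre_hilbert_axioms.intro)
  show "Module.module Cx (ell2 S)"
  proof (rule moduleI)
    show "abelian_group (ell2 S)"
    proof (rule abelian_groupI)
      fix f assume f: "f \<in> carrier (ell2 S)"
      show "\<exists>g\<in>carrier (ell2 S). g \<oplus>\<^bsub>ell2 S\<^esub> f = \<zero>\<^bsub>ell2 S\<^esub>"
        using ell2_smult_closed[OF f, of "-1"] by (intro bexI[of _ "\<lambda>\<mu>. - 1 * f \<mu>"]) (auto simp: ell2_simps)
    qed (auto simp: ell2_simps(2-) ell2_add_closed, auto simp: ell2_simps)
  qed (auto simp: cring_Cx ell2_simps(2-) ell2_smult_closed algebra_simps)
next
  fix f g h assume a: "f \<in> carrier (ell2 S)" "g \<in> carrier (ell2 S)" "h \<in> carrier (ell2 S)"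
  show "cinner (ell2 S) f (g \<oplus>\<^bsub>ell2 S\<^esub> h) = cinner (ell2 S) f g + cinner (ell2 S) f h"
    using a by (simp add: ell2_simps(2-) distrib_left infsum_add ell2_cinner_summable)
next
  fix f g c assume a: "f \<in> carrier (ell2 S)" "g \<in> carrier (ell2 S)"
  show "cinner (ell2 S) f (c \<odot>\<^bsub>ell2 S\<^esub> g) = c * cinner (ell2 S) f g"
    by (simp add: ell2_simps(2-) mult.left_commute infsum_cmult_right')
next
  fix f g assume a: "f \<in> carrier (ell2 S)" "g \<in> carrier (ell2 S)"
  show "cinner (ell2 S) g f = cnj (cinner (ell2 S) f g)"
    by (simp add: ell2_simps(2-) mult.commute flip: infsum_cnj)
next
  fix f assume f: "f \<in> carrier (ell2 S)"
  show "0 \<le> Re (cinner (ell2 S) f f)"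
    using f by (simp add: ell2_cinner_self infsum_nonneg)
  have "f \<mu> = 0" if "(\<Sum>\<^sub>\<infinity>\<mu>\<in>S. (cmod (f \<mu>))\<^sup>2) = 0" for \<mu>
  proof (cases "\<mu> \<in> S")
    case True
    have "(cmod (f \<mu>))\<^sup>2 = 0"
      by (rule nonneg_infsum_le_0D[where A = S]) (use f that True in \<open>auto simp: ell2_simps\<close>)
    then show ?thesis by simp
  qed (use f in \<open>simp add: ell2_simps\<close>)
  then have "(\<Sum>\<^sub>\<infinity>\<mu>\<in>S. (cmod (f \<mu>))\<^sup>2) = 0 \<longleftrightarrow> f = (\<lambda>_. 0)"
    by (metis (mono_tags, lifting) infsum_0 norm_zero power_zero_numeral)
  then show "cinner (ell2 S) f f = 0 \<longleftrightarrow> f = \<zero>\<^bsub>ell2 S\<^esub>"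
    by (simp only: ell2_cinner_self[OF f] of_real_eq_0_iff ell2_simps(2))
qed

lemma hnorm_ell2_sq:
  assumes "f \<in> carrier (ell2 S)"
  shows "(hnorm (ell2 S) f)\<^sup>2 = (\<Sum>\<^sub>\<infinity>\<mu>\<in>S. (cmod (f \<mu>))\<^sup>2)"
proof -
  interpret pre_hilbert "ell2 S" by (rule pre_hilbert_ell2)
  show ?thesis using assms by (simp add: hnorm_sq ell2_cinner_self)
qed

lemma ell2_diff:
  assumes "f \<in> carrier (ell2 S)" "g \<in> carrier (ell2 S)"
  shows "f \<ominus>\<^bsub>ell2 S\<^esub> g = (\<lambda>\<mu>. f \<mu> - g \<mu>)"
proof -
  interpret pre_hilbert "ell2 S" by (rule pre_hilbert_ell2)
  show ?thesis using assms by (simp add: diff_eq_smult ell2_simps(2-))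
qed

lemma sum_sq_le_hnorm:
  assumes "f \<in> carrier (ell2 S)" "finite J" "J \<subseteq> S"
  shows "(\<Sum>\<mu>\<in>J. (cmod (f \<mu>))\<^sup>2) \<le> (hnorm (ell2 S) f)\<^sup>2"
  unfolding hnorm_ell2_sq[OF assms(1)]
  using assms by (intro finite_sum_le_infsum) (auto simp: ell2_simps)

lemma cmod_le_hnorm_ell2:
  assumes "f \<in> carrier (ell2 S)"
  shows "cmod (f \<mu>) \<le> hnorm (ell2 S) f"
proof -
  interpret pre_hilbert "ell2 S" by (rule pre_hilbert_ell2)
  show ?thesis
  proof (cases "\<mu> \<in> S")
    case True
    then have "(cmod (f \<mu>))\<^sup>2 \<le> (hnorm (ell2 S) f)\<^sup>2"
      using sum_sq_le_hnorm[OF assms, of "{\<mu>}"] by simp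
    then show ?thesis using assms by (simp add: power2_le_iff_abs_le)
  next
    case False
    then have "f \<mu> = 0" using assms by (simp add: ell2_simps)
    then show ?thesis using assms by simp
  qed
qed

text \<open>Finite partial sums control membership and norm alike, and they are continuous under entrywise
  limits.\<close>

lemma ell2_of_finite_sums:
  assumes "\<And>\<mu>. \<mu> \<notin> S \<Longrightarrow> f \<mu> = 0" "0 \<le> e"
    and "\<And>J. finite J \<Longrightarrow> J \<subseteq> S \<Longrightarrow> (\<Sum>\<mu>\<in>J. (cmod (f \<mu>))\<^sup>2) \<le> e\<^sup>2"
  shows "f \<in> carrier (ell2 S)" and "hnorm (ell2 S) f \<le> e"
proof -
  interpret pre_hilbert "ell2 S" by (rule pre_hilbert_ell2)
  have "(\<lambda>\<mu>. (cmod (f \<mu>))\<^sup>2) summable_on S"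
    using assms(3) by (intro nonneg_bdd_above_summable_on) (auto intro!: bdd_aboveI)
  then show f: "f \<in> carrier (ell2 S)" using assms(1) by (simp add: ell2_simps)
  have "(hnorm (ell2 S) f)\<^sup>2 \<le> e\<^sup>2"
    unfolding hnorm_ell2_sq[OF f]
    using f assms(3) by (intro infsum_le_finite_sums) (auto simp: ell2_simps)
  then show "hnorm (ell2 S) f \<le> e" using assms(2) by (rule power2_le_imp_le)
qed

text \<open>A Cauchy sequence converges entrywise, and its tail estimates, which hold on every finite set of
  indices, survive the limit.\<close>

lemma hilbert_space_ell2: "hilbert_space (ell2 S)"
proof -
  interpret pre_hilbert "ell2 S" by (rule pre_hilbert_ell2)
  let ?n = "hnorm (ell2 S)"
  have "\<exists>g\<in>carrier (ell2 S). \<forall>e>0. \<exists>N. \<forall>k\<ge>N. ?n (u k \<ominus>\<^bsub>ell2 S\<^esub> g) < e"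
    if u: "range u \<subseteq> carrier (ell2 S)"
      and cau: "\<forall>e>0. \<exists>N. \<forall>k\<ge>N. \<forall>l\<ge>N. ?n (u k \<ominus>\<^bsub>ell2 S\<^esub> u l) < e"
    for u :: "nat \<Rightarrow> 'a \<Rightarrow> complex"
  proof -
    have uc: "u k \<in> carrier (ell2 S)" for k using u by auto
    note ud = ell2_diff[OF uc uc]
    have uc2: "(\<lambda>\<mu>. u k \<mu> - u l \<mu>) \<in> carrier (ell2 S)" for k l
      using M.minus_closed[OF uc uc] by (simp add: ud)
    have "Cauchy (\<lambda>k. u k \<mu>)" for \<mu>
    proof (rule metric_CauchyI)
      fix e :: real assume "e > 0"
      then obtain N where N: "\<And>k l. k \<ge> N \<Longrightarrow> l \<ge> N \<Longrightarrow> ?n (u k \<ominus>\<^bsub>ell2 S\<^esub> u l) < e"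
        using cau by blast
      have "dist (u k \<mu>) (u l \<mu>) < e" if "k \<ge> N" "l \<ge> N" for k l
        using cmod_le_hnorm_ell2[of "u k \<ominus>\<^bsub>ell2 S\<^esub> u l" S \<mu>] N[OF that] uc
        by (simp add: ud dist_norm uc2)
      then show "\<exists>N. \<forall>k\<ge>N. \<forall>l\<ge>N. dist (u k \<mu>) (u l \<mu>) < e" by blast
    qed
    then have "\<exists>y. (\<lambda>k. u k \<mu>) \<longlonglongrightarrow> y" for \<mu>
      by (simp add: Cauchy_convergent_iff convergent_def)
    then obtain g where g: "\<And>\<mu>. (\<lambda>k. u k \<mu>) \<longlonglongrightarrow> g \<mu>" by metis
    have g0: "g \<mu> = 0" if "\<mu> \<notin> S" for \<mu>
      using g[of \<mu>] uc that by (simp add: ell2_simps LIMSEQ_const_iff)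
    have tail: "(\<lambda>\<mu>. u k \<mu> - g \<mu>) \<in> carrier (ell2 S)" "?n (\<lambda>\<mu>. u k \<mu> - g \<mu>) \<le> e"
      if e: "e > 0" and N: "\<And>k l. k \<ge> N \<Longrightarrow> l \<ge> N \<Longrightarrow> ?n (u k \<ominus>\<^bsub>ell2 S\<^esub> u l) < e" and k: "k \<ge> N"
      for e N k
    proof -
      have fin: "(\<Sum>\<mu>\<in>J. (cmod (u k \<mu> - g \<mu>))\<^sup>2) \<le> e\<^sup>2" if J: "finite J" "J \<subseteq> S" for J
      proof (rule tendsto_upperbound)
        show "(\<lambda>l. \<Sum>\<mu>\<in>J. (cmod (u k \<mu> - u l \<mu>))\<^sup>2) \<longlonglongrightarrow> (\<Sum>\<mu>\<in>J. (cmod (u k \<mu> - g \<mu>))\<^sup>2)"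
          by (intro tendsto_intros g)
        have "(\<Sum>\<mu>\<in>J. (cmod (u k \<mu> - u l \<mu>))\<^sup>2) \<le> e\<^sup>2" if l: "l \<ge> N" for l
        proof -
          have "(\<Sum>\<mu>\<in>J. (cmod (u k \<mu> - u l \<mu>))\<^sup>2) \<le> (?n (u k \<ominus>\<^bsub>ell2 S\<^esub> u l))\<^sup>2"
            using sum_sq_le_hnorm[of "u k \<ominus>\<^bsub>ell2 S\<^esub> u l" S J] J uc
            by (simp add: ud uc2)
          also have "\<dots> \<le> e\<^sup>2" using N[OF k l] e uc 
            by (intro power_mono) (auto simp: ud uc2 intro: less_imp_le)
          finally show ?thesis .
        qed
        then show "\<forall>\<^sub>F l in sequentially. (\<Sum>\<mu>\<in>J. (cmod (u k \<mu> - u l \<mu>))\<^sup>2) \<le> e\<^sup>2"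
          unfolding eventually_sequentially by blast
      qed simp
      have z: "u k \<mu> - g \<mu> = 0" if "\<mu> \<notin> S" for \<mu>
        using g0[OF that] uc that by (simp add: ell2_simps)
      show "(\<lambda>\<mu>. u k \<mu> - g \<mu>) \<in> carrier (ell2 S)" "?n (\<lambda>\<mu>. u k \<mu> - g \<mu>) \<le> e"
        using ell2_of_finite_sums[where e = e, OF z _ fin] e by auto
    qed
    have gc: "g \<in> carrier (ell2 S)"
    proof -
      obtain N where "\<And>k l. k \<ge> N \<Longrightarrow> l \<ge> N \<Longrightarrow> ?n (u k \<ominus>\<^bsub>ell2 S\<^esub> u l) < 1"
        using cau[THEN spec, of 1] by auto
      then have "(\<lambda>\<mu>. u N \<mu> - g \<mu>) \<in> carrier (ell2 S)" by (intro tail(1)[of 1 N N]) auto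
      from ell2_add_closed[OF uc[of N] ell2_smult_closed[OF this, of "-1"]] show ?thesis by simp
    qed
    show ?thesis
    proof (intro bexI[OF _ gc] allI impI)
      fix e :: real assume e: "e > 0"
      then obtain N where N: "\<And>k l. k \<ge> N \<Longrightarrow> l \<ge> N \<Longrightarrow> ?n (u k \<ominus>\<^bsub>ell2 S\<^esub> u l) < e / 2"
        using cau[THEN spec, of "e / 2"] by auto
      have "?n (u k \<ominus>\<^bsub>ell2 S\<^esub> g) < e" if "k \<ge> N" for k
        using tail(2)[OF _ N that] e by (simp add: ell2_diff[OF uc gc])
      then show "\<exists>N. \<forall>k\<ge>N. ?n (u k \<ominus>\<^bsub>ell2 S\<^esub> g) < e" by blast
    qed
  qed
  then have complete: "Metric_space.mcomplete (carrier (ell2 S)) (ndist (ell2 S) (hnorm (ell2 S)))"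
    unfolding mcomplete_iff by (intro allI impI)
  show ?thesis
  proof (intro hilbert_space.intro hilbert_space_axioms.intro complete module_axioms)
  qed (rule cinner_add_right cinner_smult_right cinner_commute cinner_nonneg cinner_eq_0; assumption)+
qed

lemma hnorm_basis_vec: 
  assumes "\<nu> \<in> S"
  shows "hnorm (ell2 S) (basis_vec \<nu>) = 1"
proof -
  have "(\<Sum>\<^sub>\<infinity>\<mu>\<in>S. cnj (basis_vec \<nu> \<mu>) * basis_vec \<nu> \<mu>) = (\<Sum>\<^sub>\<infinity>\<mu>\<in>{\<nu>}. 1)"
    using assms by (intro infsum_cong_neutral) (auto simp: basis_vec_def)
  then show ?thesis by (simp add: hnorm_def ell2_simps)
qed

lemma cinner_basis_vec:
  assumes "\<nu> \<in> S"
  shows "cinner (ell2 S) (basis_vec \<nu>) f = f \<nu>"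
proof -
  have "(\<Sum>\<^sub>\<infinity>\<mu>\<in>S. cnj (basis_vec \<nu> \<mu>) * f \<mu>) = (\<Sum>\<^sub>\<infinity>\<mu>\<in>{\<nu>}. f \<mu>)"
    using assms by (intro infsum_cong_neutral) (auto simp: basis_vec_def)
  then show ?thesis by (simp add: ell2_simps)
qed

section \<open>Diagonal operators\<close>

locale ell2_operators =
  fixes S :: "'i set"
begin

abbreviation "Op \<equiv> bounded_ops (ell2 S)"

sublocale H: hilbert_space "ell2 S"
  by (rule hilbert_space_ell2)

sublocale F: pre_cstar_algebra Op
  by (rule pre_cstar_bounded_ops) (rule hilbert_space_ell2)

abbreviation op_times (infixl "\<cdot>" 70) where
  "x \<cdot> y \<equiv> x \<otimes>\<^bsub>Op\<^esub> y"

lemma op_eqI: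
  assumes "Z \<in> carrier Op" "Y \<in> carrier Op"
    "\<And>x \<nu>. x \<in> carrier (ell2 S) \<Longrightarrow> \<nu> \<in> S \<Longrightarrow> Z x \<nu> = Y x \<nu>"
  shows "Z = Y"
proof (rule H.bounded_ops_eqI[OF assms(1,2)])
  fix x assume x: "x \<in> carrier (ell2 S)"
  show "Z x = Y x"
  proof
    fix \<nu>
    show "Z x \<nu> = Y x \<nu>"
      using assms(3)[OF x] H.bounded_opsD(2)[OF assms(1) x] H.bounded_opsD(2)[OF assms(2) x]
      by (cases "\<nu> \<in> S") (auto simp: ell2_simps)
  qed
qed

text \<open>As the vectors vanish off \<open>S\<close>, \<open>diag f\<close> depends only on the restriction of \<open>f\<close> to \<open>S\<close>.\<close>

definition diag :: "('i \<Rightarrow> complex) \<Rightarrow> ('i \<Rightarrow> complex) \<Rightarrow> 'i \<Rightarrow> complex" where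
  "diag f = (\<lambda>x\<in>carrier (ell2 S). \<lambda>\<nu>. f \<nu> * x \<nu>)"

definition bdd :: "('i \<Rightarrow> complex) \<Rightarrow> bool" where
  "bdd f \<longleftrightarrow> (\<exists>C. \<forall>\<nu>\<in>S. cmod (f \<nu>) \<le> C)"

lemma diag_bound:
  assumes f: "\<And>\<nu>. \<nu> \<in> S \<Longrightarrow> cmod (f \<nu>) \<le> C" "0 \<le> C" and x: "x \<in> carrier (ell2 S)"
  shows "(\<lambda>\<nu>. f \<nu> * x \<nu>) \<in> carrier (ell2 S)"
    and "hnorm (ell2 S) (\<lambda>\<nu>. f \<nu> * x \<nu>) \<le> C * hnorm (ell2 S) x"
proof -
  have fin: "(\<Sum>\<mu>\<in>J. (cmod (f \<mu> * x \<mu>))\<^sup>2) \<le> (C * hnorm (ell2 S) x)\<^sup>2"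
    if J: "finite J" "J \<subseteq> S" for J
  proof -
    have "(\<Sum>\<mu>\<in>J. (cmod (f \<mu> * x \<mu>))\<^sup>2) \<le> (\<Sum>\<mu>\<in>J. C\<^sup>2 * (cmod (x \<mu>))\<^sup>2)"
      using J f by (intro sum_mono) (auto simp: norm_mult power_mult_distrib intro!: mult_right_mono power_mono)
    also have "\<dots> = C\<^sup>2 * (\<Sum>\<mu>\<in>J. (cmod (x \<mu>))\<^sup>2)" by (simp add: sum_distrib_left)
    also have "\<dots> \<le> C\<^sup>2 * (hnorm (ell2 S) x)\<^sup>2"
      using sum_sq_le_hnorm[OF x J] by (intro mult_left_mono) auto
    finally show ?thesis by (simp add: power_mult_distrib)
  qed
  have z: "\<mu> \<notin> S \<Longrightarrow> f \<mu> * x \<mu> = 0" for \<mu> using x by (simp add: ell2_simps)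
  have p: "0 \<le> C * hnorm (ell2 S) x" using f(2) x by simp
  show "(\<lambda>\<nu>. f \<nu> * x \<nu>) \<in> carrier (ell2 S)" by (rule ell2_of_finite_sums(1)[OF z p fin])
  show "hnorm (ell2 S) (\<lambda>\<nu>. f \<nu> * x \<nu>) \<le> C * hnorm (ell2 S) x"
    by (rule ell2_of_finite_sums(2)[OF z p fin])
qed

lemma bddE:
  assumes "bdd f"
  obtains C where "\<And>\<nu>. \<nu> \<in> S \<Longrightarrow> cmod (f \<nu>) \<le> C" "0 \<le> C"
  using assms unfolding bdd_def by (metis abs_ge_self abs_ge_zero order_trans)

lemma bddI: "(\<And>\<nu>. \<nu> \<in> S \<Longrightarrow> cmod (f \<nu>) \<le> C) \<Longrightarrow> bdd f"
  by (auto simp: bdd_def)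

lemma diag_apply: "x \<in> carrier (ell2 S) \<Longrightarrow> diag f x = (\<lambda>\<nu>. f \<nu> * x \<nu>)"
  by (simp add: diag_def)

lemma diag_cong: "(\<And>\<nu>. \<nu> \<in> S \<Longrightarrow> f \<nu> = g \<nu>) \<Longrightarrow> diag f = diag g"
  unfolding diag_def by (intro restrict_ext ext) (auto simp: ell2_simps)

lemma diag_in [simp]:
  assumes "bdd f"
  shows "diag f \<in> carrier Op"
proof -
  obtain C where C: "\<And>\<nu>. \<nu> \<in> S \<Longrightarrow> cmod (f \<nu>) \<le> C" "0 \<le> C" using bddE[OF assms] by metis
  show ?thesis
    by (rule H.bounded_opsI[where K = C])
      (use diag_bound[OF C] in \<open>auto simp: diag_def ell2_simps(2-) ell2_add_closed ell2_smult_closed algebra_simps\<close>)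
qed

lemma nrm_diag_le:
  assumes "\<And>\<nu>. \<nu> \<in> S \<Longrightarrow> cmod (f \<nu>) \<le> C" "0 \<le> C"
  shows "nrm Op (diag f) \<le> C"
  by (rule H.nrm_bounded_ops_le) (use diag_bound[OF assms] assms(2) in \<open>auto simp: diag_apply\<close>)

lemma cmod_entry_le_nrm:
  assumes Z: "Z \<in> carrier Op" and \<nu>: "\<nu> \<in> S"
  shows "cmod (Z (basis_vec \<nu>) \<mu>) \<le> nrm Op Z"
proof -
  have e: "basis_vec \<nu> \<in> carrier (ell2 S)" using \<nu> by (rule basis_vec_in_ell2)
  have "cmod (Z (basis_vec \<nu>) \<mu>) \<le> hnorm (ell2 S) (Z (basis_vec \<nu>))"
    using H.bounded_opsD(2)[OF Z e] by (rule cmod_le_hnorm_ell2)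
  also have "\<dots> \<le> nrm Op Z" 
    using H.hnorm_le_nrm_bounded_ops[OF Z e] hnorm_basis_vec[OF \<nu>] by simp
  finally show ?thesis .
qed

lemma diag_basis_vec: "\<nu> \<in> S \<Longrightarrow> diag f (basis_vec \<nu>) \<nu> = f \<nu>"
  using basis_vec_in_ell2[of \<nu> S] by (simp add: diag_apply) (simp add: basis_vec_def)

lemma diag_inj: "diag f = diag g \<Longrightarrow> \<nu> \<in> S \<Longrightarrow> f \<nu> = g \<nu>"
  using diag_basis_vec by metis

lemma bdd_simps [simp]:
  "bdd (\<lambda>_. c)" "bdd f \<Longrightarrow> bdd g \<Longrightarrow> bdd (\<lambda>\<nu>. f \<nu> * g \<nu>)"
  "bdd f \<Longrightarrow> bdd g \<Longrightarrow> bdd (\<lambda>\<nu>. f \<nu> + g \<nu>)" "bdd f \<Longrightarrow> bdd (\<lambda>\<nu>. cnj (f \<nu>))"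
  "bdd (\<lambda>\<nu>. if P \<nu> then 1 else 0)" "bdd f \<Longrightarrow> bdd (\<lambda>\<nu>. - f \<nu>)"
  "bdd f \<Longrightarrow> bdd g \<Longrightarrow> bdd (\<lambda>\<nu>. f \<nu> - g \<nu>)"
proof -
  show "bdd (\<lambda>_. c)" by (rule bddI) auto
  show "bdd (\<lambda>\<nu>. if P \<nu> then 1 else 0)" by (rule bddI[where C = 1]) simp
  show "bdd (\<lambda>\<nu>. - f \<nu>)" if "bdd f" using that by (simp add: bdd_def)
  show "bdd (\<lambda>\<nu>. cnj (f \<nu>))" if "bdd f" using that by (simp add: bdd_def)
  assume "bdd f" "bdd g"
  then obtain C D where CD: "\<And>\<nu>. \<nu> \<in> S \<Longrightarrow> cmod (f \<nu>) \<le> C" "0 \<le> C" "\<And>\<nu>. \<nu> \<in> S \<Longrightarrow> cmod (g \<nu>) \<le> D"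
    by (metis bddE)
  show "bdd (\<lambda>\<nu>. f \<nu> * g \<nu>)"
    by (rule bddI[where C = "C * D"]) (use CD in \<open>auto simp: norm_mult intro!: mult_mono\<close>)
  show "bdd (\<lambda>\<nu>. f \<nu> + g \<nu>)"
    by (rule bddI[where C = "C + D"]) (use CD in \<open>auto intro!: norm_triangle_le add_mono\<close>)
  show "bdd (\<lambda>\<nu>. f \<nu> - g \<nu>)"
    by (rule bddI[where C = "C + D"]) (use CD in \<open>auto intro!: norm_triangle_le_diff add_mono\<close>)
qed

lemma diag_apply_in: "bdd f \<Longrightarrow> x \<in> carrier (ell2 S) \<Longrightarrow> (\<lambda>\<nu>. f \<nu> * x \<nu>) \<in> carrier (ell2 S)"
  using H.bounded_opsD(2)[OF diag_in, of f x] by (simp add: diag_apply)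

lemma diag_mult: "bdd f \<Longrightarrow> bdd g \<Longrightarrow> diag f \<cdot> diag g = diag (\<lambda>\<nu>. f \<nu> * g \<nu>)"
  by (rule op_eqI) (auto simp: H.bounded_ops_simps diag_apply diag_apply_in)

lemma diag_add: "bdd f \<Longrightarrow> bdd g \<Longrightarrow> diag f \<oplus>\<^bsub>Op\<^esub> diag g = diag (\<lambda>\<nu>. f \<nu> + g \<nu>)"
  by (rule op_eqI) (auto simp: H.bounded_ops_simps diag_apply ell2_simps(3) algebra_simps)

lemma diag_smult: "bdd f \<Longrightarrow> c \<odot>\<^bsub>Op\<^esub> diag f = diag (\<lambda>\<nu>. c * f \<nu>)"
  by (rule op_eqI) (auto simp: H.bounded_ops_simps diag_apply ell2_simps(4))

lemma diag_one: "diag (\<lambda>_. 1) = \<one>\<^bsub>Op\<^esub>"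
  by (rule op_eqI) (auto simp: H.bounded_ops_simps diag_apply)

lemma diag_zero: "diag (\<lambda>_. 0) = \<zero>\<^bsub>Op\<^esub>"
  by (rule op_eqI) (auto simp: H.bounded_ops_simps diag_apply ell2_simps(2))

lemma diag_diff: "bdd f \<Longrightarrow> bdd g \<Longrightarrow> diag f \<ominus>\<^bsub>Op\<^esub> diag g = diag (\<lambda>\<nu>. f \<nu> - g \<nu>)"
  by (simp add: F.diff_eq_smult diag_smult diag_add)

lemma diag_adj: "bdd f \<Longrightarrow> adj Op (diag f) = diag (\<lambda>\<nu>. cnj (f \<nu>))"
  by (rule H.adj_bounded_ops_eqI) (auto simp: diag_apply ell2_simps(5) mult_ac)

lemma diag_finsum:
  assumes "finite J" "\<And>i. i \<in> J \<Longrightarrow> bdd (f i)"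
  shows "(\<Oplus>\<^bsub>Op\<^esub>i\<in>J. diag (f i)) = diag (\<lambda>\<nu>. \<Sum>i\<in>J. f i \<nu>)" and "bdd (\<lambda>\<nu>. \<Sum>i\<in>J. f i \<nu>)"
  using assms by (induction J) (auto simp: diag_zero Pi_iff diag_add)

lemma diag_list_prod:
  assumes "\<And>i. i \<in> set is \<Longrightarrow> bdd (f i)"
  shows "list_prod Op (map (\<lambda>i. diag (f i)) is) = diag (\<lambda>\<nu>. \<Prod>i\<leftarrow>is. f i \<nu>)"
    and "bdd (\<lambda>\<nu>. \<Prod>i\<leftarrow>is. f i \<nu>)"
  using assms by (induction "is") (auto simp: list_prod_def diag_one diag_mult)

definition diagonals :: "(('i \<Rightarrow> complex) \<Rightarrow> 'i \<Rightarrow> complex) set" where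
  "diagonals = {diag f | f. bdd f}"

text \<open>An operator commuting with the coordinate projections maps each basis vector to a multiple of
  itself. As a commutant, the set of diagonal operators is a C*-subalgebra.\<close>

lemma diagonals_eq_commutant:
  "diagonals = {Z \<in> carrier Op. \<forall>m\<in>(\<lambda>\<nu>. diag (\<lambda>\<mu>. if \<mu> = \<nu> then 1 else 0)) ` S. m \<cdot> Z = Z \<cdot> m}"
  (is "_ = ?C")
proof
  show "diagonals \<subseteq> ?C"
    by (auto simp: diagonals_def diag_mult mult.commute)
  show "?C \<subseteq> diagonals"
  proof
    fix Z assume Z: "Z \<in> ?C"
    define f where "f \<nu> = Z (basis_vec \<nu>) \<nu>" for \<nu>
    have b: "bdd f" unfolding f_def using Z by (intro bddI[where C = "nrm Op Z"] cmod_entry_le_nrm) auto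
    have "Z = diag f"
    proof (rule op_eqI)
      fix x \<nu> assume x: "x \<in> carrier (ell2 S)" and \<nu>: "\<nu> \<in> S"
      let ?p = "diag (\<lambda>\<mu>. if \<mu> = \<nu> then 1 else 0)"
      have px: "?p x = x \<nu> \<odot>\<^bsub>ell2 S\<^esub> basis_vec \<nu>"
        using x by (auto simp: diag_apply ell2_simps(4) basis_vec_def)
      have "Z x \<nu> = (?p \<cdot> Z) x \<nu>"
        using x Z by (simp add: H.bounded_ops_simps diag_apply H.bounded_opsD(2))
      also have "\<dots> = (Z \<cdot> ?p) x \<nu>" using Z \<nu> by auto
      also have "\<dots> = Z (x \<nu> \<odot>\<^bsub>ell2 S\<^esub> basis_vec \<nu>) \<nu>"
        using x by (simp add: H.bounded_ops_simps px)
      also have "\<dots> = f \<nu> * x \<nu>"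
        using H.bounded_opsD(4)[of Z "basis_vec \<nu>" "x \<nu>"] Z basis_vec_in_ell2[OF \<nu>]
        by (auto simp: f_def ell2_simps(4) mult.commute)
      finally show "Z x \<nu> = diag f x \<nu>" using x by (simp add: diag_apply)
    qed (use Z b in auto)
    then show "Z \<in> diagonals" using b by (auto simp: diagonals_def)
  qed
qed

lemma cstar_subalgebra_diagonals: "cstar_subalgebra Op diagonals"
  unfolding diagonals_eq_commutant
  by (rule F.cstar_subalgebra_commutant) (auto simp: diag_adj if_distrib cong: if_cong)

text \<open>The function \<open>sqrt (1 - x\<^sup>2)\<close> is a uniform limit of polynomials on \<open>[-1, 1]\<close>, so it operates
  on the diagonal algebras.\<close>

lemma diagonal_sqrt:
  assumes V: "cstar_subalgebra Op V" "V \<subseteq> diagonals" and one: "\<one>\<^bsub>Op\<^esub> \<in> V"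
    and h: "h \<in> V" "adj Op h = h" "nrm Op h \<le> 1"
  shows "\<exists>k\<in>V. adj Op k = k \<and> h \<cdot> k = k \<cdot> h \<and>
    h \<cdot> h \<oplus>\<^bsub>Op\<^esub> k \<cdot> k = \<one>\<^bsub>Op\<^esub>"
proof -
  obtain f where f: "h = diag f" "bdd f" using h V by (auto simp: diagonals_def)
  define r where "r \<nu> = Re (f \<nu>)" for \<nu>
  have fr: "f \<nu> = of_real (r \<nu>)" if "\<nu> \<in> S" for \<nu>
    using h(2) f that diag_inj[of "\<lambda>\<nu>. cnj (f \<nu>)" f \<nu>]
    by (simp add: diag_adj r_def complex_eq_iff)
  have hr: "h = diag (\<lambda>\<nu>. of_real (r \<nu>))" unfolding f using fr by (rule diag_cong)
  have "cmod (f \<nu>) \<le> 1" if "\<nu> \<in> S" for \<nu>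
    using cmod_entry_le_nrm[of h \<nu> \<nu>] that h f diag_basis_vec[of \<nu> f] by simp
  then have r: "\<bar>r \<nu>\<bar> \<le> 1" if "\<nu> \<in> S" for \<nu> using fr[OF that] that by fastforce
  then have br: "bdd (\<lambda>\<nu>. of_real (r \<nu>))" by (intro bddI[where C = 1]) auto
  have Vadd: "x \<oplus>\<^bsub>Op\<^esub> y \<in> V" and Vmult: "x \<cdot> y \<in> V" and Vsmult: "c \<odot>\<^bsub>Op\<^esub> x \<in> V"
    if "x \<in> V" "y \<in> V" for x y c
    using V(1) that unfolding F.cstar_subalgebra_iff by blast+
  have poly: "bdd (\<lambda>\<nu>. of_real (g (r \<nu>))) \<and> diag (\<lambda>\<nu>. of_real (g (r \<nu>))) \<in> V"
    if "real_polynomial_function g" for g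
    using that
  proof (induction g)
    case (linear g)
    have "g x = g 1 * x" for x
      using linear_simps(5)[OF linear, of x 1] by (simp add: mult.commute)
    then have "(\<lambda>\<nu>. complex_of_real (g (r \<nu>))) = (\<lambda>\<nu>. of_real (g 1) * of_real (r \<nu>))"
      by (metis of_real_mult)
    moreover have "diag (\<lambda>\<nu>. of_real (g 1) * of_real (r \<nu>)) \<in> V"
      using Vsmult[OF h(1) h(1), of "of_real (g 1)"] br by (simp add: hr diag_smult)
    ultimately show ?case using br by simp
  next
    case (const c)
    show ?case using Vsmult[OF one one, of "of_real c"] by (simp add: diag_smult flip: diag_one)
  next
    case (add g g')
    then show ?case
      using Vadd[of "diag (\<lambda>\<nu>. of_real (g (r \<nu>)))" "diag (\<lambda>\<nu>. of_real (g' (r \<nu>)))"]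
      by (simp add: diag_add)
  next
    case (mult g g')
    then show ?case
      using Vmult[of "diag (\<lambda>\<nu>. of_real (g (r \<nu>)))" "diag (\<lambda>\<nu>. of_real (g' (r \<nu>)))"]
      by (simp add: diag_mult)
  qed
  define q where "q x = sqrt (1 - x\<^sup>2)" for x :: real
  define k where "k = diag (\<lambda>\<nu>. of_real (q (r \<nu>)))"
  have q1: "\<bar>q (r \<nu>)\<bar> \<le> 1" if "\<nu> \<in> S" for \<nu>
    using r[OF that] by (simp add: q_def abs_le_square_iff abs_square_le_1 real_sqrt_le_1_iff)
  have bq: "bdd (\<lambda>\<nu>. of_real (q (r \<nu>)))" using q1 by (intro bddI[where C = 1]) auto
  have "k \<in> V"
  proof -
    have "\<exists>y\<in>V. nrm Op (k \<ominus>\<^bsub>Op\<^esub> y) < e" if e: "e > 0" for e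
    proof -
      have "continuous_on {-1..1} q" unfolding q_def by (intro continuous_intros)
      then obtain g where g: "real_polynomial_function g" "\<And>x. x \<in> {-1..1} \<Longrightarrow> \<bar>q x - g x\<bar> < e / 2"
        using Stone_Weierstrass_real_polynomial_function[of "{-1..1}" q "e / 2"] e compact_Icc by auto
      have diff: "k \<ominus>\<^bsub>Op\<^esub> diag (\<lambda>\<nu>. of_real (g (r \<nu>))) =
          diag (\<lambda>\<nu>. of_real (q (r \<nu>)) - of_real (g (r \<nu>)))"
        using poly[OF g(1)] bq by (simp add: k_def diag_diff)
      have "nrm Op (k \<ominus>\<^bsub>Op\<^esub> diag (\<lambda>\<nu>. of_real (g (r \<nu>)))) \<le> e / 2"
        unfolding diff
      proof (rule nrm_diag_le)
        fix \<nu> assume "\<nu> \<in> S"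
        then have "\<bar>q (r \<nu>) - g (r \<nu>)\<bar> < e / 2" using r[of \<nu>] by (intro g) auto
        then show "cmod (complex_of_real (q (r \<nu>)) - complex_of_real (g (r \<nu>))) \<le> e / 2"
          by (metis less_imp_le norm_of_real of_real_diff)
      qed (use e in auto)
      then show ?thesis using poly[OF g(1)] e by (intro bexI) auto
    qed
    moreover have "k \<in> carrier Op" using bq by (simp add: k_def)
    ultimately show ?thesis using V(1) unfolding F.cstar_subalgebra_iff F.closedin_iff by blast
  qed
  moreover have "adj Op k = k" using bq by (simp add: k_def diag_adj)
  moreover have "h \<cdot> k = k \<cdot> h"
    using bq br by (simp add: k_def hr diag_mult mult.commute)
  moreover have "h \<cdot> h \<oplus>\<^bsub>Op\<^esub> k \<cdot> k = \<one>\<^bsub>Op\<^esub>"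
  proof -
    have "h \<cdot> h \<oplus>\<^bsub>Op\<^esub> k \<cdot> k =
        diag (\<lambda>\<nu>. of_real (r \<nu>) * of_real (r \<nu>) + of_real (q (r \<nu>)) * of_real (q (r \<nu>)))"
      using bq br by (simp add: k_def hr diag_mult diag_add)
    also have "\<dots> = diag (\<lambda>_. 1)"
    proof (rule diag_cong)
      fix \<nu> assume "\<nu> \<in> S"
      then have "(r \<nu>)\<^sup>2 \<le> 1" using r[of \<nu>] by (simp add: abs_square_le_1)
      then have "r \<nu> * r \<nu> + q (r \<nu>) * q (r \<nu>) = 1"
        by (simp add: q_def flip: power2_eq_square)
      then show "complex_of_real (r \<nu>) * of_real (r \<nu>) + of_real (q (r \<nu>)) * of_real (q (r \<nu>)) = 1"
        by (metis of_real_1 of_real_add of_real_mult)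
    qed
    finally show ?thesis by (simp add: diag_one)
  qed
  ultimately show ?thesis by blast
qed

end

section \<open>Shift operators of a factor closed language\<close>

text \<open>What the operators depend on: factors of allowed words are allowed and, since the ideal is
  generated in degree at least two, so are the empty word and the letters.\<close>

locale factor_closed_language =
  fixes d :: nat and L :: "nat list set"
  assumes L_words: "L \<subseteq> words d"
    and Nil_in: "[] \<in> L"
    and single_in: "i \<in> {1..d} \<Longrightarrow> [i] \<in> L"
    and prefix_in: "u @ v \<in> L \<Longrightarrow> u \<in> L"
    and suffix_in: "u @ v \<in> L \<Longrightarrow> v \<in> L"
    and d_pos: "1 \<le> d"
begin

sublocale ell2_operators L .

abbreviation shift_op_times (infixl "\<cdot>" 70) where
  "x \<cdot> y \<equiv> x \<otimes>\<^bsub>Op\<^esub> y"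

abbreviation "T \<equiv> shift L"

lemma tail_in: "i # \<nu> \<in> L \<Longrightarrow> \<nu> \<in> L"
  using suffix_in[of "[i]" \<nu>] by simp

lemma shift_apply:
  "x \<in> carrier (ell2 L) \<Longrightarrow> T i x (j # \<nu>) = (if j = i \<and> j # \<nu> \<in> L then x \<nu> else 0)"
  "x \<in> carrier (ell2 L) \<Longrightarrow> T i x [] = 0"
  by (auto simp: shift_def)

lemma shift_in [simp]: "T i \<in> carrier Op"
proof -
  have *: "T i x \<in> carrier (ell2 L) \<and> hnorm (ell2 L) (T i x) \<le> 1 * hnorm (ell2 L) x"
    if x: "x \<in> carrier (ell2 L)" for x
  proof -
    have z: "\<mu> \<notin> L \<Longrightarrow> T i x \<mu> = 0" for \<mu>
      using x by (cases \<mu>) (auto simp: shift_apply)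
    have fin: "(\<Sum>\<mu>\<in>J. (cmod (T i x \<mu>))\<^sup>2) \<le> (1 * hnorm (ell2 L) x)\<^sup>2" if J: "finite J" "J \<subseteq> L" for J
    proof -
      let ?J = "{\<nu>. i # \<nu> \<in> J}"
      have fJ: "finite ?J" using finite_vimageI[OF J(1), of "(#) i"] by (simp add: vimage_def)
      have "(\<Sum>\<mu>\<in>J. (cmod (T i x \<mu>))\<^sup>2) = (\<Sum>\<mu>\<in>(#) i ` ?J. (cmod (T i x \<mu>))\<^sup>2)"
      proof (rule sum.mono_neutral_right[OF J(1)])
        show "\<forall>\<mu>\<in>J - (#) i ` ?J. (cmod (T i x \<mu>))\<^sup>2 = 0"
        proof
          fix \<mu> assume "\<mu> \<in> J - (#) i ` ?J"
          then show "(cmod (T i x \<mu>))\<^sup>2 = 0"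
            using x by (cases \<mu>) (auto simp: shift_apply)
        qed
      qed auto
      also have "\<dots> = (\<Sum>\<nu>\<in>?J. (cmod (x \<nu>))\<^sup>2)"
        using x J by (subst sum.reindex) (auto simp: shift_apply intro!: sum.cong)
      also have "\<dots> \<le> (hnorm (ell2 L) x)\<^sup>2"
        using x fJ J by (intro sum_sq_le_hnorm) (auto intro: tail_in)
      finally show ?thesis by simp
    qed
    have p: "0 \<le> 1 * hnorm (ell2 L) x" using x by simp
    show ?thesis using ell2_of_finite_sums[OF z p fin] by blast
  qed
  show ?thesis
  proof (rule H.bounded_opsI[where K = 1])
    show "T i \<in> carrier (ell2 L) \<rightarrow>\<^sub>E carrier (ell2 L)" using * by (auto simp: shift_def)
    fix x y c assume x: "x \<in> carrier (ell2 L)"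
    show "hnorm (ell2 L) (T i x) \<le> 1 * hnorm (ell2 L) x" using * x by blast
    show "T i (c \<odot>\<^bsub>ell2 L\<^esub> x) = c \<odot>\<^bsub>ell2 L\<^esub> T i x"
      using x by (auto simp: shift_def ell2_simps(4) ell2_smult_closed split: list.split)
    assume y: "y \<in> carrier (ell2 L)"
    show "T i (x \<oplus>\<^bsub>ell2 L\<^esub> y) = T i x \<oplus>\<^bsub>ell2 L\<^esub> T i y"
      using x y by (auto simp: shift_def ell2_simps(3) ell2_add_closed split: list.split)
  qed
qed

lemma adj_shift_in [simp]: "adj Op (T i) \<in> carrier Op"
  by simp

lemma adj_shift_apply:
  assumes x: "x \<in> carrier (ell2 L)" and \<nu>: "\<nu> \<in> L"
  shows "adj Op (T i) x \<nu> = (if i # \<nu> \<in> L then x (i # \<nu>) else 0)"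
proof -
  \<comment> \<open>The entries of \<open>T\<^sub>i\<^sup>* x\<close> are \<open>\<langle>e\<^sub>\<nu>, T\<^sub>i\<^sup>* x\<rangle> = \<langle>T\<^sub>i e\<^sub>\<nu>, x\<rangle>\<close>.\<close>
  have "adj Op (T i) x \<nu> = cinner (ell2 L) (basis_vec \<nu>) (adj Op (T i) x)"
    using \<nu> by (simp add: cinner_basis_vec)
  also have "\<dots> = cinner (ell2 L) (T i (basis_vec \<nu>)) x"
    using H.adj_bounded_ops(2)[OF shift_in, of "basis_vec \<nu>" x i] x basis_vec_in_ell2[OF \<nu>] by simp
  also have "\<dots> = (if i # \<nu> \<in> L then x (i # \<nu>) else 0)"
    using cinner_basis_vec[of "i # \<nu>" L x] by (simp add: shift_basis_vec[OF \<nu>]) (simp add: ell2_simps)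
  finally show ?thesis .
qed

lemmas op_apply = H.bounded_ops_simps H.bounded_opsD(2) shift_apply adj_shift_apply diag_apply diag_apply_in

text \<open>The diagonal of \<open>T\<^sub>i\<^sup>* (diag f) T\<^sub>i\<close>.\<close>

definition compress :: "nat \<Rightarrow> (nat list \<Rightarrow> complex) \<Rightarrow> nat list \<Rightarrow> complex" where
  "compress i f \<nu> = (if i # \<nu> \<in> L then f (i # \<nu>) else 0)"

lemma bdd_compress [simp]: "bdd f \<Longrightarrow> bdd (compress i f)"
proof -
  assume "bdd f"
  then obtain C where "\<And>\<nu>. \<nu> \<in> L \<Longrightarrow> cmod (f \<nu>) \<le> C" "0 \<le> C" using bddE by metis
  then show ?thesis by (intro bddI[where C = C]) (auto simp: compress_def)
qed

lemma adj_shift_diag_shift: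
  assumes "bdd f"
  shows "adj Op (T j) \<cdot> diag f \<cdot> T i = (if i = j then diag (compress i f) else \<zero>\<^bsub>Op\<^esub>)"
  using assms by (intro op_eqI) (auto simp: op_apply ell2_simps(2) compress_def)

lemma diag_shift:
  assumes "bdd f"
  shows "diag f \<cdot> T i = T i \<cdot> diag (compress i f)"
proof (rule op_eqI)
  fix x \<mu> assume x: "x \<in> carrier (ell2 L)" and \<mu>: "\<mu> \<in> L"
  show "(diag f \<cdot> T i) x \<mu> = (T i \<cdot> diag (compress i f)) x \<mu>"
    using assms x \<mu> diag_apply_in[of "compress i f" x] by (cases \<mu>) (auto simp: op_apply compress_def)
qed (use assms in auto)

lemma adj_shift_shift:
  "adj Op (T j) \<cdot> T i = (if i = j then diag (\<lambda>\<nu>. if i # \<nu> \<in> L then 1 else 0) else \<zero>\<^bsub>Op\<^esub>)"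
  using adj_shift_diag_shift[of "\<lambda>_. 1" j i] by (simp add: diag_one compress_def[abs_def])

lemma shift_adj_shift:
  "T i \<cdot> adj Op (T i) = diag (\<lambda>\<mu>. if \<mu> \<noteq> [] \<and> hd \<mu> = i then 1 else 0)"
proof (rule op_eqI)
  fix x \<mu> assume x: "x \<in> carrier (ell2 L)" and \<mu>: "\<mu> \<in> L"
  have a: "adj Op (T i) x \<in> carrier (ell2 L)" using x by (simp add: H.bounded_opsD(2))
  show "(T i \<cdot> adj Op (T i)) x \<mu> = diag (\<lambda>\<mu>. if \<mu> \<noteq> [] \<and> hd \<mu> = i then 1 else 0) x \<mu>"
    using x \<mu> a tail_in by (cases \<mu>) (auto simp: op_apply)
qed auto

lemma shift_partial_isometry: "T i \<cdot> (adj Op (T i) \<cdot> T i) = T i"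
proof (rule op_eqI)
  fix x \<mu> assume x: "x \<in> carrier (ell2 L)" and \<mu>: "\<mu> \<in> L"
  show "(T i \<cdot> (adj Op (T i) \<cdot> T i)) x \<mu> = T i x \<mu>"
    using x \<mu> tail_in by (cases \<mu>) (auto simp: op_apply H.bounded_opsD(2))
qed auto

text \<open>The projection onto \<open>e\<^bsub>[]\<^esub>\<close>.\<close>

definition vacuum :: "(nat list \<Rightarrow> complex) \<Rightarrow> nat list \<Rightarrow> complex" where
  "vacuum = diag (\<lambda>\<nu>. if \<nu> = [] then 1 else 0)"

lemma vacuum_in [simp]: "vacuum \<in> carrier Op"
  by (simp add: vacuum_def)

lemma sum_shift_adj_shift:
  "(\<Oplus>\<^bsub>Op\<^esub>i\<in>{1..d}. T i \<cdot> adj Op (T i)) = \<one>\<^bsub>Op\<^esub> \<ominus>\<^bsub>Op\<^esub> vacuum"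
proof -
  have "(\<Sum>i\<in>{1..d}. if \<mu> \<noteq> [] \<and> hd \<mu> = i then 1 else 0) = (1::complex) - (if \<mu> = [] then 1 else 0)"
    if "\<mu> \<in> L" for \<mu>
  proof (cases "\<mu> = []")
    case False
    then have "hd \<mu> \<in> {1..d}" using that L_words by (cases \<mu>) (auto simp: words_def)
    then show ?thesis using False by simp
  qed simp
  then have "diag (\<lambda>\<mu>. \<Sum>i\<in>{1..d}. if \<mu> \<noteq> [] \<and> hd \<mu> = i then 1 else 0) =
      diag (\<lambda>\<mu>. 1 - (if \<mu> = [] then 1 else 0))"
    by (rule diag_cong)
  then show ?thesis
    by (simp add: shift_adj_shift diag_finsum vacuum_def diag_diff flip: diag_one)
qed

lemma vacuum_shift: "vacuum \<cdot> T i = \<zero>\<^bsub>Op\<^esub>"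
proof (rule op_eqI)
  fix x \<mu> assume x: "x \<in> carrier (ell2 L)" and \<mu>: "\<mu> \<in> L"
  show "(vacuum \<cdot> T i) x \<mu> = \<zero>\<^bsub>Op\<^esub> x \<mu>"
    using x \<mu> by (cases \<mu>) (auto simp: op_apply vacuum_def ell2_simps(2))
qed auto

text \<open>Appending a letter to \<open>w\<close> compresses \<open>T\<^sub>w\<^sup>* T\<^sub>w\<close> by \<open>T\<^sub>i\<close>, hence the induction from the right.\<close>

lemma source_proj_shift: "source_proj Op T w = diag (\<lambda>\<nu>. if w @ \<nu> \<in> L then 1 else 0)"
proof (induction w rule: rev_induct)
  case Nil
  have "diag (\<lambda>\<nu>. if [] @ \<nu> \<in> L then 1 else 0) = diag (\<lambda>_. 1)" by (rule diag_cong) simp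
  then show ?case by (simp add: diag_one)
next
  case (snoc i w)
  have "source_proj Op T (w @ [i]) = diag (compress i (\<lambda>\<nu>. if w @ \<nu> \<in> L then 1 else 0))"
    by (subst F.source_proj_snoc) (simp_all add: snoc.IH adj_shift_diag_shift)
  also have "\<dots> = diag (\<lambda>\<nu>. if (w @ [i]) @ \<nu> \<in> L then 1 else 0)"
    by (rule diag_cong) (auto simp: compress_def dest: suffix_in)
  finally show ?case .
qed

abbreviation "P \<equiv> source_proj Op T"

lemma source_proj_shift_eq_zero: "w \<notin> L \<Longrightarrow> P w = \<zero>\<^bsub>Op\<^esub>"
  unfolding source_proj_shift diag_zero[symmetric]
  by (rule diag_cong) (auto dest: prefix_in)

abbreviation "A \<equiv> carrier (coeff_algebra L)"

lemma A_eq: "A = generated_cstar Op (P ` L)"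
  by (simp add: coeff_algebra_def)

lemma P_in_Op: "P w \<in> carrier Op"
  by (simp add: F.source_proj_closed)

lemma subalg_A: "cstar_subalgebra Op A"
  unfolding A_eq by (rule F.cstar_subalgebra_generated) (auto simp: P_in_Op)

lemma closed_A: "F.closed_set A"
  using subalg_A unfolding F.cstar_subalgebra_iff by blast

lemma A_least: "cstar_subalgebra Op V \<Longrightarrow> (\<And>w. w \<in> L \<Longrightarrow> P w \<in> V) \<Longrightarrow> A \<subseteq> V"
  unfolding A_eq by (rule F.generated_cstar_least) auto

lemma A_in_Op [simp]: "a \<in> A \<Longrightarrow> a \<in> carrier Op"
  using subalg_A unfolding F.cstar_subalgebra_iff by blast

lemma A_closed [simp]:
  "\<zero>\<^bsub>Op\<^esub> \<in> A" 
  "x \<in> A \<Longrightarrow> y \<in> A \<Longrightarrow> x \<oplus>\<^bsub>Op\<^esub> y \<in> A"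
  "x \<in> A \<Longrightarrow> y \<in> A \<Longrightarrow> x \<cdot> y \<in> A"
  "x \<in> A \<Longrightarrow> y \<in> A \<Longrightarrow> x \<ominus>\<^bsub>Op\<^esub> y \<in> A"
  "x \<in> A \<Longrightarrow> c \<odot>\<^bsub>Op\<^esub> x \<in> A"
  "x \<in> A \<Longrightarrow> adj Op x \<in> A"
  using subalg_A F.cstar_subalgebra_diff[OF subalg_A] unfolding F.cstar_subalgebra_iff by blast+

lemma P_in_A [simp]: "P w \<in> A"
proof (cases "w \<in> L")
  case True
  then show ?thesis using subsetD[OF F.generated_cstar_incl[of "P ` L"]] by (simp add: A_eq)
qed (simp add: source_proj_shift_eq_zero)

lemma one_in_A [simp]: "\<one>\<^bsub>Op\<^esub> \<in> A"
  using P_in_A[of "[]"] by simp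

lemma A_diagonal: "A \<subseteq> diagonals"
  by (rule A_least[OF cstar_subalgebra_diagonals]) (auto simp: diagonals_def source_proj_shift)

lemma A_diagE:
  assumes "a \<in> A"
  obtains f where "bdd f" "a = diag f"
  using assms A_diagonal by (auto simp: diagonals_def)

lemma A_commute: "a \<in> A \<Longrightarrow> b \<in> A \<Longrightarrow> a \<cdot> b = b \<cdot> a"
  by (elim A_diagE) (simp add: diag_mult mult.commute)

text \<open>Compressing by \<open>T\<^sub>i\<close> is multiplicative on the diagonal operators, and maps \<open>P\<^sub>w\<close> to \<open>P\<^sub>w\<^sub>i\<close>.\<close>

abbreviation conj_shift :: "nat \<Rightarrow> ((nat list \<Rightarrow> complex) \<Rightarrow> nat list \<Rightarrow> complex) \<Rightarrow> (nat list \<Rightarrow> complex) \<Rightarrow> nat list \<Rightarrow> complex" where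
  "conj_shift i a \<equiv> adj Op (T i) \<cdot> a \<cdot> T i"

lemma conj_shift_P: "conj_shift i (P w) = P (w @ [i])"
  by (subst F.source_proj_snoc) auto

lemma A_shift:
  assumes "a \<in> A"
  shows "a \<cdot> T i = T i \<cdot> conj_shift i a"
  using assms by (elim A_diagE) (simp add: diag_shift adj_shift_diag_shift)

lemma adj_shift_A_shift:
  assumes "a \<in> A" "i \<noteq> j"
  shows "adj Op (T j) \<cdot> a \<cdot> T i = \<zero>\<^bsub>Op\<^esub>"
  using assms by (elim A_diagE) (simp add: adj_shift_diag_shift)

lemma conj_shift_mult:
  assumes "a \<in> A" "b \<in> A"
  shows "conj_shift i (a \<cdot> b) = conj_shift i a \<cdot> conj_shift i b"
proof -
  have "conj_shift i (a \<cdot> b) = adj Op (T i) \<cdot> a \<cdot> (b \<cdot> T i)"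
    using assms by (simp add: F.m_assoc)
  also have "\<dots> = adj Op (T i) \<cdot> a \<cdot> (T i \<cdot> conj_shift i b)"
    using A_shift[OF assms(2)] by simp
  also have "\<dots> = conj_shift i a \<cdot> conj_shift i b"
    using assms by (simp add: F.m_assoc)
  finally show ?thesis .
qed

lemma conj_shift_adj: "a \<in> carrier Op \<Longrightarrow> conj_shift i (adj Op a) = adj Op (conj_shift i a)"
  by (simp add: F.adj_mult F.m_assoc)

lemma conj_shift_add:
  "a \<in> carrier Op \<Longrightarrow> b \<in> carrier Op \<Longrightarrow> conj_shift i (a \<oplus>\<^bsub>Op\<^esub> b) = conj_shift i a \<oplus>\<^bsub>Op\<^esub> conj_shift i b"
  by (simp add: F.l_distr F.r_distr)

lemma conj_shift_smult:
  "a \<in> carrier Op \<Longrightarrow> conj_shift i (c \<odot>\<^bsub>Op\<^esub> a) = c \<odot>\<^bsub>Op\<^esub> conj_shift i a"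
  by (simp add: F.smult_mult_left F.smult_mult_right)

lemma conj_shift_diff:
  "a \<in> carrier Op \<Longrightarrow> b \<in> carrier Op \<Longrightarrow> conj_shift i (a \<ominus>\<^bsub>Op\<^esub> b) = conj_shift i a \<ominus>\<^bsub>Op\<^esub> conj_shift i b"
  by (simp add: F.mult_diff_left F.mult_diff_right)

lemma nrm_conj_shift_le: 
  assumes "a \<in> carrier Op"
  shows "nrm Op (conj_shift i a) \<le> nrm Op (T i) * nrm Op a * nrm Op (T i)"
  using assms F.nrm_adj[of "T i"] by (intro F.nrm_mult_le) auto

end

context factor_closed_language
begin

section \<open>Killing tuples\<close>

text \<open>Each \<open>P\<^bsub>\<mu>\<^sub>i\<^esub>\<close> fixes \<open>e\<^bsub>[]\<^esub>\<close>, as \<open>\<mu>\<^sub>i\<close> is allowed; a nonempty word with first letter \<open>i\<close> is killed by the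
  factor with index \<open>i\<close>.\<close>

lemma killing_tuple_prod:
  assumes "killing_tuple d L \<mu>"
  shows "list_prod Op (map (\<lambda>i. P (\<mu> i)) [1..<Suc d]) = vacuum"
proof -
  let ?f = "\<lambda>i \<nu>. (if \<mu> i @ \<nu> \<in> L then 1 else 0 :: complex)"
  have "(\<Prod>i\<leftarrow>[1..<Suc d]. ?f i \<nu>) = (if \<nu> = [] then 1 else 0)" if \<nu>: "\<nu> \<in> L" for \<nu>
  proof (cases \<nu>)
    case Nil
    have "(\<Prod>i\<leftarrow>[1..<Suc d]. ?f i \<nu>) = (\<Prod>i\<leftarrow>[1..<Suc d]. 1)"
      using assms Nil by (intro arg_cong[where f = prod_list] map_cong) (auto simp: killing_tuple_def)
    moreover have "(\<Prod>i\<leftarrow>is. 1) = (1::complex)" for "is" :: "nat list" by (induction "is") auto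
    ultimately show ?thesis using Nil by (simp del: upt_Suc)
  next
    case (Cons i \<nu>')
    have i: "i \<in> {1..d}" using \<nu> Cons L_words by (auto simp: words_def)
    have "\<mu> i @ \<nu> \<notin> L"
      using assms i prefix_in[of "\<mu> i @ [i]" \<nu>'] Cons by (auto simp: killing_tuple_def)
    then have "\<exists>i\<in>set [1..<Suc d]. ?f i \<nu> = 0" using i by (intro bexI[of _ i]) auto
    then show ?thesis using Cons by (auto simp: prod_list_zero_iff)
  qed
  then show ?thesis
    unfolding source_proj_shift vacuum_def by (subst diag_list_prod) (auto intro!: diag_cong simp del: upt_Suc)
qed

lemma vacuum_in_A:
  assumes "killing_tuple d L \<mu>"
  shows "vacuum \<in> A"
proof -
  have "list_prod Op (map (\<lambda>i. P (\<mu> i)) [1..<Suc d]) \<in> A"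
    by (rule F.list_prod_in) (use d_pos in auto)
  then show ?thesis using killing_tuple_prod[OF assms] by simp
qed

text \<open>Without a killing tuple some letter \<open>i\<close> may follow every word of the language. Then every
  \<open>P\<^sub>w\<close> takes the same value at \<open>[]\<close> and at \<open>[i]\<close>, which is to say that it commutes with the rank
  one operator from \<open>e\<^bsub>[]\<^esub>\<close> to \<open>e\<^bsub>[i]\<^esub>\<close>; hence so does every element of \<open>A\<close>.\<close>

lemma A_no_killing:
  assumes "\<nexists>\<mu>. killing_tuple d L \<mu>"
  shows "\<exists>i\<in>{1..d}. \<forall>f. bdd f \<longrightarrow> diag f \<in> A \<longrightarrow> f [] = f [i]"
proof -
  have "\<exists>i\<in>{1..d}. \<forall>w\<in>L. w @ [i] \<in> L"
  proof (rule ccontr)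
    assume "\<not> ?thesis"
    then obtain \<mu> where "\<And>i. i \<in> {1..d} \<Longrightarrow> \<mu> i \<in> L \<and> \<mu> i @ [i] \<notin> L" by metis
    then have "killing_tuple d L \<mu>" by (simp add: killing_tuple_def)
    then show False using assms by blast
  qed
  then obtain i where i: "i \<in> {1..d}" "\<And>w. w \<in> L \<Longrightarrow> w @ [i] \<in> L" by blast
  define u where "u = T i \<cdot> vacuum"
  have u: "u \<in> carrier Op" by (simp add: u_def)
  let ?C = "{a \<in> carrier Op. \<forall>m\<in>{u, adj Op u}. m \<cdot> a = a \<cdot> m}"
  have "P w \<in> ?C" if w: "w \<in> L" for w
  proof -
    have [simp]: "P w \<in> carrier Op" by (rule P_in_Op)
    have Pu: "P w \<cdot> u = u \<cdot> P w"
    proof -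
      let ?p = "\<lambda>\<nu>. if w @ \<nu> \<in> L then 1 else 0"
      let ?v = "\<lambda>\<nu>. if \<nu> = [] then 1 else 0"
      have pv: "diag (\<lambda>\<nu>. compress i ?p \<nu> * ?v \<nu>) = diag (\<lambda>\<nu>. ?v \<nu> * ?p \<nu>)"
        by (rule diag_cong) (use i(2)[OF w] w single_in[OF i(1)] in \<open>simp add: compress_def\<close>)
      have "P w \<cdot> u = (diag ?p \<cdot> T i) \<cdot> vacuum"
        by (simp add: u_def F.m_assoc source_proj_shift)
      also have "\<dots> = T i \<cdot> (diag (compress i ?p) \<cdot> diag ?v)"
        by (simp add: diag_shift F.m_assoc vacuum_def)
      also have "diag (compress i ?p) \<cdot> diag ?v = diag ?v \<cdot> diag ?p"
        using pv by (simp add: diag_mult)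
      finally show ?thesis by (simp add: u_def F.m_assoc source_proj_shift vacuum_def)
    qed
    have "adj Op u \<cdot> P w = adj Op (P w \<cdot> u)" using u by (simp add: F.adj_mult F.source_proj_adj)
    also have "\<dots> = adj Op (u \<cdot> P w)" by (simp add: Pu)
    also have "\<dots> = P w \<cdot> adj Op u" using u by (simp add: F.adj_mult F.source_proj_adj)
    finally show ?thesis using Pu by auto
  qed
  moreover have "cstar_subalgebra Op ?C"
    by (rule F.cstar_subalgebra_commutant) (use u in auto)
  ultimately have sub: "A \<subseteq> ?C" by (intro A_least) auto
  have "f [] = f [i]" if f: "bdd f" "diag f \<in> A" for f
  proof -
    let ?e = "basis_vec [] :: nat list \<Rightarrow> complex"
    have e: "?e \<in> carrier (ell2 L)" using Nil_in by (rule basis_vec_in_ell2)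
    have v: "vacuum x = (\<lambda>\<nu>. (if \<nu> = [] then 1 else 0) * x \<nu>)" if "x \<in> carrier (ell2 L)" for x
      using that by (simp add: vacuum_def diag_apply)
    have vc: "(\<lambda>\<nu>. (if \<nu> = [] then 1 else 0) * x \<nu>) \<in> carrier (ell2 L)" if "x \<in> carrier (ell2 L)" for x
      using that diag_apply_in[OF bdd_simps(5)] by fast
    have "(u \<cdot> diag f) ?e [i] = (diag f \<cdot> u) ?e [i]" using sub f by auto
    moreover have "(diag f \<cdot> u) ?e [i] = f [i]"
      using e f u single_in[OF i(1)] H.bounded_opsD(2)[OF shift_in vc[OF e]]
      by (simp add: H.bounded_ops_simps u_def diag_apply v vc shift_apply) (simp add: basis_vec_def)
    moreover have "(u \<cdot> diag f) ?e [i] = f []"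
      using e f u single_in[OF i(1)] diag_apply_in[OF f(1) e]
      by (simp add: H.bounded_ops_simps u_def diag_apply v vc shift_apply) (simp add: basis_vec_def)
    ultimately show ?thesis by simp
  qed
  then show ?thesis using i by blast
qed

text \<open>The support projection of the ideal \<open>J\<^sub>E\<close>: the kernel of the left action is spanned by
  \<open>vacuum\<close> if there is a killing tuple, and is zero otherwise.\<close>

definition support_proj :: "(nat list \<Rightarrow> complex) \<Rightarrow> nat list \<Rightarrow> complex" where
  "support_proj = (if \<exists>\<mu>. killing_tuple d L \<mu> then \<one>\<^bsub>Op\<^esub> \<ominus>\<^bsub>Op\<^esub> vacuum else \<one>\<^bsub>Op\<^esub>)"

lemma support_proj_in_A [simp]: "support_proj \<in> A"
  using vacuum_in_A by (auto simp: support_proj_def)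

lemma support_proj_shift: "support_proj \<cdot> T i = T i"
  by (simp add: support_proj_def F.mult_diff_left vacuum_shift)

text \<open>An element that kills every \<open>T\<^sub>i\<close> is concentrated at \<open>[]\<close>. Without a killing tuple, its value there
  equals that at some \<open>[i]\<close>, so it vanishes.\<close>

lemma mult_support_proj_eq_zero:
  assumes b: "b \<in> A" and z: "\<And>i. i \<in> {1..d} \<Longrightarrow> b \<cdot> T i = \<zero>\<^bsub>Op\<^esub>"
  shows "b \<cdot> support_proj = \<zero>\<^bsub>Op\<^esub>"
proof -
  have "b \<cdot> (\<one>\<^bsub>Op\<^esub> \<ominus>\<^bsub>Op\<^esub> vacuum) = (\<Oplus>\<^bsub>Op\<^esub>i\<in>{1..d}. b \<cdot> (T i \<cdot> adj Op (T i)))"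
    using b unfolding sum_shift_adj_shift[symmetric] by (subst F.finsum_rdistr) auto
  also have "\<dots> = (\<Oplus>\<^bsub>Op\<^esub>i\<in>{1..d}. \<zero>\<^bsub>Op\<^esub>)"
    using b z by (intro F.finsum_cong') (auto simp flip: F.m_assoc)
  finally have v: "b \<cdot> (\<one>\<^bsub>Op\<^esub> \<ominus>\<^bsub>Op\<^esub> vacuum) = \<zero>\<^bsub>Op\<^esub>" by simp
  show ?thesis
  proof (cases "\<exists>\<mu>. killing_tuple d L \<mu>")
    case True
    then show ?thesis using v by (simp add: support_proj_def)
  next
    case False
    then obtain i where i: "i \<in> {1..d}" "\<And>f. bdd f \<Longrightarrow> diag f \<in> A \<Longrightarrow> f [] = f [i]"
      using A_no_killing by blast
    obtain f where f: "bdd f" "b = diag f" using b by (rule A_diagE)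
    have "diag (\<lambda>\<nu>. f \<nu> * (1 - (if \<nu> = [] then 1 else 0))) = diag (\<lambda>_. 0)"
      using v f by (simp add: vacuum_def diag_mult diag_diff diag_zero flip: diag_one)
    then have f0: "f \<nu> = 0" if "\<nu> \<in> L" "\<nu> \<noteq> []" for \<nu>
      using diag_inj[OF _ that(1), of "\<lambda>\<nu>. f \<nu> * (1 - (if \<nu> = [] then 1 else 0))" "\<lambda>_. 0"] that(2) by simp
    then have "f \<nu> = 0" if "\<nu> \<in> L" for \<nu>
      using that i(2)[of f] f b f0[of "[i]"] single_in[OF i(1)] by (cases "\<nu> = []") auto
    then have "b = diag (\<lambda>_. 0)" unfolding f by (rule diag_cong)
    then show ?thesis using False b by (simp add: support_proj_def diag_zero)
  qed
qed

section \<open>The correspondence\<close>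

abbreviation "E \<equiv> monomial_correspondence d L"

lemma coeff_algebra_eq: "coeff_algebra L = Op\<lparr>carrier := A\<rparr>"
  by (simp add: coeff_algebra_def)

lemma coeff_algebra_simps:
  "nrm (coeff_algebra L) = nrm Op" "x \<otimes>\<^bsub>coeff_algebra L\<^esub> y = x \<cdot> y"
  "\<zero>\<^bsub>coeff_algebra L\<^esub> = \<zero>\<^bsub>Op\<^esub>"
  by (simp_all add: coeff_algebra_def)

lemma E_simps:
  "\<zero>\<^bsub>E\<^esub> = \<zero>\<^bsub>Op\<^esub>" "\<xi> \<oplus>\<^bsub>E\<^esub> \<eta> = \<xi> \<oplus>\<^bsub>Op\<^esub> \<eta>" "c \<odot>\<^bsub>E\<^esub> \<xi> = c \<odot>\<^bsub>Op\<^esub> \<xi>"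
  "coeff E = coeff_algebra L" "ract E \<xi> a = \<xi> \<cdot> a" "aip E \<xi> \<eta> = adj Op \<xi> \<cdot> \<eta>"
  "lact E a \<xi> = a \<cdot> \<xi>"
  by (simp_all add: monomial_correspondence_def Let_def)

lemma conj_shift_in_A: 
  assumes "a \<in> A"
  shows "conj_shift i a \<in> A"
proof -
  let ?V = "{a \<in> A. conj_shift i a \<in> A}"
  have "cstar_subalgebra Op ?V"
    unfolding F.cstar_subalgebra_iff
  proof (intro conjI ballI allI)
    show "F.closed_set ?V"
    proof (rule closed_set_preimage[OF F.normed_module_axioms F.normed_module_axioms closed_A closed_A])
      fix x y assume "x \<in> A" "y \<in> A"
      then show "nrm Op (conj_shift i x \<ominus>\<^bsub>Op\<^esub> conj_shift i y)
          \<le> nrm Op (T i) * nrm Op (T i) * nrm Op (x \<ominus>\<^bsub>Op\<^esub> y)"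
        using nrm_conj_shift_le[of "x \<ominus>\<^bsub>Op\<^esub> y" i] by (simp add: conj_shift_diff mult_ac)
    qed auto
  qed (auto simp: conj_shift_adj conj_shift_mult conj_shift_add conj_shift_smult)
  then have "A \<subseteq> ?V" by (rule A_least) (auto simp: conj_shift_P)
  then show ?thesis using assms by auto
qed

lemma adj_shift_A:
  assumes "a \<in> A"
  shows "adj Op (T i) \<cdot> a = conj_shift i a \<cdot> adj Op (T i)"
proof -
  have "adj Op (T i) \<cdot> a = adj Op (adj Op a \<cdot> T i)"
    using assms by (simp add: F.adj_mult)
  also have "\<dots> = adj Op (T i \<cdot> conj_shift i (adj Op a))"
    using A_shift[of "adj Op a" i] assms by (simp only: A_closed)
  also have "\<dots> = conj_shift i a \<cdot> adj Op (T i)"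
    using assms by (simp add: F.adj_mult F.m_assoc)
  finally show ?thesis .
qed

text \<open>The conditions on the right are closed and hold for the \<open>T\<^sub>i a\<close>. Conversely they give
  \<open>\<xi> = (1 - vacuum) \<xi> = \<Sum> T\<^sub>i (T\<^sub>i\<^sup>* \<xi>)\<close>, so \<open>\<xi>\<close> already lies in the linear span of the \<open>T\<^sub>i a\<close>.\<close>

lemma E_iff:
  "\<xi> \<in> carrier E \<longleftrightarrow> \<xi> \<in> carrier Op \<and> vacuum \<cdot> \<xi> = \<zero>\<^bsub>Op\<^esub> \<and>
     (\<forall>i\<in>{1..d}. adj Op (T i) \<cdot> \<xi> \<in> A)" (is "_ \<longleftrightarrow> \<xi> \<in> carrier Op \<and> ?v \<xi> \<and> ?a \<xi>")
proof -
  let ?G = "{T i \<cdot> a | i a. i \<in> {1..d} \<and> a \<in> A}"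
  have E: "carrier E = closed_span Op ?G" by (simp add: monomial_correspondence_def Let_def)
  let ?V = "{\<xi> \<in> carrier Op. ?v \<xi> \<and> ?a \<xi>}"
  have gen: "?G \<subseteq> ?V"
  proof
    fix \<xi> assume "\<xi> \<in> ?G"
    then obtain i a where ia: "\<xi> = T i \<cdot> a" "i \<in> {1..d}" "a \<in> A" by auto
    have "adj Op (T j) \<cdot> \<xi> \<in> A" for j
    proof -
      have "adj Op (T j) \<cdot> \<xi> = (adj Op (T j) \<cdot> \<one>\<^bsub>Op\<^esub> \<cdot> T i) \<cdot> a"
        using ia by (simp add: F.m_assoc)
      also have "\<dots> \<in> A"
        using ia conj_shift_in_A[OF one_in_A, of i] adj_shift_A_shift[OF one_in_A, of i j] by (cases "i = j") auto
      finally show ?thesis .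
    qed
    moreover have "vacuum \<cdot> \<xi> = \<zero>\<^bsub>Op\<^esub>"
      using ia vacuum_shift by (simp flip: F.m_assoc)
    ultimately show "\<xi> \<in> ?V" using ia by auto
  qed
  have sub: "submodule ?V Cx Op"
    unfolding F.submodule_iff
    by (auto simp: F.r_distr F.smult_mult_right)
  have cl: "norm_closed Op ?V"
  proof -
    have "?V = {\<xi> \<in> carrier Op. vacuum \<cdot> \<xi> \<in> {\<zero>\<^bsub>Op\<^esub>}} \<inter>
        (\<Inter>i\<in>{1..d}. {\<xi> \<in> carrier Op. adj Op (T i) \<cdot> \<xi> \<in> A})"
      by auto
    moreover have "norm_closed Op \<dots>"
      by (rule closedin_Int[OF F.closed_set_left_mult[OF F.closed_set_zero vacuum_in] closedin_Inter])
        (use d_pos in \<open>auto intro!: F.closed_set_left_mult closed_A\<close>)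
    ultimately show ?thesis by (simp only:)
  qed
  show ?thesis
  proof
    assume "\<xi> \<in> carrier E"
    then have "\<xi> \<in> ?V" unfolding E closed_span_def using gen sub cl by blast
    then show "\<xi> \<in> carrier Op \<and> ?v \<xi> \<and> ?a \<xi>" by simp
  next
    assume a: "\<xi> \<in> carrier Op \<and> ?v \<xi> \<and> ?a \<xi>"
    have "\<xi> = (\<one>\<^bsub>Op\<^esub> \<ominus>\<^bsub>Op\<^esub> vacuum) \<cdot> \<xi>"
      using a by (simp add: F.mult_diff_left)
    also have "\<dots> = (\<Oplus>\<^bsub>Op\<^esub>i\<in>{1..d}. T i \<cdot> (adj Op (T i) \<cdot> \<xi>))"
      using a unfolding sum_shift_adj_shift[symmetric]
      by (subst F.finsum_ldistr) (auto simp: F.m_assoc intro!: F.finsum_cong')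
    finally have e: "\<xi> = \<dots>" .
    have "\<xi> \<in> W" if W: "?G \<subseteq> W" "submodule W Cx Op" for W
    proof -
      have "(\<Oplus>\<^bsub>Op\<^esub>i\<in>{1..d}. T i \<cdot> (adj Op (T i) \<cdot> \<xi>)) \<in> W"
      proof (rule F.finsum_in_submodule[OF W(2)])
        fix i assume "i \<in> {1..d}"
        then have "T i \<cdot> (adj Op (T i) \<cdot> \<xi>) \<in> ?G" using a by blast
        then show "T i \<cdot> (adj Op (T i) \<cdot> \<xi>) \<in> W" using W(1) by blast
      qed simp
      then show ?thesis using e by simp
    qed
    then show "\<xi> \<in> carrier E" unfolding E closed_span_def by blast
  qed
qed

lemma E_in_Op [simp]: "\<xi> \<in> carrier E \<Longrightarrow> \<xi> \<in> carrier Op"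
  by (simp add: E_iff)

lemma coord_in_A [simp]: "\<xi> \<in> carrier E \<Longrightarrow> i \<in> {1..d} \<Longrightarrow> adj Op (T i) \<cdot> \<xi> \<in> A"
  by (simp add: E_iff)

lemma vacuum_E [simp]: "\<xi> \<in> carrier E \<Longrightarrow> vacuum \<cdot> \<xi> = \<zero>\<^bsub>Op\<^esub>"
  by (simp only: E_iff)

lemma E_I:
  "\<lbrakk>\<xi> \<in> carrier Op; vacuum \<cdot> \<xi> = \<zero>\<^bsub>Op\<^esub>; \<And>i. i \<in> {1..d} \<Longrightarrow> adj Op (T i) \<cdot> \<xi> \<in> A\<rbrakk>
    \<Longrightarrow> \<xi> \<in> carrier E"
  by (simp only: E_iff) blast

text \<open>The generators \<open>T\<^sub>i\<close> form a finite frame of \<open>E\<close>, the source of all finiteness below.\<close>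

lemma E_frame:
  assumes "\<xi> \<in> carrier E"
  shows "(\<Oplus>\<^bsub>Op\<^esub>i\<in>{1..d}. T i \<cdot> (adj Op (T i) \<cdot> \<xi>)) = \<xi>"
proof -
  have "(\<Oplus>\<^bsub>Op\<^esub>i\<in>{1..d}. T i \<cdot> (adj Op (T i) \<cdot> \<xi>)) = (\<one>\<^bsub>Op\<^esub> \<ominus>\<^bsub>Op\<^esub> vacuum) \<cdot> \<xi>"
    using assms unfolding sum_shift_adj_shift[symmetric]
    by (subst F.finsum_ldistr) (auto simp: F.m_assoc intro!: F.finsum_cong')
  also have "\<dots> = \<xi>" using assms by (simp add: F.mult_diff_left)
  finally show ?thesis .
qed

lemma E_add_closed [simp]: "\<xi> \<in> carrier E \<Longrightarrow> \<eta> \<in> carrier E \<Longrightarrow> \<xi> \<oplus>\<^bsub>Op\<^esub> \<eta> \<in> carrier E"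
  by (rule E_I) (simp_all add: F.r_distr)

lemma E_smult_closed [simp]: "\<xi> \<in> carrier E \<Longrightarrow> c \<odot>\<^bsub>Op\<^esub> \<xi> \<in> carrier E"
  by (rule E_I) (simp_all add: F.smult_mult_right)

lemma E_zero_closed [simp]: "\<zero>\<^bsub>Op\<^esub> \<in> carrier E"
  by (rule E_I) simp_all

lemma E_ract_closed [simp]: "\<xi> \<in> carrier E \<Longrightarrow> a \<in> A \<Longrightarrow> \<xi> \<cdot> a \<in> carrier E"
  by (rule E_I) (simp_all flip: F.m_assoc)

lemma vacuum_commute: "a \<in> A \<Longrightarrow> vacuum \<cdot> a = a \<cdot> vacuum"
  by (elim A_diagE) (simp add: vacuum_def diag_mult mult.commute)

lemma E_lact_closed [simp]:
  assumes "\<xi> \<in> carrier E" "a \<in> A"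
  shows "a \<cdot> \<xi> \<in> carrier E"
proof -
  have "vacuum \<cdot> (a \<cdot> \<xi>) = (vacuum \<cdot> a) \<cdot> \<xi>"
    using assms by (simp add: F.m_assoc)
  also have "\<dots> = \<zero>\<^bsub>Op\<^esub>"
    unfolding vacuum_commute[OF assms(2)] using assms by (simp add: F.m_assoc)
  finally have "vacuum \<cdot> (a \<cdot> \<xi>) = \<zero>\<^bsub>Op\<^esub>" .
  moreover have "adj Op (T i) \<cdot> (a \<cdot> \<xi>) = conj_shift i a \<cdot> (adj Op (T i) \<cdot> \<xi>)" for i
  proof -
    have "adj Op (T i) \<cdot> (a \<cdot> \<xi>) = (adj Op (T i) \<cdot> a) \<cdot> \<xi>" using assms by (simp add: F.m_assoc)
    also have "\<dots> = (conj_shift i a \<cdot> adj Op (T i)) \<cdot> \<xi>" using adj_shift_A[OF assms(2)] by simp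
    also have "\<dots> = conj_shift i a \<cdot> (adj Op (T i) \<cdot> \<xi>)" using assms by (intro F.m_assoc) auto
    finally show ?thesis .
  qed
  ultimately show ?thesis
    using assms conj_shift_in_A[OF assms(2)] by (intro E_I) simp_all
qed

lemma shift_in_E [simp]: "i \<in> {1..d} \<Longrightarrow> T i \<in> carrier E"
proof (rule E_I)
  fix j assume "i \<in> {1..d}"
  show "adj Op (T j) \<cdot> T i \<in> A"
    using conj_shift_in_A[OF one_in_A, of i] adj_shift_A_shift[OF one_in_A, of i j]
    by (cases "i = j") simp_all
qed (simp_all add: vacuum_shift)

lemma E_finsum_closed [simp]:
  assumes "finite J" "\<And>i. i \<in> J \<Longrightarrow> f i \<in> carrier E"
  shows "(\<Oplus>\<^bsub>Op\<^esub>i\<in>J. f i) \<in> carrier E"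
  using assms by (induction J) (auto simp: Pi_iff)

lemma E_aip_frame:
  assumes "\<xi> \<in> carrier E" "\<eta> \<in> carrier E"
  shows "adj Op \<xi> \<cdot> \<eta> =
    (\<Oplus>\<^bsub>Op\<^esub>i\<in>{1..d}. adj Op (adj Op (T i) \<cdot> \<xi>) \<cdot> (adj Op (T i) \<cdot> \<eta>))"
proof -
  have "adj Op \<xi> \<cdot> \<eta> = adj Op \<xi> \<cdot> (\<Oplus>\<^bsub>Op\<^esub>i\<in>{1..d}. T i \<cdot> (adj Op (T i) \<cdot> \<eta>))"
    using E_frame[OF assms(2)] by simp
  also have "\<dots> = (\<Oplus>\<^bsub>Op\<^esub>i\<in>{1..d}. adj Op \<xi> \<cdot> (T i \<cdot> (adj Op (T i) \<cdot> \<eta>)))"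
    using assms by (intro F.finsum_rdistr) auto
  also have "\<dots> = (\<Oplus>\<^bsub>Op\<^esub>i\<in>{1..d}. adj Op (adj Op (T i) \<cdot> \<xi>) \<cdot> (adj Op (T i) \<cdot> \<eta>))"
    using assms by (intro F.finsum_cong') (auto simp: F.adj_mult F.m_assoc)
  finally show ?thesis .
qed

lemma A_finsum_closed:
  assumes "finite J" "\<And>i. i \<in> J \<Longrightarrow> f i \<in> A"
  shows "(\<Oplus>\<^bsub>Op\<^esub>i\<in>J. f i) \<in> A"
  using assms by (induction J) (auto simp: Pi_iff)

lemma E_aip_in_A [simp]:
  assumes "\<xi> \<in> carrier E" "\<eta> \<in> carrier E"
  shows "adj Op \<xi> \<cdot> \<eta> \<in> A"
  unfolding E_aip_frame[OF assms] using assms by (intro A_finsum_closed) auto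

lemma E_ext:
  assumes "\<xi> \<in> carrier E" "\<eta> \<in> carrier E"
    "\<And>\<zeta>. \<zeta> \<in> carrier E \<Longrightarrow> adj Op \<zeta> \<cdot> \<xi> = adj Op \<zeta> \<cdot> \<eta>"
  shows "\<xi> = \<eta>"
proof -
  have m: "\<xi> \<ominus>\<^bsub>Op\<^esub> \<eta> \<in> carrier E" using assms by (simp add: F.diff_eq_smult)
  have "\<xi> \<ominus>\<^bsub>Op\<^esub> \<eta> = \<zero>\<^bsub>Op\<^esub>"
    by (rule F.eq_zero_of_adj_mult) (use assms assms(3)[OF m] m in \<open>auto simp: F.mult_diff_right\<close>)
  then show ?thesis using assms F.n_diff_eq_0[of \<xi> \<eta>] by simp
qed

lemma enorm_E: "\<xi> \<in> carrier E \<Longrightarrow> enorm E \<xi> = nrm Op \<xi>"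
  by (simp add: enorm_def E_simps coeff_algebra_simps F.cstar_identity F.n_nonneg)

lemma normed_module_E: "normed_module E (enorm E)"
proof (intro normed_module.intro normed_module_axioms.intro)
  show "Module.module Cx E"
  proof (rule moduleI)
    show "abelian_group E"
    proof (rule abelian_groupI)
      fix \<xi> assume \<xi>: "\<xi> \<in> carrier E"
      then show "\<exists>\<eta>\<in>carrier E. \<eta> \<oplus>\<^bsub>E\<^esub> \<xi> = \<zero>\<^bsub>E\<^esub>"
        using F.uminus_eq_smult[of \<xi>] F.M.l_neg[of \<xi>]
        by (intro bexI[of _ "(- 1) \<odot>\<^bsub>Op\<^esub> \<xi>"]) (auto simp: E_simps)
    qed (auto simp: E_simps F.M.a_ac)
  qed (auto simp: cring_Cx E_simps F.smult_add_left F.smult_add_right F.smult_smult)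
next
  fix \<xi> \<eta> c assume \<xi>: "\<xi> \<in> carrier E"
  show "0 \<le> enorm E \<xi>" using \<xi> by (simp add: enorm_E F.n_nonneg)
  show "enorm E \<xi> = 0 \<longleftrightarrow> \<xi> = \<zero>\<^bsub>E\<^esub>" using \<xi> by (simp add: enorm_E E_simps F.n_eq_0)
  show "enorm E (c \<odot>\<^bsub>E\<^esub> \<xi>) = cmod c * enorm E \<xi>" using \<xi> by (simp add: enorm_E E_simps F.n_smult)
  assume \<eta>: "\<eta> \<in> carrier E"
  show "enorm E (\<xi> \<oplus>\<^bsub>E\<^esub> \<eta>) \<le> enorm E \<xi> + enorm E \<eta>"
    using \<xi> \<eta> by (simp add: enorm_E E_simps F.n_triangle)
qed

sublocale E: normed_module E "enorm E"
  by (rule normed_module_E)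

lemma E_finsum:
  assumes "finite J" "\<And>i. i \<in> J \<Longrightarrow> f i \<in> carrier E"
  shows "(\<Oplus>\<^bsub>E\<^esub>i\<in>J. f i) = (\<Oplus>\<^bsub>Op\<^esub>i\<in>J. f i)"
  using assms
proof (induction J)
  case empty
  then show ?case by (simp add: E_simps)
next
  case (insert i J)
  then show ?case by (subst E.M.finsum_insert, simp_all add: Pi_iff E_simps)
qed

section \<open>Adjointable and compact operators\<close>

abbreviation "LE \<equiv> adjointable_ops E"

lemma adjointable_iff:
  "S \<in> carrier LE \<longleftrightarrow> S \<in> carrier E \<rightarrow>\<^sub>E carrier E \<and> (\<exists>S'\<in>carrier E \<rightarrow>\<^sub>E carrier E.
     \<forall>\<xi>\<in>carrier E. \<forall>\<eta>\<in>carrier E. adj Op (S \<xi>) \<cdot> \<eta> = adj Op \<xi> \<cdot> S' \<eta>)"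
  by (simp add: adjointable_ops_def op_algebra_def E_simps)

lemma adjointable_closed [simp]: "S \<in> carrier LE \<Longrightarrow> \<xi> \<in> carrier E \<Longrightarrow> S \<xi> \<in> carrier E"
  by (auto simp: adjointable_iff)

lemma aip_swap:
  assumes "\<xi> \<in> carrier E" "\<eta> \<in> carrier E" "\<xi>' \<in> carrier E" "\<eta>' \<in> carrier E" 
    "adj Op \<xi> \<cdot> \<eta> = adj Op \<xi>' \<cdot> \<eta>'"
  shows "adj Op \<eta> \<cdot> \<xi> = adj Op \<eta>' \<cdot> \<xi>'"
proof -
  have "adj Op (adj Op \<xi> \<cdot> \<eta>) = adj Op (adj Op \<xi>' \<cdot> \<eta>')" using assms by simp
  then show ?thesis using assms(1-4) by (simp add: F.adj_mult)
qed

text \<open>Moving \<open>S\<close> to the other side of the inner product, expanding in the frame, and moving it back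
  shows that an adjointable operator is determined by its values on the frame.\<close>

lemma adjointable_frame:
  assumes S: "S \<in> carrier LE" and \<xi>: "\<xi> \<in> carrier E"
  shows "S \<xi> = (\<Oplus>\<^bsub>Op\<^esub>i\<in>{1..d}. S (T i) \<cdot> (adj Op (T i) \<cdot> \<xi>))"
proof (rule E_ext)
  show "S \<xi> \<in> carrier E" using S \<xi> by simp
  show "(\<Oplus>\<^bsub>Op\<^esub>i\<in>{1..d}. S (T i) \<cdot> (adj Op (T i) \<cdot> \<xi>)) \<in> carrier E"
    using S \<xi> by (intro E_finsum_closed) auto
  fix \<zeta> assume \<zeta>: "\<zeta> \<in> carrier E"
  obtain S' where S': "S' \<in> carrier E \<rightarrow>\<^sub>E carrier E"
      "\<And>\<xi> \<eta>. \<xi> \<in> carrier E \<Longrightarrow> \<eta> \<in> carrier E \<Longrightarrow> adj Op (S \<xi>) \<cdot> \<eta> = adj Op \<xi> \<cdot> S' \<eta>"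
    using S unfolding adjointable_iff by blast
  have S'c: "S' \<zeta> \<in> carrier E" using S' \<zeta> by auto
  have sw: "adj Op \<zeta> \<cdot> S \<xi> = adj Op (S' \<zeta>) \<cdot> \<xi>" if "\<xi> \<in> carrier E" for \<xi>
    by (rule aip_swap) (use S that \<zeta> S'c S'(2)[OF that \<zeta>] in auto)
  have "adj Op \<zeta> \<cdot> S \<xi> = adj Op (S' \<zeta>) \<cdot> (\<Oplus>\<^bsub>Op\<^esub>i\<in>{1..d}. T i \<cdot> (adj Op (T i) \<cdot> \<xi>))"
    using sw[OF \<xi>] E_frame[OF \<xi>] by simp
  also have "\<dots> = (\<Oplus>\<^bsub>Op\<^esub>i\<in>{1..d}. adj Op (S' \<zeta>) \<cdot> (T i \<cdot> (adj Op (T i) \<cdot> \<xi>)))"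
    using S'c \<xi> by (intro F.finsum_rdistr) auto
  also have "\<dots> = (\<Oplus>\<^bsub>Op\<^esub>i\<in>{1..d}. adj Op \<zeta> \<cdot> (S (T i) \<cdot> (adj Op (T i) \<cdot> \<xi>)))"
    using S'c \<xi> \<zeta> S sw[OF shift_in_E] by (intro F.finsum_cong') (auto simp flip: F.m_assoc)
  also have "\<dots> = adj Op \<zeta> \<cdot> (\<Oplus>\<^bsub>Op\<^esub>i\<in>{1..d}. S (T i) \<cdot> (adj Op (T i) \<cdot> \<xi>))"
    using S \<xi> \<zeta> by (intro F.finsum_rdistr[symmetric]) auto
  finally show "adj Op \<zeta> \<cdot> S \<xi> =
      adj Op \<zeta> \<cdot> (\<Oplus>\<^bsub>Op\<^esub>i\<in>{1..d}. S (T i) \<cdot> (adj Op (T i) \<cdot> \<xi>))" .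
qed

text \<open>Linearity follows from the existence of an adjoint, boundedness from the frame expansion.\<close>

lemma operator_space_LE: "operator_space E (enorm E) (carrier LE)"
proof (intro operator_space.intro operator_space_axioms.intro normed_module_E)
  show "(\<lambda>x\<in>carrier E. \<zero>\<^bsub>E\<^esub>) \<in> carrier LE"
    by (auto simp: adjointable_iff E_simps intro!: bexI[of _ "\<lambda>x\<in>carrier E. \<zero>\<^bsub>Op\<^esub>"])
  fix S assume S: "S \<in> carrier LE"
  obtain S' where S': "S' \<in> carrier E \<rightarrow>\<^sub>E carrier E"
      "\<And>\<xi> \<eta>. \<xi> \<in> carrier E \<Longrightarrow> \<eta> \<in> carrier E \<Longrightarrow> adj Op (S \<xi>) \<cdot> \<eta> = adj Op \<xi> \<cdot> S' \<eta>"
    using S unfolding adjointable_iff by blast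
  have S'c: "\<And>\<xi>. \<xi> \<in> carrier E \<Longrightarrow> S' \<xi> \<in> carrier E" using S' by auto
  show "S \<in> carrier E \<rightarrow>\<^sub>E carrier E" using S by (simp add: adjointable_iff)
  note fr = adjointable_frame[OF S]
  { fix \<xi> \<eta> assume a: "\<xi> \<in> carrier E" "\<eta> \<in> carrier E"
    show "S (\<xi> \<oplus>\<^bsub>E\<^esub> \<eta>) = S \<xi> \<oplus>\<^bsub>E\<^esub> S \<eta>"
      unfolding E_simps
    proof (rule E_ext)
      fix \<zeta> assume \<zeta>: "\<zeta> \<in> carrier E"
      have sw: "adj Op \<zeta> \<cdot> S \<xi> = adj Op (S' \<zeta>) \<cdot> \<xi>" if "\<xi> \<in> carrier E" for \<xi>
        by (rule aip_swap) (use S that \<zeta> S'c S'(2)[OF that \<zeta>] in auto)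
      show "adj Op \<zeta> \<cdot> S (\<xi> \<oplus>\<^bsub>Op\<^esub> \<eta>) = adj Op \<zeta> \<cdot> (S \<xi> \<oplus>\<^bsub>Op\<^esub> S \<eta>)"
        using a \<zeta> S S'c[OF \<zeta>] by (simp add: sw F.r_distr)
    qed (use a S in auto) }
  { fix \<xi> c assume a: "\<xi> \<in> carrier E"
    show "S (c \<odot>\<^bsub>E\<^esub> \<xi>) = c \<odot>\<^bsub>E\<^esub> S \<xi>"
      unfolding E_simps
    proof (rule E_ext)
      fix \<zeta> assume \<zeta>: "\<zeta> \<in> carrier E"
      have sw: "adj Op \<zeta> \<cdot> S \<xi> = adj Op (S' \<zeta>) \<cdot> \<xi>" if "\<xi> \<in> carrier E" for \<xi>
        by (rule aip_swap) (use S that \<zeta> S'c S'(2)[OF that \<zeta>] in auto)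
      show "adj Op \<zeta> \<cdot> S (c \<odot>\<^bsub>Op\<^esub> \<xi>) = adj Op \<zeta> \<cdot> (c \<odot>\<^bsub>Op\<^esub> S \<xi>)"
        using a \<zeta> S S'c[OF \<zeta>] by (simp add: sw F.smult_mult_right)
    qed (use a S in auto) }
  show "\<exists>K. \<forall>\<xi>\<in>carrier E. enorm E (S \<xi>) \<le> K * enorm E \<xi>"
  proof (intro exI ballI)
    fix \<xi> assume \<xi>: "\<xi> \<in> carrier E"
    have "nrm Op (S \<xi>) \<le> (\<Sum>i\<in>{1..d}. nrm Op (S (T i) \<cdot> (adj Op (T i) \<cdot> \<xi>)))"
      unfolding fr[OF \<xi>] using S \<xi> by (intro F.n_finsum_le) auto
    also have "\<dots> \<le> (\<Sum>i\<in>{1..d}. nrm Op (S (T i)) * (nrm Op (adj Op (T i)) * nrm Op \<xi>))"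
      using S \<xi> by (intro sum_mono F.nrm_mult_le) auto
    finally show "enorm E (S \<xi>) \<le> (\<Sum>i\<in>{1..d}. nrm Op (S (T i)) * nrm Op (adj Op (T i))) * enorm E \<xi>"
      using S \<xi> by (simp add: enorm_E sum_distrib_right mult.assoc)
  qed
  show "(\<lambda>x\<in>carrier E. c \<odot>\<^bsub>E\<^esub> S x) \<in> carrier LE" for c
    using S S'
    by (auto simp: adjointable_iff E_simps S'c F.adj_smult F.smult_mult_left F.smult_mult_right
        intro!: bexI[of _ "\<lambda>x\<in>carrier E. cnj c \<odot>\<^bsub>Op\<^esub> S' x"])
  fix R assume R: "R \<in> carrier LE"
  obtain R' where R': "R' \<in> carrier E \<rightarrow>\<^sub>E carrier E"
      "\<And>\<xi> \<eta>. \<xi> \<in> carrier E \<Longrightarrow> \<eta> \<in> carrier E \<Longrightarrow> adj Op (R \<xi>) \<cdot> \<eta> = adj Op \<xi> \<cdot> R' \<eta>"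
    using R unfolding adjointable_iff by blast
  have R'c: "\<And>\<xi>. \<xi> \<in> carrier E \<Longrightarrow> R' \<xi> \<in> carrier E" using R' by auto
  show "(\<lambda>x\<in>carrier E. S x \<oplus>\<^bsub>E\<^esub> R x) \<in> carrier LE"
    unfolding adjointable_iff
  proof (intro conjI bexI[of _ "\<lambda>x\<in>carrier E. S' x \<oplus>\<^bsub>Op\<^esub> R' x"] ballI)
    fix \<xi> \<eta> assume "\<xi> \<in> carrier E" "\<eta> \<in> carrier E"
    then show "adj Op ((\<lambda>x\<in>carrier E. S x \<oplus>\<^bsub>E\<^esub> R x) \<xi>) \<cdot> \<eta> =
        adj Op \<xi> \<cdot> (\<lambda>x\<in>carrier E. S' x \<oplus>\<^bsub>Op\<^esub> R' x) \<eta>"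
      using S R S' R' S'c R'c by (simp add: E_simps F.adj_add F.l_distr F.r_distr)
  qed (use S R S'c R'c in \<open>auto simp: E_simps\<close>)
qed

sublocale LE: operator_space E "enorm E" "aip E" "carrier LE"
  rewrites "op_algebra E (enorm E) (aip E) (carrier LE) = LE"
  by (rule operator_space_LE) (simp add: adjointable_ops_def op_algebra_def)

sublocale LE: normed_module LE "nrm LE"
  by (rule LE.normed_op_algebra)

lemma adj_AE_eqI:
  assumes S: "S \<in> carrier LE" and S': "S' \<in> carrier E \<rightarrow>\<^sub>E carrier E"
    and ad: "\<And>\<xi> \<eta>. \<xi> \<in> carrier E \<Longrightarrow> \<eta> \<in> carrier E \<Longrightarrow> adj Op (S \<xi>) \<cdot> \<eta> = adj Op \<xi> \<cdot> S' \<eta>"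
  shows "adj LE S = S'" and "S' \<in> carrier LE"
proof -
  have S'c: "\<And>\<xi>. \<xi> \<in> carrier E \<Longrightarrow> S' \<xi> \<in> carrier E" using S' by auto
  have "adj Op (S' \<xi>) \<cdot> \<eta> = adj Op \<xi> \<cdot> S \<eta>" if "\<xi> \<in> carrier E" "\<eta> \<in> carrier E" for \<xi> \<eta>
    by (rule aip_swap) (use that S S'c ad in auto)
  then show S'A: "S' \<in> carrier LE"
    using S S' unfolding adjointable_iff by (intro conjI bexI[of _ S]) auto
  have "adj LE S = (THE S'. S' \<in> carrier LE \<and>
      (\<forall>\<xi>\<in>carrier E. \<forall>\<eta>\<in>carrier E. adj Op (S \<xi>) \<cdot> \<eta> = adj Op \<xi> \<cdot> S' \<eta>))"
    by (simp add: adjointable_ops_def op_algebra_def E_simps)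
  also have "\<dots> = S'"
  proof (rule the_equality)
    fix R assume R: "R \<in> carrier LE \<and>
      (\<forall>\<xi>\<in>carrier E. \<forall>\<eta>\<in>carrier E. adj Op (S \<xi>) \<cdot> \<eta> = adj Op \<xi> \<cdot> R \<eta>)"
    show "R = S'"
    proof (rule LE.op_ext)
      fix \<eta> assume \<eta>: "\<eta> \<in> carrier E"
      show "R \<eta> = S' \<eta>"
        by (rule E_ext) (use R \<eta> S'c ad in auto)
    qed (use R S'A in auto)
  qed (use S'A ad in auto)
  finally show "adj LE S = S'" .
qed

lemma adj_LE:
  assumes S: "S \<in> carrier LE"
  shows "adj LE S \<in> carrier LE"
    and "\<And>\<xi> \<eta>. \<xi> \<in> carrier E \<Longrightarrow> \<eta> \<in> carrier E \<Longrightarrow> adj Op (S \<xi>) \<cdot> \<eta> = adj Op \<xi> \<cdot> adj LE S \<eta>"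
proof -
  obtain S' where S': "S' \<in> carrier E \<rightarrow>\<^sub>E carrier E"
      "\<And>\<xi> \<eta>. \<xi> \<in> carrier E \<Longrightarrow> \<eta> \<in> carrier E \<Longrightarrow> adj Op (S \<xi>) \<cdot> \<eta> = adj Op \<xi> \<cdot> S' \<eta>"
    using S unfolding adjointable_iff by blast
  note e = adj_AE_eqI[OF S S']
  show "adj LE S \<in> carrier LE" using e by simp
  show "\<And>\<xi> \<eta>. \<xi> \<in> carrier E \<Longrightarrow> \<eta> \<in> carrier E \<Longrightarrow> adj Op (S \<xi>) \<cdot> \<eta> = adj Op \<xi> \<cdot> adj LE S \<eta>"
    using e S' by simp
qed

lemma rank_one_apply:
  "\<zeta> \<in> carrier E \<Longrightarrow> rank_one E \<xi> \<eta> \<zeta> = \<xi> \<cdot> (adj Op \<eta> \<cdot> \<zeta>)"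
  by (simp add: rank_one_def E_simps)

lemma rank_one_fun:
  "\<xi> \<in> carrier E \<Longrightarrow> \<eta> \<in> carrier E \<Longrightarrow> rank_one E \<xi> \<eta> \<in> carrier E \<rightarrow>\<^sub>E carrier E"
  unfolding rank_one_def E_simps restrict_PiE_iff by simp

lemma rank_one_in_LE [simp]:
  assumes "\<xi> \<in> carrier E" "\<eta> \<in> carrier E"
  shows "rank_one E \<xi> \<eta> \<in> carrier LE"
  unfolding adjointable_iff
proof (intro conjI bexI[of _ "rank_one E \<eta> \<xi>"] ballI)
  fix \<zeta> \<theta> assume "\<zeta> \<in> carrier E" "\<theta> \<in> carrier E"
  then show "adj Op (rank_one E \<xi> \<eta> \<zeta>) \<cdot> \<theta> = adj Op \<zeta> \<cdot> rank_one E \<eta> \<xi> \<theta>"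
    using assms by (simp add: rank_one_apply F.adj_mult F.m_assoc)
qed (use assms rank_one_fun in blast)+

abbreviation "rank_ones \<equiv> {rank_one E \<xi> \<eta> | \<xi> \<eta>. \<xi> \<in> carrier E \<and> \<eta> \<in> carrier E}"

lemma compact_in_LE: 
  assumes "S \<in> carrier (compact_ops E)"
  shows "S \<in> carrier LE"
proof -
  have "submodule (carrier LE) Cx LE" by (rule LE.carrier_is_submodule)
  moreover have "rank_ones \<subseteq> carrier LE" by auto
  ultimately show ?thesis
    using assms LE.closed_set_carrier unfolding compact_ops_def closed_span_def by auto
qed

lemma compact_ops_simps:
  "S \<oplus>\<^bsub>compact_ops E\<^esub> R = S \<oplus>\<^bsub>LE\<^esub> R" "S \<otimes>\<^bsub>compact_ops E\<^esub> R = compose (carrier E) S R"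
  "c \<odot>\<^bsub>compact_ops E\<^esub> S = c \<odot>\<^bsub>LE\<^esub> S" "adj (compact_ops E) S = adj LE S"
  by (simp_all add: compact_ops_def) (simp add: adjointable_ops_def op_algebra_def)

lemma rank_one_compact:
  "\<xi> \<in> carrier E \<Longrightarrow> \<eta> \<in> carrier E \<Longrightarrow> rank_one E \<xi> \<eta> \<in> carrier (compact_ops E)"
  unfolding compact_ops_def closed_span_def by auto

lemma finsum_compact:
  assumes "finite J" "\<And>i. i \<in> J \<Longrightarrow> f i \<in> carrier (compact_ops E)"
  shows "(\<Oplus>\<^bsub>LE\<^esub>i\<in>J. f i) \<in> carrier (compact_ops E)"
proof -
  have "(\<Oplus>\<^bsub>LE\<^esub>i\<in>J. f i) \<in> V" if V: "rank_ones \<subseteq> V" "submodule V Cx LE" "norm_closed LE V" for V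
    by (rule LE.finsum_in_submodule[OF V(2) assms(1)])
      (use assms(2) V in \<open>auto simp: compact_ops_def closed_span_def\<close>)
  then show ?thesis unfolding compact_ops_def closed_span_def by auto
qed

lemma left_op_apply: "\<xi> \<in> carrier E \<Longrightarrow> left_op E a \<xi> = a \<cdot> \<xi>"
  by (simp add: left_op_def E_simps)

text \<open>The left action is by compact operators, because \<open>E\<close> has a finite frame.\<close>

lemma left_op_eq_finsum:
  assumes a: "a \<in> A"
  shows "left_op E a = (\<Oplus>\<^bsub>LE\<^esub>i\<in>{1..d}. rank_one E (a \<cdot> T i) (T i))"
proof -
  let ?S = "\<Oplus>\<^bsub>LE\<^esub>i\<in>{1..d}. rank_one E (a \<cdot> T i) (T i)"
  have S: "?S \<in> carrier LE" using a by (intro LE.M.finsum_closed) auto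
  have "?S \<xi> = a \<cdot> \<xi>" if \<xi>: "\<xi> \<in> carrier E" for \<xi>
  proof -
    have "?S \<xi> = (\<Oplus>\<^bsub>E\<^esub>i\<in>{1..d}. rank_one E (a \<cdot> T i) (T i) \<xi>)"
      using a \<xi> by (intro LE.finsum_op_apply) auto
    also have "\<dots> = (\<Oplus>\<^bsub>Op\<^esub>i\<in>{1..d}. rank_one E (a \<cdot> T i) (T i) \<xi>)"
      using a \<xi> by (intro E_finsum) auto
    also have "\<dots> = (\<Oplus>\<^bsub>Op\<^esub>i\<in>{1..d}. a \<cdot> (T i \<cdot> (adj Op (T i) \<cdot> \<xi>)))"
      using a \<xi> by (intro F.finsum_cong') (auto simp: rank_one_apply F.m_assoc)
    also have "\<dots> = a \<cdot> \<xi>"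
      using a \<xi> E_frame[OF \<xi>] by (subst F.finsum_rdistr[symmetric]) auto
    finally show ?thesis .
  qed
  note S_apply = this
  show ?thesis
  proof (rule PiE_ext)
    show "left_op E a \<in> carrier E \<rightarrow>\<^sub>E carrier E"
      using a unfolding left_op_def E_simps restrict_PiE_iff by simp
    show "?S \<in> carrier E \<rightarrow>\<^sub>E carrier E" by (rule LE.op_fun[OF S])
    show "left_op E a \<xi> = ?S \<xi>" if "\<xi> \<in> carrier E" for \<xi>
      by (simp only: left_op_apply[OF that] S_apply[OF that])
  qed
qed

lemma left_op_compact:
  assumes "a \<in> A"
  shows "left_op E a \<in> carrier (compact_ops E)"
  unfolding left_op_eq_finsum[OF assms]
  using assms by (intro finsum_compact rank_one_compact E_lact_closed shift_in_E) auto

lemma left_op_eq_zero_iff: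
  assumes "b \<in> A"
  shows "left_op E b = \<zero>\<^bsub>LE\<^esub> \<longleftrightarrow> (\<forall>\<xi>\<in>carrier E. b \<cdot> \<xi> = \<zero>\<^bsub>Op\<^esub>)"
proof
  assume "left_op E b = \<zero>\<^bsub>LE\<^esub>"
  then have "left_op E b \<xi> = \<zero>\<^bsub>Op\<^esub>" if "\<xi> \<in> carrier E" for \<xi>
    using that by (simp add: LE.op_algebra_simps E_simps)
  then show "\<forall>\<xi>\<in>carrier E. b \<cdot> \<xi> = \<zero>\<^bsub>Op\<^esub>" by (simp add: left_op_apply)
qed (auto simp: LE.op_algebra_simps left_op_def E_simps intro!: restrict_ext)

lemma katsura_iff:
  "a \<in> katsura_ideal E \<longleftrightarrow> a \<in> A \<and>
    (\<forall>b\<in>A. (\<forall>\<xi>\<in>carrier E. b \<cdot> \<xi> = \<zero>\<^bsub>Op\<^esub>) \<longrightarrow> a \<cdot> b = \<zero>\<^bsub>Op\<^esub>)"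
proof -
  have "a \<in> katsura_ideal E \<longleftrightarrow> a \<in> A \<and> left_op E a \<in> carrier (compact_ops E) \<and>
    (\<forall>b\<in>A. left_op E b = \<zero>\<^bsub>LE\<^esub> \<longrightarrow> a \<cdot> b = \<zero>\<^bsub>Op\<^esub>)"
    unfolding katsura_ideal_def E_simps by (auto simp: coeff_algebra_simps) 
  then show ?thesis using left_op_compact left_op_eq_zero_iff by auto
qed

lemma support_proj_katsura: "support_proj \<in> katsura_ideal E"
  unfolding katsura_iff
proof (intro conjI ballI impI)
  fix b assume b: "b \<in> A" and "\<forall>\<xi>\<in>carrier E. b \<cdot> \<xi> = \<zero>\<^bsub>Op\<^esub>"
  then have "b \<cdot> support_proj = \<zero>\<^bsub>Op\<^esub>" by (intro mult_support_proj_eq_zero) auto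
  then show "support_proj \<cdot> b = \<zero>\<^bsub>Op\<^esub>" using A_commute[OF b support_proj_in_A] by simp
qed simp

text \<open>The projection \<open>vacuum\<close>, when it lies in \<open>A\<close>, acts as zero on \<open>E\<close>.\<close>

lemma katsura_mult_support_proj:
  assumes "a \<in> katsura_ideal E"
  shows "a \<in> A" and "a \<cdot> support_proj = a"
proof -
  show a: "a \<in> A" using assms by (simp add: katsura_iff)
  show "a \<cdot> support_proj = a"
  proof (cases "\<exists>\<mu>. killing_tuple d L \<mu>")
    case True
    then have v: "vacuum \<in> A" using vacuum_in_A by blast
    have "\<forall>\<xi>\<in>carrier E. vacuum \<cdot> \<xi> = \<zero>\<^bsub>Op\<^esub>" by simp
    then have "a \<cdot> vacuum = \<zero>\<^bsub>Op\<^esub>" using assms v by (simp add: katsura_iff)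
    then show ?thesis using a True by (simp add: support_proj_def F.mult_diff_right)
  qed (use a in \<open>simp add: support_proj_def\<close>)
qed

end

(* Keeps the index set {1..d} from being rewritten to {Suc 0..d}. *)
declare One_nat_def [simp del]

section \<open>Representations of the correspondence\<close>

locale corr_representation = factor_closed_language d L + B: pre_cstar_algebra B
  for d :: nat and L :: "nat list set" and B :: "('b, 'k) cstar_scheme" (structure) +
  fixes p t :: "((nat list \<Rightarrow> complex) \<Rightarrow> nat list \<Rightarrow> complex) \<Rightarrow> 'b"
  assumes rep: "corr_rep (monomial_correspondence d L) B p t"
begin

lemma p_hom: "p \<in> star_hom (coeff_algebra L) B"
  using rep by (simp add: corr_rep_def E_simps)

sublocale p: subalgebra_hom Op B A p
  by unfold_locales (use subalg_A p_hom coeff_algebra_eq in auto)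

lemma t_closed [simp]: "\<xi> \<in> carrier E \<Longrightarrow> t \<xi> \<in> carrier B"
  using rep by (auto simp: corr_rep_def)

lemma t_add: "\<xi> \<in> carrier E \<Longrightarrow> \<eta> \<in> carrier E \<Longrightarrow> t (\<xi> \<oplus>\<^bsub>Op\<^esub> \<eta>) = t \<xi> \<oplus> t \<eta>"
  using rep by (simp add: corr_rep_def E_simps)

lemma t_smult: "\<xi> \<in> carrier E \<Longrightarrow> t (c \<odot>\<^bsub>Op\<^esub> \<xi>) = c \<odot> t \<xi>"
  using rep by (simp add: corr_rep_def E_simps)

lemma t_inner: "\<xi> \<in> carrier E \<Longrightarrow> \<eta> \<in> carrier E \<Longrightarrow> adj B (t \<xi>) \<otimes> t \<eta> = p (adj Op \<xi> \<cdot> \<eta>)"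
  using rep by (simp add: corr_rep_def E_simps)

lemma t_lact: "\<xi> \<in> carrier E \<Longrightarrow> a \<in> A \<Longrightarrow> t (a \<cdot> \<xi>) = p a \<otimes> t \<xi>"
  using rep by (simp add: corr_rep_def E_simps left_op_apply)

text \<open>With \<open>x\<close> and \<open>y\<close> the two sides, \<open>x\<^sup>*x\<close>, \<open>x\<^sup>*y\<close>, \<open>y\<^sup>*x\<close> and \<open>y\<^sup>*y\<close> all agree, so that
  \<open>(x - y)\<^sup>*(x - y) = 0\<close>.\<close>

lemma t_ract:
  assumes \<xi>: "\<xi> \<in> carrier E" and a: "a \<in> A"
  shows "t (\<xi> \<cdot> a) = t \<xi> \<otimes> p a"
proof -
  let ?x = "t (\<xi> \<cdot> a)" and ?y = "t \<xi> \<otimes> p a" and ?g = "adj Op \<xi> \<cdot> \<xi>"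
  have c: "?x \<in> carrier B" "?y \<in> carrier B" "?g \<in> A" using \<xi> a by auto
  have xx: "adj B ?x \<otimes> ?x = p (adj Op a \<cdot> (?g \<cdot> a))"
    using \<xi> a by (simp add: t_inner F.adj_mult F.m_assoc)
  have xy: "adj B ?x \<otimes> ?y = p (adj Op a \<cdot> (?g \<cdot> a))"
  proof -
    have "adj B ?x \<otimes> ?y = (adj B ?x \<otimes> t \<xi>) \<otimes> p a" using \<xi> a c by (simp add: B.m_assoc)
    also have "\<dots> = p (adj Op a \<cdot> ?g) \<otimes> p a" using \<xi> a by (simp add: t_inner F.adj_mult F.m_assoc)
    also have "\<dots> = p (adj Op a \<cdot> ?g \<cdot> a)" using a c by (intro p.hom_mult[symmetric]) auto
    finally show ?thesis using \<xi> a by (simp add: F.m_assoc)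
  qed
  have yx: "adj B ?y \<otimes> ?x = p (adj Op a \<cdot> (?g \<cdot> a))"
  proof -
    have "adj B ?y \<otimes> ?x = p (adj Op a) \<otimes> (adj B (t \<xi>) \<otimes> ?x)"
      using \<xi> a c by (simp add: B.adj_mult B.m_assoc p.hom_adj)
    also have "\<dots> = p (adj Op a) \<otimes> p (?g \<cdot> a)" using \<xi> a by (simp add: t_inner F.m_assoc)
    also have "\<dots> = p (adj Op a \<cdot> (?g \<cdot> a))" using a c by (intro p.hom_mult[symmetric]) auto
    finally show ?thesis .
  qed
  have yy: "adj B ?y \<otimes> ?y = p (adj Op a \<cdot> (?g \<cdot> a))"
  proof -
    have "adj B ?y \<otimes> ?y = p (adj Op a) \<otimes> ((adj B (t \<xi>) \<otimes> t \<xi>) \<otimes> p a)"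
      using \<xi> a by (simp add: B.adj_mult B.m_assoc p.hom_adj)
    also have "\<dots> = p (adj Op a) \<otimes> p (?g \<cdot> a)"
      unfolding t_inner[OF \<xi> \<xi>] using a c by (simp only: p.hom_mult)
    also have "\<dots> = p (adj Op a \<cdot> (?g \<cdot> a))" using a c by (intro p.hom_mult[symmetric]) auto
    finally show ?thesis .
  qed
  have "adj B (?x \<ominus> ?y) \<otimes> (?x \<ominus> ?y) =
      (adj B ?x \<otimes> ?x \<ominus> adj B ?y \<otimes> ?x) \<ominus> (adj B ?x \<otimes> ?y \<ominus> adj B ?y \<otimes> ?y)"
  proof -
    have "adj B (?x \<ominus> ?y) = adj B ?x \<ominus> adj B ?y"
      using c(1,2) by (simp only: B.diff_eq_smult B.adj_add B.adj_smult B.smult_in B.adj_closed) simp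
    then show ?thesis using c(1,2) by (simp only: B.mult_diff_left B.mult_diff_right B.adj_closed B.M.minus_closed)
  qed
  also have "\<dots> = \<zero>"
  proof -
    have z: "h \<ominus> h = \<zero>" if "h \<in> carrier B" for h
      using that by (simp add: B.minus_eq B.M.r_neg)
    have "p (adj Op a \<cdot> (?g \<cdot> a)) \<in> carrier B" using a c by simp
    from z[OF this] show ?thesis unfolding xx xy yx yy by (simp only: z[OF B.zero_closed])
  qed
  finally have "?x \<ominus> ?y = \<zero>" 
    by (rule B.eq_zero_of_adj_mult[rotated]) (use c(1,2) in \<open>simp only: B.M.minus_closed\<close>)
  then show ?thesis using c B.n_diff_eq_0[of ?x ?y] by simp
qed

lemma t_finsum:
  assumes "finite J" "\<And>i. i \<in> J \<Longrightarrow> f i \<in> carrier E"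
  shows "t (\<Oplus>\<^bsub>Op\<^esub>i\<in>J. f i) = (\<Oplus>i\<in>J. t (f i))"
  using assms
proof (induction J)
  case empty
  then show ?case using t_smult[of "\<zero>\<^bsub>Op\<^esub>" 0] by simp
qed (auto simp: Pi_iff t_add)

text \<open>The unit of \<open>A\<close> acts as a unit on the generators, hence on everything they generate.\<close>

lemma p_one:
  assumes gen: "generated_cstar B (p ` A \<union> t ` carrier E) = carrier B"
  shows "p \<one>\<^bsub>Op\<^esub> = \<one>"
proof -
  let ?e = "p \<one>\<^bsub>Op\<^esub>"
  have e: "?e \<in> carrier B" "adj B ?e = ?e" using p.hom_adj[OF one_in_A] by simp_all
  let ?V = "{x \<in> carrier B. ?e \<otimes> x = x} \<inter> {x \<in> carrier B. x \<otimes> ?e = x}"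
  have "B.closed_set {x \<in> carrier B. ?e \<otimes> x = x}"
  proof (rule closed_set_eq[OF B.normed_module_axioms B.normed_module_axioms B.closed_set_carrier])
    fix x y assume "x \<in> carrier B" "y \<in> carrier B"
    then show "nrm B (?e \<otimes> x \<ominus> ?e \<otimes> y) \<le> nrm B ?e * nrm B (x \<ominus> y)"
      "nrm B (x \<ominus> y) \<le> 1 * nrm B (x \<ominus> y)"
      using B.nrm_mult[of ?e "x \<ominus> y"] e by (simp_all add: B.mult_diff_right)
  qed (use e in auto)
  moreover have "B.closed_set {x \<in> carrier B. x \<otimes> ?e = x}"
  proof (rule closed_set_eq[OF B.normed_module_axioms B.normed_module_axioms B.closed_set_carrier])
    fix x y assume "x \<in> carrier B" "y \<in> carrier B"
    then show "nrm B (x \<otimes> ?e \<ominus> y \<otimes> ?e) \<le> nrm B ?e * nrm B (x \<ominus> y)"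
      "nrm B (x \<ominus> y) \<le> 1 * nrm B (x \<ominus> y)"
      using B.nrm_mult[of "x \<ominus> y" ?e] e by (simp_all add: B.mult_diff_left mult.commute)
  qed (use e in auto)
  ultimately have cl: "B.closed_set ?V" by (rule closedin_Int)
  have "cstar_subalgebra B ?V"
    unfolding B.cstar_subalgebra_iff
  proof (intro conjI ballI allI cl)
    fix x assume x: "x \<in> ?V"
    show "c \<odot> x \<in> ?V" for c using x e by (auto simp: B.smult_mult_left B.smult_mult_right)
    have "?e \<otimes> adj B x = adj B x" "adj B x \<otimes> ?e = adj B x"
      using x e B.adj_mult[of x ?e, symmetric] B.adj_mult[of ?e x, symmetric] by simp_all
    then show "adj B x \<in> ?V" using x by auto
    fix y assume y: "y \<in> ?V"
    show "x \<oplus> y \<in> ?V" using x y e by (auto simp: B.l_distr B.r_distr)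
    have "?e \<otimes> (x \<otimes> y) = x \<otimes> y" "(x \<otimes> y) \<otimes> ?e = x \<otimes> y"
      using x y e B.m_assoc[of ?e x y, symmetric] B.m_assoc[of x y ?e] by simp_all
    then show "x \<otimes> y \<in> ?V" using x y by auto
  qed (use e in auto)
  moreover have "p ` A \<union> t ` carrier E \<subseteq> ?V"
  proof -
    have "p a \<in> ?V" if "a \<in> A" for a
      using that p.hom_mult[OF one_in_A that] p.hom_mult[OF that one_in_A] by simp
    moreover have "t \<xi> \<in> ?V" if "\<xi> \<in> carrier E" for \<xi>
      using that t_lact[OF that one_in_A] t_ract[OF that one_in_A] by simp
    ultimately show ?thesis by blast
  qed
  ultimately have "carrier B \<subseteq> ?V" using B.generated_cstar_least gen by blast
  then have "\<one> \<in> ?V" by blast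
  then show ?thesis using e by simp
qed

lemma source_proj_t:
  assumes one: "p \<one>\<^bsub>Op\<^esub> = \<one>" and w: "w \<in> words d"
  shows "p (P w) = source_proj B (\<lambda>i. t (T i)) w"
  using w
proof (induction w rule: rev_induct)
  case Nil
  then show ?case using one by simp
next
  case (snoc i w)
  then have i: "i \<in> {1..d}" and w: "w \<in> words d" by (auto simp: words_def)
  have "p (P (w @ [i])) = p (adj Op (T i) \<cdot> (P w \<cdot> T i))"
    by (simp add: F.m_assoc flip: conj_shift_P)
  also have "\<dots> = adj B (t (T i)) \<otimes> t (P w \<cdot> T i)"
    using i by (intro t_inner[symmetric] E_lact_closed shift_in_E P_in_A)
  also have "t (P w \<cdot> T i) = p (P w) \<otimes> t (T i)"
    using i by (intro t_lact shift_in_E P_in_A)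
  also have "adj B (t (T i)) \<otimes> (p (P w) \<otimes> t (T i)) =
      adj B (t (T i)) \<otimes> source_proj B (\<lambda>i. t (T i)) w \<otimes> t (T i)"
    unfolding snoc.IH[OF w, symmetric]
    using i by (intro B.m_assoc[symmetric] B.adj_closed t_closed shift_in_E p.hom_closed P_in_A)
  also have "\<dots> = source_proj B (\<lambda>i. t (T i)) (w @ [i])"
    using w i by (intro B.source_proj_snoc[symmetric] funcsetI t_closed shift_in_E) (auto simp: words_def)
  finally show ?case .
qed

end

section \<open>From the relations to covariant representations\<close>

text \<open>Relations (i) to (iii), with the homomorphism of (i) named. Relation (iv) enters as the equation
  \<open>p support_proj = range_sum\<close>.\<close>

locale relations_rep = factor_closed_language d L + B: pre_cstar_algebra B
  for d :: nat and L :: "nat list set" and B :: "('b, 'k) cstar_scheme" (structure) +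
  fixes s :: "nat \<Rightarrow> 'b" and p :: "((nat list \<Rightarrow> complex) \<Rightarrow> nat list \<Rightarrow> complex) \<Rightarrow> 'b"
  assumes s_iso: "i \<in> {1..d} \<Longrightarrow> partial_isometry B (s i)"
    and p_hom: "p \<in> star_hom (coeff_algebra L) B"
    and p_source: "w \<in> words d \<Longrightarrow> p (P w) = source_proj B s w"
    and s_orth: "\<lbrakk>i \<in> {1..d}; j \<in> {1..d}; i \<noteq> j\<rbrakk> \<Longrightarrow> adj B (s j) \<otimes> s i = \<zero>"
    and s_comm: "\<lbrakk>w \<in> L; i \<in> {1..d}\<rbrakk> \<Longrightarrow> source_proj B s w \<otimes> (s i \<otimes> adj B (s i)) =
      (s i \<otimes> adj B (s i)) \<otimes> source_proj B s w"
begin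

sublocale p: subalgebra_hom Op B A p
  by unfold_locales (use subalg_A p_hom coeff_algebra_eq in auto)

lemma s_in [simp]: "i \<in> {1..d} \<Longrightarrow> s i \<in> carrier B"
  using s_iso B.partial_isometryD(1) by blast

lemma s_fun: "w \<in> words d \<Longrightarrow> s \<in> set w \<rightarrow> carrier B"
  using s_in by (auto simp: words_def simp del: s_in)

lemma p_one: "p \<one>\<^bsub>Op\<^esub> = \<one>"
  using p_source[of "[]"] by (simp add: words_def)

lemma p_bounded: "a \<in> A \<Longrightarrow> nrm B (p a) \<le> 2 * nrm Op a"
  by (rule p.hom_bounded[OF one_in_A p_one diagonal_sqrt[OF subalg_A A_diagonal one_in_A]])

lemma p_lipschitz:
  "\<lbrakk>a \<in> A; b \<in> A\<rbrakk> \<Longrightarrow> nrm B (p a \<ominus> p b) \<le> 2 * nrm Op (a \<ominus>\<^bsub>Op\<^esub> b)"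
  by (rule p.hom_lipschitz[OF p_bounded])

lemma L_snoc_words: "w \<in> L \<Longrightarrow> i \<in> {1..d} \<Longrightarrow> w @ [i] \<in> words d"
  using L_words by (auto simp: words_def)

text \<open>The relation \<open>a T\<^sub>i = T\<^sub>i (T\<^sub>i\<^sup>* a T\<^sub>i)\<close> is inherited by \<open>s\<^sub>i\<close>. It amounts to two conditions
  on \<open>a\<close>: \<open>p a\<close> commutes with \<open>s\<^sub>i s\<^sub>i\<^sup>*\<close>, and \<open>s\<^sub>i\<^sup>* (p a) s\<^sub>i = p (T\<^sub>i\<^sup>* a T\<^sub>i)\<close>. The first defines a
  C*-subalgebra, on which both sides of the second are multiplicative in \<open>a\<close>, so that the two
  together define a C*-subalgebra. By (iii) it contains the \<open>P\<^sub>w\<close>.\<close>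

lemma p_s:
  assumes a: "a \<in> A" and i: "i \<in> {1..d}"
  shows "p a \<otimes> s i = s i \<otimes> p (conj_shift i a)"
proof -
  let ?s = "s i" and ?e = "s i \<otimes> adj B (s i)"
  note [simp] = s_in[OF i] conj_shift_in_A
  have es: "?e \<otimes> ?s = ?s" by (rule B.partial_isometryD(2)[OF s_iso[OF i]])
  let ?C = "{a \<in> A. p a \<in> {x \<in> carrier B. \<forall>m\<in>{?e}. m \<otimes> x = x \<otimes> m}}"
  have C: "cstar_subalgebra Op ?C"
    by (rule p.cstar_subalgebra_preimage[OF p_bounded], assumption, rule B.cstar_subalgebra_commutant)
      (auto simp: B.adj_mult)
  have Ce: "p a \<otimes> ?s = ?e \<otimes> (p a \<otimes> ?s)" if "a \<in> ?C" for a
  proof -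
    have c: "a \<in> A" "?e \<otimes> p a = p a \<otimes> ?e" using that by auto
    have "p a \<otimes> ?s = (p a \<otimes> ?e) \<otimes> ?s"
      using es c(1) B.m_assoc[of "p a" ?e ?s] by simp
    also have "\<dots> = ?e \<otimes> (p a \<otimes> ?s)"
      unfolding c(2)[symmetric] using c(1) by (intro B.m_assoc) auto
    finally show ?thesis .
  qed
  define f where "f x = adj B ?s \<otimes> (p x \<otimes> ?s)" for x
  let ?V = "{a \<in> ?C. f a = p (conj_shift i a)}"
  have VA: "\<And>a. a \<in> ?V \<Longrightarrow> a \<in> A" by simp
  have fC: "f x \<in> carrier B" if "x \<in> A" for x using that by (simp add: f_def)
  have f_mult: "f (x \<cdot> y) = f x \<otimes> f y" if x: "x \<in> ?C" and y: "y \<in> ?C" for x y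
  proof -
    have A: "x \<in> A" "y \<in> A" using x y by auto
    have "f (x \<cdot> y) = adj B ?s \<otimes> (p x \<otimes> (p y \<otimes> ?s))"
      using A by (simp add: f_def p.hom_mult B.m_assoc)
    also have "\<dots> = adj B ?s \<otimes> (p x \<otimes> (?e \<otimes> (p y \<otimes> ?s)))"
      using Ce[OF y] by simp
    also have "\<dots> = f x \<otimes> f y" using A by (simp add: f_def B.m_assoc)
    finally show ?thesis .
  qed
  have "cstar_subalgebra Op ?V"
    unfolding F.cstar_subalgebra_iff
  proof (intro conjI ballI allI)
    have clC: "F.closed_set ?C" using C by (simp only: cstar_subalgebra_def)
    show "F.closed_set ?V"
    proof (rule closed_set_eq[OF F.normed_module_axioms B.normed_module_axioms clC])
      fix x y assume "x \<in> ?C" "y \<in> ?C"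
      then have xy: "x \<in> A" "y \<in> A" by auto
      have "nrm B (f x \<ominus> f y) = nrm B (adj B ?s \<otimes> ((p x \<ominus> p y) \<otimes> ?s))"
        using xy by (simp add: f_def B.mult_diff_left B.mult_diff_right)
      also have "\<dots> \<le> nrm B (adj B ?s) * (2 * nrm Op (x \<ominus>\<^bsub>Op\<^esub> y) * nrm B ?s)"
        using xy p_lipschitz[OF xy] by (intro B.nrm_mult_le) auto
      finally show "nrm B (f x \<ominus> f y) \<le> (nrm B (adj B ?s) * 2 * nrm B ?s) * nrm Op (x \<ominus>\<^bsub>Op\<^esub> y)"
        by (simp add: mult_ac)
      show "nrm B (p (conj_shift i x) \<ominus> p (conj_shift i y)) \<le>
          (2 * nrm Op (T i) * nrm Op (T i)) * nrm Op (x \<ominus>\<^bsub>Op\<^esub> y)"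
        using p_lipschitz[of "conj_shift i x" "conj_shift i y"] nrm_conj_shift_le[of "x \<ominus>\<^bsub>Op\<^esub> y" i] xy
        by (simp add: conj_shift_diff mult_ac)
    qed (use fC in auto)
    show "?V \<subseteq> carrier Op" by auto
    have C0: "\<zero>\<^bsub>Op\<^esub> \<in> ?C" and Cadd: "\<And>x y. x \<in> ?C \<Longrightarrow> y \<in> ?C \<Longrightarrow> x \<oplus>\<^bsub>Op\<^esub> y \<in> ?C"
      and Csmult: "\<And>c x. x \<in> ?C \<Longrightarrow> c \<odot>\<^bsub>Op\<^esub> x \<in> ?C" and Cadj: "\<And>x. x \<in> ?C \<Longrightarrow> adj Op x \<in> ?C"
      and Cmult: "\<And>x y. x \<in> ?C \<Longrightarrow> y \<in> ?C \<Longrightarrow> x \<cdot> y \<in> ?C"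
      using C unfolding F.cstar_subalgebra_iff by blast+
    show "\<zero>\<^bsub>Op\<^esub> \<in> ?V" using C0 by (simp add: f_def)
    fix x assume x: "x \<in> ?V"
    then have xC: "x \<in> ?C" and fx: "f x = p (conj_shift i x)" and xA: "x \<in> A" by auto
    have "f (c \<odot>\<^bsub>Op\<^esub> x) = p (conj_shift i (c \<odot>\<^bsub>Op\<^esub> x))" for c
      unfolding conj_shift_smult[OF A_in_Op[OF xA]] using xA fx
      by (simp add: f_def p.hom_smult B.smult_mult_left B.smult_mult_right)
    then show "c \<odot>\<^bsub>Op\<^esub> x \<in> ?V" for c using Csmult[OF xC] by blast
    have "f (adj Op x) = adj B (f x)" using xA by (simp add: f_def p.hom_adj B.adj_mult B.m_assoc)
    also have "\<dots> = p (conj_shift i (adj Op x))"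
      unfolding conj_shift_adj[OF A_in_Op[OF xA]] fx using xA by (intro p.hom_adj[symmetric]) simp
    finally show "adj Op x \<in> ?V" using Cadj[OF xC] by blast
    fix y assume y: "y \<in> ?V"
    then have yC: "y \<in> ?C" and fy: "f y = p (conj_shift i y)" and yA: "y \<in> A" by auto
    have "f (x \<oplus>\<^bsub>Op\<^esub> y) = f x \<oplus> f y"
      using xA yA by (simp add: f_def p.hom_add B.l_distr B.r_distr)
    also have "\<dots> = p (conj_shift i (x \<oplus>\<^bsub>Op\<^esub> y))"
      unfolding conj_shift_add[OF A_in_Op[OF xA] A_in_Op[OF yA]] fx fy
      using xA yA by (intro p.hom_add[symmetric]) auto
    finally show "x \<oplus>\<^bsub>Op\<^esub> y \<in> ?V" using Cadd[OF xC yC] by blast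
    have "f (x \<cdot> y) = p (conj_shift i (x \<cdot> y))"
      unfolding f_mult[OF xC yC] conj_shift_mult[OF xA yA] fx fy
      using xA yA by (intro p.hom_mult[symmetric]) auto
    then show "x \<cdot> y \<in> ?V" using Cmult[OF xC yC] by blast
  qed
  then have "A \<subseteq> ?V"
  proof (rule A_least)
    fix w assume w: "w \<in> L"
    have ww: "w \<in> words d" "w @ [i] \<in> words d" using w L_words L_snoc_words[OF w i] by auto
    have "source_proj B s w \<in> carrier B" using s_fun[OF ww(1)] by (rule B.source_proj_closed)
    moreover have "source_proj B s (w @ [i]) = adj B ?s \<otimes> source_proj B s w \<otimes> ?s"
      using s_fun[OF ww(1)] by (intro B.source_proj_snoc) auto
    ultimately show "P w \<in> ?V"
      using s_comm[OF w i] ww by (simp add: f_def conj_shift_P p_source B.m_assoc)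
  qed
  then have "a \<in> ?V" using a by blast
  then have aC: "a \<in> ?C" and fa: "f a = p (conj_shift i a)" by auto
  have "p a \<otimes> ?s = ?s \<otimes> f a"
    using Ce[OF aC] a by (simp add: f_def B.m_assoc)
  then show ?thesis by (simp only: fa)
qed

text \<open>Forced by \<open>E_frame\<close> and \<open>t (T\<^sub>i a) = s\<^sub>i (p a)\<close>.\<close>

definition t :: "((nat list \<Rightarrow> complex) \<Rightarrow> nat list \<Rightarrow> complex) \<Rightarrow> 'b" where
  "t \<xi> = (\<Oplus>i\<in>{1..d}. s i \<otimes> p (adj Op (T i) \<cdot> \<xi>))"

lemma t_closed [simp]: "\<xi> \<in> carrier E \<Longrightarrow> t \<xi> \<in> carrier B"
  unfolding t_def by (intro B.finsum_closed) auto

lemma t_add: "\<xi> \<in> carrier E \<Longrightarrow> \<eta> \<in> carrier E \<Longrightarrow> t (\<xi> \<oplus>\<^bsub>Op\<^esub> \<eta>) = t \<xi> \<oplus> t \<eta>"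
proof -
  assume a: "\<xi> \<in> carrier E" "\<eta> \<in> carrier E"
  have "t (\<xi> \<oplus>\<^bsub>Op\<^esub> \<eta>) = (\<Oplus>i\<in>{1..d}. s i \<otimes> p (adj Op (T i) \<cdot> \<xi>) \<oplus>
      s i \<otimes> p (adj Op (T i) \<cdot> \<eta>))"
    unfolding t_def using a
    by (intro B.finsum_cong') (auto simp: F.r_distr p.hom_add B.r_distr)
  also have "\<dots> = t \<xi> \<oplus> t \<eta>"
    unfolding t_def using a by (intro B.finsum_addf) auto
  finally show ?thesis .
qed

lemma t_smult: "\<xi> \<in> carrier E \<Longrightarrow> t (c \<odot>\<^bsub>Op\<^esub> \<xi>) = c \<odot> t \<xi>"
  unfolding t_def
  by (subst B.smult_finsum) (auto simp: F.smult_mult_right p.hom_smult B.smult_mult_right intro!: B.finsum_cong')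

lemma adj_shift_shift_adj: "(adj Op (T i) \<cdot> T i) \<cdot> adj Op (T i) = adj Op (T i)"
  using arg_cong[OF shift_partial_isometry[of i], of "adj Op"] by (simp add: F.adj_mult F.m_assoc)

lemma adj_s_t:
  assumes \<xi>: "\<xi> \<in> carrier E" and i: "i \<in> {1..d}"
  shows "adj B (s i) \<otimes> t \<xi> = p (adj Op (T i) \<cdot> \<xi>)"
proof -
  let ?c = "\<lambda>j. adj Op (T j) \<cdot> \<xi>"
  have "adj B (s i) \<otimes> t \<xi> = (\<Oplus>j\<in>{1..d}. adj B (s i) \<otimes> (s j \<otimes> p (?c j)))"
    unfolding t_def using \<xi> i by (intro B.finsum_rdistr) auto
  also have "\<dots> = adj B (s i) \<otimes> (s i \<otimes> p (?c i))"
  proof (rule B.finsum_single[OF finite_atLeastAtMost i])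
    fix j assume j: "j \<in> {1..d}"
    show "adj B (s i) \<otimes> (s j \<otimes> p (?c j)) \<in> carrier B"
      using \<xi> i j by (intro B.m_closed B.adj_closed s_in p.hom_closed coord_in_A)
    assume "j \<noteq> i"
    then have "(adj B (s i) \<otimes> s j) \<otimes> p (?c j) = \<zero>"
      using s_orth[OF j i] \<xi> i j by simp
    then show "adj B (s i) \<otimes> (s j \<otimes> p (?c j)) = \<zero>"
      using \<xi> i j by (subst B.m_assoc[symmetric]) auto
  qed
  also have "\<dots> = p (P [i]) \<otimes> p (?c i)"
    using \<xi> i p_source[of "[i]"] by (simp add: B.source_proj_single words_def B.m_assoc)
  also have "\<dots> = p (P [i] \<cdot> ?c i)"
    using \<xi> i by (simp add: p.hom_mult)
  also have "P [i] \<cdot> ?c i = (adj Op (T i) \<cdot> T i) \<cdot> adj Op (T i) \<cdot> \<xi>"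
    using \<xi> by (simp add: F.source_proj_single F.m_assoc)
  also have "\<dots> = ?c i" by (simp only: adj_shift_shift_adj)
  finally show ?thesis .
qed

lemma t_shift: 
  assumes i: "i \<in> {1..d}"
  shows "t (T i) = s i"
proof -
  have "t (T i) = s i \<otimes> p (adj Op (T i) \<cdot> T i)"
    unfolding t_def
  proof (rule B.finsum_single[OF finite_atLeastAtMost i])
    fix j assume j: "j \<in> {1..d}"
    show "s j \<otimes> p (adj Op (T j) \<cdot> T i) \<in> carrier B"
      using i j by (intro B.m_closed s_in p.hom_closed coord_in_A shift_in_E)
    assume "j \<noteq> i"
    then show "s j \<otimes> p (adj Op (T j) \<cdot> T i) = \<zero>"
      using j by (simp add: adj_shift_shift)
  qed
  also have "p (adj Op (T i) \<cdot> T i) = adj B (s i) \<otimes> s i"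
    using p_source[of "[i]"] i by (simp add: words_def B.source_proj_single F.source_proj_single)
  finally show ?thesis using B.partial_isometryD(3)[OF s_iso[OF i]] by simp
qed

lemma t_inner:
  assumes \<xi>: "\<xi> \<in> carrier E" and \<eta>: "\<eta> \<in> carrier E"
  shows "adj B (t \<xi>) \<otimes> t \<eta> = p (adj Op \<xi> \<cdot> \<eta>)"
proof -
  let ?c = "\<lambda>\<xi> i. adj Op (T i) \<cdot> \<xi>"
  have "adj B (t \<xi>) = (\<Oplus>i\<in>{1..d}. adj B (s i \<otimes> p (?c \<xi> i)))"
    unfolding t_def using \<xi> by (intro B.adj_finsum) auto
  also have "\<dots> \<otimes> t \<eta> = (\<Oplus>i\<in>{1..d}. adj B (s i \<otimes> p (?c \<xi> i)) \<otimes> t \<eta>)"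
    using \<xi> \<eta> by (intro B.finsum_ldistr) auto
  also have "\<dots> = (\<Oplus>i\<in>{1..d}. p (adj Op (?c \<xi> i) \<cdot> ?c \<eta> i))"
  proof (rule B.finsum_cong')
    fix i assume i: "i \<in> {1..d}"
    have "adj B (s i \<otimes> p (?c \<xi> i)) \<otimes> t \<eta> = adj B (p (?c \<xi> i)) \<otimes> (adj B (s i) \<otimes> t \<eta>)"
      using \<xi> \<eta> i by (simp add: B.adj_mult B.m_assoc)
    also have "\<dots> = p (adj Op (?c \<xi> i)) \<otimes> p (?c \<eta> i)"
      using adj_s_t[OF \<eta> i] p.hom_adj[OF coord_in_A[OF \<xi> i]] by simp
    also have "\<dots> = p (adj Op (?c \<xi> i) \<cdot> ?c \<eta> i)"
      using \<xi> \<eta> i by (intro p.hom_mult[symmetric] A_closed coord_in_A)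
    finally show "adj B (s i \<otimes> p (?c \<xi> i)) \<otimes> t \<eta> = p (adj Op (?c \<xi> i) \<cdot> ?c \<eta> i)" .
  next
    show "(\<lambda>i. p (adj Op (?c \<xi> i) \<cdot> ?c \<eta> i)) \<in> {1..d} \<rightarrow> carrier B"
      using \<xi> \<eta> by (intro funcsetI p.hom_closed A_closed coord_in_A)
  qed simp
  also have "\<dots> = p (\<Oplus>\<^bsub>Op\<^esub>i\<in>{1..d}. adj Op (?c \<xi> i) \<cdot> ?c \<eta> i)"
    using \<xi> \<eta> by (intro p.hom_finsum(1)[symmetric] A_closed coord_in_A) auto
  also have "\<dots> = p (adj Op \<xi> \<cdot> \<eta>)" using E_aip_frame[OF \<xi> \<eta>] by simp
  finally show ?thesis .
qed

lemma t_lact: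
  assumes \<xi>: "\<xi> \<in> carrier E" and a: "a \<in> A"
  shows "p a \<otimes> t \<xi> = t (a \<cdot> \<xi>)"
proof -
  let ?c = "\<lambda>i. adj Op (T i) \<cdot> \<xi>"
  have "p a \<otimes> t \<xi> = (\<Oplus>i\<in>{1..d}. p a \<otimes> (s i \<otimes> p (?c i)))"
    unfolding t_def using \<xi> a by (intro B.finsum_rdistr) auto
  also have "\<dots> = t (a \<cdot> \<xi>)"
    unfolding t_def
  proof (rule B.finsum_cong')
    fix i assume i: "i \<in> {1..d}"
    have "p a \<otimes> (s i \<otimes> p (?c i)) = (p a \<otimes> s i) \<otimes> p (?c i)"
      using \<xi> a i by (simp add: B.m_assoc)
    also have "\<dots> = s i \<otimes> (p (conj_shift i a) \<otimes> p (?c i))"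
      unfolding p_s[OF a i] using \<xi> i conj_shift_in_A[OF a] by (intro B.m_assoc s_in p.hom_closed coord_in_A)
    also have "p (conj_shift i a) \<otimes> p (?c i) = p (conj_shift i a \<cdot> ?c i)"
      using \<xi> i conj_shift_in_A[OF a] by (intro p.hom_mult[symmetric] coord_in_A)
    also have "conj_shift i a \<cdot> ?c i = (conj_shift i a \<cdot> adj Op (T i)) \<cdot> \<xi>"
      using \<xi> conj_shift_in_A[OF a, of i] by (intro F.m_assoc[symmetric] A_in_Op E_in_Op adj_shift_in)
    also have "\<dots> = adj Op (T i) \<cdot> (a \<cdot> \<xi>)"
      unfolding adj_shift_A[OF a, symmetric] using \<xi> a by (intro F.m_assoc) auto
    finally show "p a \<otimes> (s i \<otimes> p (?c i)) = s i \<otimes> p (adj Op (T i) \<cdot> (a \<cdot> \<xi>))" .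
  next
    show "(\<lambda>i. s i \<otimes> p (adj Op (T i) \<cdot> (a \<cdot> \<xi>))) \<in> {1..d} \<rightarrow> carrier B"
      using \<xi> a by (intro funcsetI B.m_closed s_in p.hom_closed coord_in_A E_lact_closed)
  qed simp
  finally show ?thesis .
qed

lemma corr_rep_t: "corr_rep E B p t"
  unfolding corr_rep_def E_simps
  using p_hom t_closed t_add t_smult t_inner t_lact by (auto simp: left_op_apply)

sublocale C: corr_representation d L B p t
  by unfold_locales (rule corr_rep_t)

lemma t_op:
  assumes S: "S \<in> carrier LE" and \<xi>: "\<xi> \<in> carrier E"
  shows "t (S \<xi>) = (\<Oplus>i\<in>{1..d}. t (S (T i)) \<otimes> p (adj Op (T i) \<cdot> \<xi>))"
proof -
  have "t (S \<xi>) = (\<Oplus>i\<in>{1..d}. t (S (T i) \<cdot> (adj Op (T i) \<cdot> \<xi>)))"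
    unfolding adjointable_frame[OF S \<xi>] by (rule C.t_finsum) (use S \<xi> in auto)
  also have "\<dots> = (\<Oplus>i\<in>{1..d}. t (S (T i)) \<otimes> p (adj Op (T i) \<cdot> \<xi>))"
    using S \<xi> by (intro B.finsum_cong') (auto simp: C.t_ract)
  finally show ?thesis .
qed

text \<open>Forced by \<open>S = \<Sum> \<Theta>(S T\<^sub>i, T\<^sub>i)\<close>, which is \<open>adjointable_frame\<close>.\<close>

definition psi :: "(((nat list \<Rightarrow> complex) \<Rightarrow> nat list \<Rightarrow> complex) \<Rightarrow> (nat list \<Rightarrow> complex) \<Rightarrow> nat list \<Rightarrow> complex) \<Rightarrow> 'b" where
  "psi S = (\<Oplus>i\<in>{1..d}. t (S (T i)) \<otimes> adj B (s i))"

abbreviation range_sum :: 'b where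
  "range_sum \<equiv> (\<Oplus>i\<in>{1..d}. s i \<otimes> adj B (s i))"

lemma range_sum_closed [simp]: "range_sum \<in> carrier B"
  by (intro B.finsum_closed) auto

lemma range_sum_t:
  assumes \<xi>: "\<xi> \<in> carrier E"
  shows "range_sum \<otimes> t \<xi> = t \<xi>"
proof -
  have "range_sum \<otimes> t \<xi> = (\<Oplus>i\<in>{1..d}. s i \<otimes> adj B (s i) \<otimes> t \<xi>)"
    using \<xi> by (intro B.finsum_ldistr) auto
  also have "\<dots> = (\<Oplus>i\<in>{1..d}. s i \<otimes> p (adj Op (T i) \<cdot> \<xi>))"
    using \<xi> by (intro B.finsum_cong') (auto simp: B.m_assoc adj_s_t)
  also have "\<dots> = t \<xi>" by (simp only: t_def)
  finally show ?thesis .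
qed

lemma adj_range_sum: "adj B range_sum = range_sum"
  by (subst B.adj_finsum) (auto simp: B.adj_mult intro!: B.finsum_cong')

lemma adj_t_range_sum:
  assumes \<xi>: "\<xi> \<in> carrier E"
  shows "adj B (t \<xi>) \<otimes> range_sum = adj B (t \<xi>)"
  using arg_cong[OF range_sum_t[OF \<xi>], of "adj B"] \<xi> by (simp add: B.adj_mult adj_range_sum)

lemma psi_closed [simp]: "S \<in> carrier LE \<Longrightarrow> psi S \<in> carrier B"
  unfolding psi_def by (intro B.finsum_closed) auto

lemma psi_t:
  assumes S: "S \<in> carrier LE" and \<xi>: "\<xi> \<in> carrier E"
  shows "psi S \<otimes> t \<xi> = t (S \<xi>)"
proof -
  have "psi S \<otimes> t \<xi> = (\<Oplus>i\<in>{1..d}. t (S (T i)) \<otimes> adj B (s i) \<otimes> t \<xi>)"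
    unfolding psi_def using S \<xi> by (intro B.finsum_ldistr) auto
  also have "\<dots> = t (S \<xi>)"
    unfolding t_op[OF S \<xi>] using S \<xi> by (intro B.finsum_cong') (auto simp: B.m_assoc adj_s_t)
  finally show ?thesis .
qed

lemma adj_psi:
  assumes S: "S \<in> carrier LE"
  shows "adj B (psi S) = (\<Oplus>i\<in>{1..d}. s i \<otimes> adj B (t (S (T i))))"
  unfolding psi_def using S by (subst B.adj_finsum) (auto simp: B.adj_mult intro!: B.finsum_cong')

lemma adj_psi_t:
  assumes S: "S \<in> carrier LE" and \<xi>: "\<xi> \<in> carrier E"
  shows "adj B (psi S) \<otimes> t \<xi> = t (adj LE S \<xi>)"
proof -
  have aS: "adj LE S \<xi> \<in> carrier E" using adj_LE(1)[OF S] \<xi> by simp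
  have "adj B (psi S) \<otimes> t \<xi> = (\<Oplus>i\<in>{1..d}. s i \<otimes> adj B (t (S (T i))) \<otimes> t \<xi>)"
    unfolding adj_psi[OF S] using S \<xi> by (intro B.finsum_ldistr) auto
  also have "\<dots> = (\<Oplus>i\<in>{1..d}. s i \<otimes> p (adj Op (T i) \<cdot> adj LE S \<xi>))"
  proof (rule B.finsum_cong')
    fix i assume i: "i \<in> {1..d}"
    have "adj B (t (S (T i))) \<otimes> t \<xi> = p (adj Op (T i) \<cdot> adj LE S \<xi>)"
      using t_inner[of "S (T i)" \<xi>] adj_LE(2)[OF S shift_in_E[OF i] \<xi>] S \<xi> i by simp
    then show "s i \<otimes> adj B (t (S (T i))) \<otimes> t \<xi> = s i \<otimes> p (adj Op (T i) \<cdot> adj LE S \<xi>)"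
      using S \<xi> i by (simp add: B.m_assoc)
  qed (use aS in auto)
  also have "\<dots> = t (adj LE S \<xi>)" by (simp add: t_def)
  finally show ?thesis .
qed

text \<open>The frame formula gives \<open>(psi S)\<^sup>* range_sum\<close> for the left hand side; the factor \<open>range_sum\<close> is
  absorbed because it acts as a unit on the range of \<open>t\<close>.\<close>

lemma psi_adj:
  assumes S: "S \<in> carrier LE"
  shows "psi (adj LE S) = adj B (psi S)"
proof -
  have "psi (adj LE S) = (\<Oplus>i\<in>{1..d}. adj B (psi S) \<otimes> (s i \<otimes> adj B (s i)))"
    unfolding psi_def[of "adj LE S"]
  proof (rule B.finsum_cong')
    fix i assume i: "i \<in> {1..d}"
    have "t (adj LE S (T i)) = adj B (psi S) \<otimes> s i"
      using adj_psi_t[OF S shift_in_E[OF i]] t_shift[OF i] by simp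
    then show "t (adj LE S (T i)) \<otimes> adj B (s i) = adj B (psi S) \<otimes> (s i \<otimes> adj B (s i))"
      using S i by (simp add: B.m_assoc)
  qed (use S in auto)
  also have "\<dots> = adj B (psi S) \<otimes> range_sum"
    using S by (intro B.finsum_rdistr[symmetric]) auto
  also have "\<dots> = (\<Oplus>i\<in>{1..d}. s i \<otimes> adj B (t (S (T i))) \<otimes> range_sum)"
    unfolding adj_psi[OF S] using S by (intro B.finsum_ldistr) auto
  also have "\<dots> = adj B (psi S)"
    unfolding adj_psi[OF S] using S
    by (intro B.finsum_cong') (auto simp: B.m_assoc adj_t_range_sum)
  finally show ?thesis .
qed

lemma psi_mult:
  assumes S: "S \<in> carrier LE" and R: "R \<in> carrier LE"
  shows "psi (compose (carrier E) S R) = psi S \<otimes> psi R"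
proof -
  have "psi (compose (carrier E) S R) = (\<Oplus>i\<in>{1..d}. psi S \<otimes> (t (R (T i)) \<otimes> adj B (s i)))"
    unfolding psi_def[of "compose (carrier E) S R"]
  proof (rule B.finsum_cong')
    fix i assume i: "i \<in> {1..d}"
    have "t (compose (carrier E) S R (T i)) = psi S \<otimes> t (R (T i))"
      using psi_t[OF S, of "R (T i)"] R i by (simp add: compose_def)
    then show "t (compose (carrier E) S R (T i)) \<otimes> adj B (s i) =
        psi S \<otimes> (t (R (T i)) \<otimes> adj B (s i))"
      using S R i by (simp add: B.m_assoc)
  qed (use S R in auto)
  also have "\<dots> = psi S \<otimes> psi R"
    unfolding psi_def[of R] using S R by (intro B.finsum_rdistr[symmetric]) auto
  finally show ?thesis .
qed

lemma psi_rank_one: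
  assumes \<xi>: "\<xi> \<in> carrier E" and \<eta>: "\<eta> \<in> carrier E"
  shows "psi (rank_one E \<xi> \<eta>) = t \<xi> \<otimes> adj B (t \<eta>)"
proof -
  have c: "adj Op \<eta> \<cdot> T i = adj Op (adj Op (T i) \<cdot> \<eta>)" for i
    using \<eta> by (simp add: F.adj_mult)
  have "psi (rank_one E \<xi> \<eta>) = (\<Oplus>i\<in>{1..d}. t \<xi> \<otimes> adj B (s i \<otimes> p (adj Op (T i) \<cdot> \<eta>)))"
    unfolding psi_def
  proof (rule B.finsum_cong')
    fix i assume i: "i \<in> {1..d}"
    have "t (rank_one E \<xi> \<eta> (T i)) = t \<xi> \<otimes> adj B (p (adj Op (T i) \<cdot> \<eta>))"
      unfolding rank_one_apply[OF shift_in_E[OF i]] c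
      using \<xi> coord_in_A[OF \<eta> i] by (simp add: C.t_ract p.hom_adj)
    then show "t (rank_one E \<xi> \<eta> (T i)) \<otimes> adj B (s i) =
        t \<xi> \<otimes> adj B (s i \<otimes> p (adj Op (T i) \<cdot> \<eta>))"
      using \<xi> coord_in_A[OF \<eta> i] i by (simp add: B.adj_mult B.m_assoc)
  qed (use \<xi> \<eta> in auto)
  also have "\<dots> = t \<xi> \<otimes> (\<Oplus>i\<in>{1..d}. adj B (s i \<otimes> p (adj Op (T i) \<cdot> \<eta>)))"
    using \<xi> \<eta> by (intro B.finsum_rdistr[symmetric]) auto
  also have "\<dots> = t \<xi> \<otimes> adj B (t \<eta>)"
    unfolding t_def[of \<eta>] using \<eta> by (subst B.adj_finsum) auto
  finally show ?thesis .
qed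

lemma induced_psi: "induced_on_compacts E B t psi"
proof -
  have "psi (S \<oplus>\<^bsub>LE\<^esub> R) = psi S \<oplus> psi R" if S: "S \<in> carrier LE" and R: "R \<in> carrier LE" for S R
  proof -
    have "psi (S \<oplus>\<^bsub>LE\<^esub> R) = (\<Oplus>i\<in>{1..d}. t (S (T i)) \<otimes> adj B (s i) \<oplus> t (R (T i)) \<otimes> adj B (s i))"
      unfolding psi_def using S R
      by (intro B.finsum_cong') (auto simp: LE.op_algebra_simps E_simps t_add B.l_distr)
    also have "\<dots> = psi S \<oplus> psi R"
      unfolding psi_def using S R by (intro B.finsum_addf) auto
    finally show ?thesis .
  qed
  moreover have "psi (c \<odot>\<^bsub>LE\<^esub> S) = c \<odot> psi S" if S: "S \<in> carrier LE" for c S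
    unfolding psi_def using S
    by (subst B.smult_finsum)
      (auto simp: LE.op_algebra_simps E_simps t_smult B.smult_mult_left intro!: B.finsum_cong')
  ultimately show ?thesis
    unfolding induced_on_compacts_def star_hom_def compact_ops_simps
    by (auto simp: compact_in_LE psi_mult psi_adj psi_rank_one)
qed

lemma psi_left_op:
  assumes a: "a \<in> A"
  shows "psi (left_op E a) = p a \<otimes> range_sum"
proof -
  have "psi (left_op E a) = (\<Oplus>i\<in>{1..d}. p a \<otimes> (s i \<otimes> adj B (s i)))"
    unfolding psi_def
  proof (rule B.finsum_cong')
    fix i assume i: "i \<in> {1..d}"
    have "t (left_op E a (T i)) = p a \<otimes> s i"
      using t_lact[OF shift_in_E[OF i] a] t_shift[OF i] i by (simp add: left_op_apply)
    then show "t (left_op E a (T i)) \<otimes> adj B (s i) = p a \<otimes> (s i \<otimes> adj B (s i))"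
      using a i by (simp add: B.m_assoc)
  qed (use a in auto)
  also have "\<dots> = p a \<otimes> range_sum"
    using a by (intro B.finsum_rdistr[symmetric]) auto
  finally show ?thesis .
qed

text \<open>Elements of \<open>J\<^sub>E\<close> absorb \<open>support_proj\<close>, so covariance on \<open>J\<^sub>E\<close> follows from covariance at this
  single element.\<close>

lemma covariant_rep_t:
  assumes "p support_proj = range_sum"
  shows "covariant_rep E B p t"
  unfolding covariant_rep_def
proof (intro conjI corr_rep_t exI[of _ psi] induced_psi ballI)
  fix a assume a: "a \<in> katsura_ideal E"
  note k = katsura_mult_support_proj[OF a]
  have "p a = p (a \<cdot> support_proj)" using k by simp
  also have "\<dots> = p a \<otimes> range_sum" using k(1) assms by (simp only: p.hom_mult support_proj_in_A)
  finally show "p a = psi (left_op E a)" using psi_left_op[OF k(1)] by simp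
qed

text \<open>The right hand side does not mention \<open>\<mu>\<close>, so (iv) for one killing tuple implies it for all.\<close>

lemma relation_iv_at_iff:
  assumes "killing_tuple d L \<mu>"
  shows "relation_iv_at d B s \<mu> \<longleftrightarrow> p support_proj = range_sum"
proof -
  have "map (\<lambda>i. source_proj B s (\<mu> i)) [1..<Suc d] = map p (map (\<lambda>i. P (\<mu> i)) [1..<Suc d])"
    using assms L_words by (auto simp: killing_tuple_def p_source subset_iff)
  then have "list_prod B (map (\<lambda>i. source_proj B s (\<mu> i)) [1..<Suc d]) =
      p (list_prod Op (map (\<lambda>i. P (\<mu> i)) [1..<Suc d]))"
    by (simp only:, subst p.hom_list_prod(1)[OF one_in_A p_one]) auto
  also have "\<dots> = p vacuum" using killing_tuple_prod[OF assms] by simp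
  finally show ?thesis
    using assms p.hom_diff[OF one_in_A vacuum_in_A[OF assms]] p_one
    by (auto simp: relation_iv_at_def support_proj_def)
qed

lemma monomial_relations_iff: 
  "monomial_relations d L B s \<longleftrightarrow> p support_proj = range_sum"
proof -
  have pi: "\<exists>\<pi>\<in>star_hom (coeff_algebra L) B. \<forall>\<mu>\<in>words d. \<pi> (P \<mu>) = source_proj B s \<mu>"
    using p_hom p_source by blast
  have "(if \<exists>\<mu>. killing_tuple d L \<mu>
      then \<exists>\<mu>. killing_tuple d L \<mu> \<and> relation_iv_at d B s \<mu>
      else \<one> = range_sum) \<longleftrightarrow> p support_proj = range_sum"
  proof (cases "\<exists>\<mu>. killing_tuple d L \<mu>")
    case True
    then show ?thesis using relation_iv_at_iff by auto
  next
    case False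
    then have "support_proj = \<one>\<^bsub>Op\<^esub>" unfolding support_proj_def by (simp only: if_False)
    then show ?thesis using False p_one by auto
  qed
  then show ?thesis
    unfolding monomial_relations_def using s_iso pi s_orth s_comm by auto
qed

end

context factor_closed_language
begin

lemma relations_repI:
  assumes "pre_cstar_algebra B" and rel: "monomial_relations d L B s"
  shows "\<exists>p. relations_rep d L B s p"
proof -
  interpret B: pre_cstar_algebra B by fact
  obtain p where p: "p \<in> star_hom (coeff_algebra L) B" "\<And>\<mu>. \<mu> \<in> words d \<Longrightarrow> p (P \<mu>) = source_proj B s \<mu>"
    using rel unfolding monomial_relations_def by blast
  have "relations_rep d L B s p"
    using rel p unfolding monomial_relations_def by unfold_locales auto
  then show ?thesis by blast
qed

end

section \<open>From covariant representations to the relations\<close>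

context corr_representation
begin

text \<open>For (iii): \<open>p (P w) s\<^sub>i s\<^sub>i\<^sup>* = s\<^sub>i p (T\<^sub>i\<^sup>* P\<^sub>w T\<^sub>i) s\<^sub>i\<^sup>*\<close> is self-adjoint, so its two factors commute.\<close>

lemma relations_rep_t:
  assumes one: "p \<one>\<^bsub>Op\<^esub> = \<one>"
  shows "relations_rep d L B (\<lambda>i. t (T i)) p"
proof unfold_locales
  fix i assume i: "i \<in> {1..d}"
  have tc: "t (T i) \<in> carrier B" using i by simp
  have pA: "adj Op (T i) \<cdot> T i \<in> A" using i by simp
  have "t (T i) = t (T i \<cdot> (adj Op (T i) \<cdot> T i))" by (simp only: shift_partial_isometry)
  also have "\<dots> = t (T i) \<otimes> (adj B (t (T i)) \<otimes> t (T i))"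
    using i pA by (simp only: t_ract shift_in_E t_inner)
  finally show "partial_isometry B (t (T i))"
    using tc by (simp add: partial_isometry_def B.m_assoc)
  show "adj B (t (T j)) \<otimes> t (T i) = \<zero>" if "j \<in> {1..d}" "i \<noteq> j" for j
    using that i by (simp add: t_inner adj_shift_shift)
  fix w assume w: "w \<in> L"
  have src: "source_proj B (\<lambda>i. t (T i)) w = p (P w)"
    using source_proj_t[OF one] w L_words by auto
  let ?c = "conj_shift i (P w)"
  have cA: "?c \<in> A" by (rule conj_shift_in_A) simp
  have ca: "adj B (p ?c) = p ?c"
    using p.hom_adj[OF cA] conj_shift_adj[OF P_in_Op, of i w] F.source_proj_adj[of T w] by simp
  have pa: "adj B (p (P w)) = p (P w)"
    using p.hom_adj[OF P_in_A, of w] F.source_proj_adj[of T w] by simp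
  have "p (P w) \<otimes> t (T i) = t (P w \<cdot> T i)"
    by (rule t_lact[OF shift_in_E[OF i] P_in_A, symmetric])
  also have "\<dots> = t (T i \<cdot> ?c)" by (simp only: A_shift[OF P_in_A])
  also have "\<dots> = t (T i) \<otimes> p ?c" by (rule t_ract[OF shift_in_E[OF i] cA])
  finally have l: "p (P w) \<otimes> t (T i) = t (T i) \<otimes> p ?c" .
  have "adj B (p (P w) \<otimes> t (T i)) = adj B (t (T i) \<otimes> p ?c)" using l by simp
  then have r: "adj B (t (T i)) \<otimes> p (P w) = p ?c \<otimes> adj B (t (T i))"
    using tc cA ca pa by (simp only: B.adj_mult p.hom_closed P_in_A)
  have "p (P w) \<otimes> (t (T i) \<otimes> adj B (t (T i))) = t (T i) \<otimes> p ?c \<otimes> adj B (t (T i))"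
    unfolding l[symmetric] using tc by (intro B.m_assoc[symmetric]) auto
  also have "\<dots> = t (T i) \<otimes> (adj B (t (T i)) \<otimes> p (P w))"
    unfolding r using tc cA by (intro B.m_assoc) auto
  also have "\<dots> = t (T i) \<otimes> adj B (t (T i)) \<otimes> p (P w)"
    using tc by (intro B.m_assoc[symmetric]) auto
  finally show "source_proj B (\<lambda>i. t (T i)) w \<otimes> (t (T i) \<otimes> adj B (t (T i))) =
      t (T i) \<otimes> adj B (t (T i)) \<otimes> source_proj B (\<lambda>i. t (T i)) w"
    unfolding src .
next
  fix w assume "w \<in> words d"
  then show "p (P w) = source_proj B (\<lambda>i. t (T i)) w" by (rule source_proj_t[OF one])
qed (rule p_hom)

text \<open>Covariance at \<open>support_proj\<close>, whose left action is \<open>\<Sum> \<Theta>(T\<^sub>i, T\<^sub>i)\<close>.\<close>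

lemma covariant_range_sum:
  assumes "covariant_rep E B p t"
  shows "p support_proj = (\<Oplus>i\<in>{1..d}. t (T i) \<otimes> adj B (t (T i)))"
proof -
  obtain \<psi> where \<psi>: "\<psi> \<in> star_hom (compact_ops E) B"
      "\<And>\<xi> \<eta>. \<xi> \<in> carrier E \<Longrightarrow> \<eta> \<in> carrier E \<Longrightarrow> \<psi> (rank_one E \<xi> \<eta>) = t \<xi> \<otimes> adj B (t \<eta>)"
      "p support_proj = \<psi> (left_op E support_proj)"
    using assms support_proj_katsura unfolding covariant_rep_def induced_on_compacts_def by blast
  have add: "\<psi> (S \<oplus>\<^bsub>LE\<^esub> R) = \<psi> S \<oplus> \<psi> R"
    if "S \<in> carrier (compact_ops E)" "R \<in> carrier (compact_ops E)" for S R
    using \<psi>(1) that unfolding star_hom_def compact_ops_simps by blast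
  have cl: "\<psi> S \<in> carrier B" if "S \<in> carrier (compact_ops E)" for S
    using \<psi>(1) that unfolding star_hom_def by blast
  have sum: "\<psi> (\<Oplus>\<^bsub>LE\<^esub>i\<in>J. f i) = (\<Oplus>i\<in>J. \<psi> (f i))"
    if "finite J" "\<And>i. i \<in> J \<Longrightarrow> f i \<in> carrier (compact_ops E)" for J :: "nat set" and f
    using that
  proof (induction J)
    case empty
    have z: "\<zero>\<^bsub>LE\<^esub> \<in> carrier (compact_ops E)" using finsum_compact[of "{}"] by simp
    then have "\<psi> (0 \<odot>\<^bsub>LE\<^esub> \<zero>\<^bsub>LE\<^esub>) = 0 \<odot> \<psi> \<zero>\<^bsub>LE\<^esub>"
      using \<psi>(1) unfolding star_hom_def compact_ops_simps by blast
    then show ?case using cl[OF z] by simp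
  next
    case (insert i J)
    have "\<psi> (\<Oplus>\<^bsub>LE\<^esub>i\<in>insert i J. f i) = \<psi> (f i \<oplus>\<^bsub>LE\<^esub> (\<Oplus>\<^bsub>LE\<^esub>i\<in>J. f i))"
      using insert by (subst LE.M.finsum_insert) (auto simp: compact_in_LE)
    also have "\<dots> = \<psi> (f i) \<oplus> (\<Oplus>i\<in>J. \<psi> (f i))"
      using insert finsum_compact[of J f] by (subst add) auto
    also have "\<dots> = (\<Oplus>i\<in>insert i J. \<psi> (f i))"
      using insert cl by (subst B.finsum_insert) auto
    finally show ?case .
  qed
  have "p support_proj = \<psi> (\<Oplus>\<^bsub>LE\<^esub>i\<in>{1..d}. rank_one E (support_proj \<cdot> T i) (T i))"
    using \<psi>(3) left_op_eq_finsum[OF support_proj_in_A] by simp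
  also have "\<dots> = \<psi> (\<Oplus>\<^bsub>LE\<^esub>i\<in>{1..d}. rank_one E (T i) (T i))"
    by (simp only: support_proj_shift)
  also have "\<dots> = (\<Oplus>i\<in>{1..d}. \<psi> (rank_one E (T i) (T i)))"
    by (rule sum) (auto intro: rank_one_compact)
  also have "\<dots> = (\<Oplus>i\<in>{1..d}. t (T i) \<otimes> adj B (t (T i)))"
    by (intro B.finsum_cong') (auto simp: \<psi>(2))
  finally show ?thesis .
qed

text \<open>A subalgebra \<open>V\<close> containing the \<open>t (T i)\<close> contains the \<open>p (P w)\<close> for nonempty \<open>w\<close>. By hypothesis it
  contains \<open>p support_proj\<close>; adding a product of such \<open>p (P w)\<close> if there is a killing tuple gives the
  unit. The words of a killing tuple are nonempty because all letters are allowed. Now \<open>V\<close> contains \<open>p ` A\<close> by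
  continuity, and the range of \<open>t\<close> by the frame expansion.\<close>

lemma generated_by_shifts:
  assumes gen: "generated_cstar B (p ` A \<union> t ` carrier E) = carrier B"
    and range_sum: "p support_proj = (\<Oplus>i\<in>{1..d}. t (T i) \<otimes> adj B (t (T i)))"
  shows "generated_cstar B ((\<lambda>i. t (T i)) ` {1..d}) = carrier B"
proof (rule B.generated_cstar_eq_carrier)
  show "(\<lambda>i. t (T i)) ` {1..d} \<subseteq> carrier B" by auto
  fix V assume sV: "(\<lambda>i. t (T i)) ` {1..d} \<subseteq> V" and V: "cstar_subalgebra B V"
  note one = p_one[OF gen]
  interpret R: relations_rep d L B "\<lambda>i. t (T i)" p by (rule relations_rep_t[OF one])
  have Vc: "V \<subseteq> carrier B" and V0: "\<zero> \<in> V" and Vadd: "\<And>x y. x \<in> V \<Longrightarrow> y \<in> V \<Longrightarrow> x \<oplus> y \<in> V"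
    and Vsmult: "\<And>c x. x \<in> V \<Longrightarrow> c \<odot> x \<in> V" and Vcl: "norm_closed B V"
    and Vadj: "\<And>x. x \<in> V \<Longrightarrow> adj B x \<in> V" and Vmult: "\<And>x y. x \<in> V \<Longrightarrow> y \<in> V \<Longrightarrow> x \<otimes> y \<in> V"
    using V unfolding B.cstar_subalgebra_iff by blast+
  have Vsub: "submodule V Cx B" using V by (simp add: cstar_subalgebra_def)
  have s: "t (T i) \<in> V" if "i \<in> {1..d}" for i using sV that by auto
  have src: "p (P w) \<in> V" if w: "w \<in> words d" "w \<noteq> []" for w
  proof -
    have "word_prod B (\<lambda>i. t (T i)) w \<in> V"
      unfolding word_prod_def
      by (rule B.list_prod_in[OF Vmult Vc]) (use w s in \<open>auto simp: words_def subset_iff\<close>)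
    then show ?thesis
      unfolding source_proj_t[OF one w(1)] unfolding source_proj_def by (intro Vmult Vadj)
  qed
  have rs: "p support_proj \<in> V"
    unfolding range_sum by (rule B.finsum_in_submodule[OF Vsub]) (simp, intro Vmult Vadj s)
  have oneV: "\<one> \<in> V"
  proof (cases "\<exists>\<mu>. killing_tuple d L \<mu>")
    case True
    then obtain \<mu> where \<mu>: "killing_tuple d L \<mu>" by blast
    have ne: "p (P (\<mu> i)) \<in> V" if i: "i \<in> {1..d}" for i
    proof (rule src)
      show "\<mu> i \<in> words d" using \<mu> i L_words by (auto simp: killing_tuple_def)
      show "\<mu> i \<noteq> []"
      proof
        assume "\<mu> i = []"
        moreover have "\<mu> i @ [i] \<notin> L" using \<mu> i unfolding killing_tuple_def by blast
        ultimately show False using single_in[OF i] by simp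
      qed
    qed
    have "p vacuum = list_prod B (map p (map (\<lambda>i. P (\<mu> i)) [1..<Suc d]))"
      unfolding killing_tuple_prod[OF \<mu>, symmetric] by (rule p.hom_list_prod[OF one_in_A one]) auto
    also have "\<dots> \<in> V"
    proof (rule B.list_prod_in[OF Vmult Vc])
      show "set (map p (map (\<lambda>i. P (\<mu> i)) [1..<Suc d])) \<subseteq> V" using ne by auto
      show "map p (map (\<lambda>i. P (\<mu> i)) [1..<Suc d]) \<noteq> []" using d_pos by simp
    qed
    finally have vV: "p vacuum \<in> V" .
    have vA: "vacuum \<in> A" by (rule vacuum_in_A[OF \<mu>])
    have "support_proj = \<one>\<^bsub>Op\<^esub> \<ominus>\<^bsub>Op\<^esub> vacuum" using \<mu> by (auto simp: support_proj_def)
    then have "support_proj \<oplus>\<^bsub>Op\<^esub> vacuum = \<one>\<^bsub>Op\<^esub>" by (simp add: F.diff_add_cancel)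
    then have "p support_proj \<oplus> p vacuum = \<one>"
      using one p.hom_add[OF support_proj_in_A vA] by simp
    then show ?thesis using Vadd[OF rs vV] by simp
  next
    case False
    then have "support_proj = \<one>\<^bsub>Op\<^esub>" unfolding support_proj_def by (simp only: if_False)
    then show ?thesis using rs one by simp
  qed
  let ?W = "{a \<in> A. p a \<in> V}"
  have "cstar_subalgebra Op ?W"
    by (rule p.cstar_subalgebra_preimage[OF R.p_bounded V])
  then have "A \<subseteq> ?W"
  proof (rule A_least)
    fix w assume "w \<in> L"
    then show "P w \<in> ?W" using src[of w] oneV one L_words by (cases "w = []") auto
  qed
  then have pV: "p a \<in> V" if "a \<in> A" for a using that by blast
  have tV: "t \<xi> \<in> V" if \<xi>: "\<xi> \<in> carrier E" for \<xi>
  proof -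
    have "t \<xi> = t (\<Oplus>\<^bsub>Op\<^esub>i\<in>{1..d}. T i \<cdot> (adj Op (T i) \<cdot> \<xi>))" by (simp only: E_frame[OF \<xi>])
    also have "\<dots> = (\<Oplus>i\<in>{1..d}. t (T i \<cdot> (adj Op (T i) \<cdot> \<xi>)))"
      by (rule t_finsum) (use \<xi> in auto)
    also have "\<dots> \<in> V"
    proof (rule B.finsum_in_submodule[OF Vsub])
      fix i assume i: "i \<in> {1..d}"
      show "t (T i \<cdot> (adj Op (T i) \<cdot> \<xi>)) \<in> V"
        unfolding t_ract[OF shift_in_E[OF i] coord_in_A[OF \<xi> i]]
        by (intro Vmult s i pV coord_in_A \<xi>)
    qed simp
    finally show ?thesis .
  qed
  have "generated_cstar B (p ` A \<union> t ` carrier E) \<subseteq> V"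
    by (rule B.generated_cstar_least[OF _ V]) (use pV tV in auto)
  then show "carrier B \<subseteq> V" using gen by simp
qed

end

section \<open>The universal property\<close>

context factor_closed_language
begin

text \<open>Representations of the relations on a Hilbert space are the same as covariant representations,
  with \<open>s\<^sub>i\<close> corresponding to the image of \<open>T\<^sub>i\<close>.\<close>

theorem cuntz_pimsner_universal:
  fixes Q :: "'q cstar"
  assumes cp: "cuntz_pimsner_algebra TYPE('h) E Q \<pi> \<tau>"
  shows "universal_for_relations TYPE('h) d L Q (\<lambda>i. \<tau> (T i))"
proof -
  have Q: "unital_cstar_algebra Q" and cov: "covariant_rep E Q \<pi> \<tau>"
    and gen: "generated_cstar Q (\<pi> ` A \<union> \<tau> ` carrier E) = carrier Q"
    and univ: "\<And>(H :: 'h hilb) p t. \<lbrakk>hilbert_space H; covariant_rep E (bounded_ops H) p t\<rbrakk> \<Longrightarrow>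
        \<exists>\<rho>\<in>star_hom Q (bounded_ops H). (\<forall>a\<in>A. \<rho> (\<pi> a) = p a) \<and> (\<forall>\<xi>\<in>carrier E. \<rho> (\<tau> \<xi>) = t \<xi>)"
    using cp unfolding cuntz_pimsner_algebra_def E_simps by blast+
  interpret Q: pre_cstar_algebra Q by (rule unital_cstar_algebra_imp_pre[OF Q])
  interpret Q: corr_representation d L Q \<pi> \<tau>
    by unfold_locales (use cov in \<open>simp add: covariant_rep_def\<close>)
  note rs = Q.covariant_range_sum[OF cov]
  interpret QR: relations_rep d L Q "\<lambda>i. \<tau> (T i)" \<pi>
    by (rule Q.relations_rep_t[OF Q.p_one[OF gen]])
  have rel: "monomial_relations d L Q (\<lambda>i. \<tau> (T i))"
    unfolding QR.monomial_relations_iff by (rule rs)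
  have "\<exists>\<rho>\<in>star_hom Q (bounded_ops H). \<forall>i\<in>{1..d}. \<rho> (\<tau> (T i)) = s i"
    if H: "hilbert_space H" and s: "monomial_relations d L (bounded_ops H) s" for H :: "'h hilb" and s
  proof -
    obtain p where p: "relations_rep d L (bounded_ops H) s p"
      using relations_repI[OF pre_cstar_bounded_ops[OF H] s] by blast
    interpret R: relations_rep d L "bounded_ops H" s p by (rule p)
    have "covariant_rep E (bounded_ops H) p R.t"
      by (rule R.covariant_rep_t) (use s R.monomial_relations_iff in blast)
    from univ[OF H this] obtain \<rho> where "\<rho> \<in> star_hom Q (bounded_ops H)"
        "\<And>\<xi>. \<xi> \<in> carrier E \<Longrightarrow> \<rho> (\<tau> \<xi>) = R.t \<xi>"
      by blast
    then show ?thesis using R.t_shift shift_in_E by (intro bexI[of _ \<rho>]) auto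
  qed
  then show ?thesis
    unfolding universal_for_relations_def
    using Q rel Q.generated_by_shifts[OF gen rs] by blast
qed

lemma relation_iv_every_tuple:
  assumes "unital_cstar_algebra B" "monomial_relations d L B s" "killing_tuple d L \<mu>"
  shows "relation_iv_at d B s \<mu>"
proof -
  obtain p where "relations_rep d L B s p"
    using relations_repI[OF unital_cstar_algebra_imp_pre[OF assms(1)] assms(2)] by blast
  then interpret R: relations_rep d L B s p .
  show ?thesis
    using assms(2) R.relation_iv_at_iff[OF assms(3)] R.monomial_relations_iff by blast
qed

end

section \<open>The words outside a monomial ideal\<close>

lemma ring_free_algebra: "ring (free_algebra d)"
proof (rule ringI)
  let ?R = "free_algebra d"
  have words_append: "u @ v \<in> words d" if "u \<in> words d" "v \<in> words d" for u v
    using that by (auto simp: words_def)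
  show "abelian_group ?R"
  proof (rule abelian_groupI)
    fix p q assume "p \<in> carrier ?R" "q \<in> carrier ?R"
    then show "p \<oplus>\<^bsub>?R\<^esub> q \<in> carrier ?R"
      using keys_add[of p q] by (auto simp: free_algebra_def)
  next
    fix p assume "p \<in> carrier ?R"
    then show "\<exists>q\<in>carrier ?R. q \<oplus>\<^bsub>?R\<^esub> p = \<zero>\<^bsub>?R\<^esub>"
      by (intro bexI[of _ "- p"]) (auto simp: free_algebra_def)
  qed (auto simp: free_algebra_def add_ac)
  show "monoid ?R"
  proof (rule monoidI)
    fix p q assume pq: "p \<in> carrier ?R" "q \<in> carrier ?R"
    show "p \<otimes>\<^bsub>?R\<^esub> q \<in> carrier ?R"
      using keys_mult[of p q] pq
      by (fastforce simp: free_algebra_def plus_fword_def intro: words_append)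
  qed (auto simp: free_algebra_def mult.assoc words_def zero_fword_def)
qed (auto simp: free_algebra_def algebra_simps)

text \<open>Multiples of members are members, so factors of words outside the ideal are outside it. If \<open>d = 0\<close>, the only word has degree
  zero and there are no generators.\<close>

lemma factor_closed_language_monomial_ideal:
  assumes I: "monomial_ideal d I" and "I \<noteq> {0}"
  shows "factor_closed_language d (allowed_words d I)"
proof -
  let ?R = "free_algebra d"
  interpret R: ring ?R by (rule ring_free_algebra)
  obtain M where M: "M \<subseteq> {\<mu> \<in> words d. 2 \<le> length \<mu>}" and I_eq: "I = Idl\<^bsub>?R\<^esub> (monomial ` M)"
    using I unfolding monomial_ideal_def by blast
  have mon: "monomial \<mu> \<in> carrier ?R" if "\<mu> \<in> words d" for \<mu>
    using that by (simp add: free_algebra_def monomial_eq_single)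
  have sub: "monomial ` M \<subseteq> carrier ?R" using M mon by auto
  interpret I: ideal I ?R unfolding I_eq by (rule R.genideal_ideal[OF sub])
  have app: "monomial (u @ v) = monomial u \<otimes>\<^bsub>?R\<^esub> monomial v" for u v
    by (simp add: monomial_eq_single free_algebra_def mult_single plus_fword_def)
  \<comment> \<open>The polynomials without terms of degree below two form an ideal.\<close>
  let ?J = "{p \<in> carrier ?R. \<forall>w\<in>Poly_Mapping.keys p. 2 \<le> length (letters w)}"
  have "ideal ?J ?R"
  proof (rule idealI[OF R.ring_axioms])
    show "subgroup ?J (add_monoid ?R)"
    proof (rule group.subgroupI)
      show "Group.group (add_monoid ?R)" by (rule R.add.is_group)
      show "?J \<noteq> {}" by (auto simp: free_algebra_def intro!: exI[of _ 0])
      fix p assume p: "p \<in> ?J"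
      have "\<ominus>\<^bsub>?R\<^esub> p = - p"
        using p by (intro R.minus_equality) (auto simp: free_algebra_def)
      then have "inv\<^bsub>add_monoid ?R\<^esub> p = - p" by (simp add: a_inv_def)
      then show "inv\<^bsub>add_monoid ?R\<^esub> p \<in> ?J" using p by (simp add: free_algebra_def)
      fix q assume q: "q \<in> ?J"
      show "p \<otimes>\<^bsub>add_monoid ?R\<^esub> q \<in> ?J"
        using p q keys_add[of p q] by (auto simp: free_algebra_def)
    qed auto
    fix p x assume p: "p \<in> ?J" and x: "x \<in> carrier ?R"
    have "2 \<le> length (letters w)" if "w \<in> Poly_Mapping.keys (x * p) \<or> w \<in> Poly_Mapping.keys (p * x)" for w
      using that keys_mult[of x p] keys_mult[of p x] p
      by (force simp: plus_fword_def)
    then show "x \<otimes>\<^bsub>?R\<^esub> p \<in> ?J" "p \<otimes>\<^bsub>?R\<^esub> x \<in> ?J"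
      using p x R.m_closed[of x p] R.m_closed[of p x] by (auto simp: free_algebra_def)
  qed
  then have IJ: "I \<subseteq> ?J"
    unfolding I_eq by (rule R.genideal_minimal) (use M mon in \<open>auto simp: monomial_eq_single\<close>)
  have short: "\<mu> \<in> allowed_words d I" if "\<mu> \<in> words d" "length \<mu> < 2" for \<mu>
    using that IJ by (auto simp: allowed_words_def monomial_eq_single)
  show ?thesis
  proof
    show "allowed_words d I \<subseteq> words d" by (auto simp: allowed_words_def)
    show "[] \<in> allowed_words d I" by (rule short) (auto simp: words_def)
    show "[i] \<in> allowed_words d I" if "i \<in> {1..d}" for i
      by (rule short) (use that in \<open>auto simp: words_def\<close>)
    fix u v assume uv: "u @ v \<in> allowed_words d I"
    then have w: "u \<in> words d" "v \<in> words d" by (auto simp: allowed_words_def words_def)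
    show "u \<in> allowed_words d I"
      using uv w I.I_r_closed[of "monomial u" "monomial v"] mon[OF w(2)] by (auto simp: allowed_words_def app)
    show "v \<in> allowed_words d I"
      using uv w I.I_l_closed[of "monomial v" "monomial u"] mon[OF w(1)] by (auto simp: allowed_words_def app)
  next
    show "1 \<le> d"
    proof (rule ccontr)
      assume "\<not> 1 \<le> d"
      then have "words d = {[]}" by (auto simp: words_def)
      then have "M = {}" using M by auto
      then have "I \<subseteq> {\<zero>\<^bsub>?R\<^esub>}"
        unfolding I_eq by (intro R.genideal_minimal R.zeroideal) auto
      moreover have "\<zero>\<^bsub>?R\<^esub> \<in> I" by (rule I.zero_closed)
      ultimately show False using \<open>I \<noteq> {0}\<close> by (auto simp: free_algebra_def)
    qed
  qed
qed

theorem theorem6p8: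
  fixes d :: nat
    and I :: "(nat fword \<Rightarrow>\<^sub>0 complex) set"
    and Q :: "'q cstar"
    and \<pi>\<^sub>0 :: "((nat list \<Rightarrow> complex) \<Rightarrow> nat list \<Rightarrow> complex) \<Rightarrow> 'q"
    and t\<^sub>0 :: "((nat list \<Rightarrow> complex) \<Rightarrow> nat list \<Rightarrow> complex) \<Rightarrow> 'q"
  assumes "monomial_ideal d I"
    and "I \<noteq> {0}"
    and "cuntz_pimsner_algebra TYPE('h) (monomial_correspondence d (allowed_words d I)) Q \<pi>\<^sub>0 t\<^sub>0"
  shows "universal_for_relations TYPE('h) d (allowed_words d I) Q
           (\<lambda>i. t\<^sub>0 (shift (allowed_words d I) i)) \<and>
    (\<forall>(B :: 'b cstar) s \<mu>. unital_cstar_algebra B \<longrightarrow>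
       monomial_relations d (allowed_words d I) B s \<longrightarrow>
       killing_tuple d (allowed_words d I) \<mu> \<longrightarrow> relation_iv_at d B s \<mu>)"
proof -
  interpret factor_closed_language d "allowed_words d I"
    by (rule factor_closed_language_monomial_ideal[OF assms(1,2)])
  show ?thesis
    using cuntz_pimsner_universal[OF assms(3)] relation_iv_every_tuple by blast
qed

end
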